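(* Let $R=k[x_1,\ldots,x_d]$ be a polynomial ring over an infinite field $k$, $\mathfrak m=(x_1,\ldots,x_d)$, and let $I$ be an $\mathfrak m$-primary monomial ideal. For each $i$ let $n_i$ be the smallest power of $x_i$ lying in $I$ (that is, the least $n_i$ with $x_i^{n_i}\in I$), and write $\underline{\alpha}=x_1^{dn_1},\ldots,x_d^{dn_d}$. Let $J$ be an ideal generated by $d$ general $k$-linear combinations of the minimal monomial generators of $I$, and let $K=(J,\underline{\alpha})$. Then $$\mathrm{core}(I)=\mathrm{mono}(K)=(\underline{\alpha}):\mathrm{Mono}\big((\underline{\alpha}):K\big).$$
   Context: A monomial ideal is an ideal generated by monomials. A subideal $J$ of an ideal $I$ is a reduction of $I$ if $I^{r+1}=JI^r$ for some integer $r\ge 0$. $\mathrm{core}(I)$ is the intersection of all reductions of $I$. For an ideal $L$ of $R$, $\mathrm{mono}(L)$ denotes the largest monomial ideal contained in $L$, and $\mathrm{Mono}(L)$ the smallest monomial ideal containing $L$. "General" means: let $f_1,\ldots,f_m$ be the minimal monomial generators of $I$; there is a dense Zariski-open subset $U$ of the affine space $k^{dm}$ such that the assertion holds whenever $J$ is generated by $\sum_{j=1}^m\lambda_{ij}f_j$, $1\le i\le d$, with $(\lambda_{ij})\in U$. (Such an ideal $K$ is called a general locally minimal reduction of $I$.) *)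

theory Defs
  imports Complex_Main "HOL-Library.Poly_Mapping" "HOL-Library.FuncSet" "HOL-Library.Cardinality"
begin

section \<open>Ideals of a commutative ring\<close>

text \<open>Ideals are the submodules of the ring regarded as a module over itself.\<close>

global_interpretation ring_module: module "(*) :: 'a::comm_ring_1 \<Rightarrow> 'a \<Rightarrow> 'a"
  defines is_ideal = ring_module.subspace
    and ideal_gen = ring_module.span
  by standard (simp_all add: algebra_simps)

definition ideal_mult :: "'a::comm_ring_1 set \<Rightarrow> 'a set \<Rightarrow> 'a set"
  where "ideal_mult A B = ideal_gen {a * b | a b. a \<in> A \<and> b \<in> B}"

primrec ideal_power :: "'a::comm_ring_1 set \<Rightarrow> nat \<Rightarrow> 'a set"
  where
    "ideal_power A 0 = UNIV"
  | "ideal_power A (Suc r) = ideal_mult A (ideal_power A r)"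

definition ideal_colon :: "'a::comm_ring_1 set \<Rightarrow> 'a set \<Rightarrow> 'a set"
  where "ideal_colon A B = {r. \<forall>b\<in>B. r * b \<in> A}"

definition ideal_radical :: "'a::comm_ring_1 set \<Rightarrow> 'a set"
  where "ideal_radical A = {r. \<exists>n. r ^ n \<in> A}"

definition primary_ideal :: "'a::comm_ring_1 set \<Rightarrow> bool"
  where "primary_ideal Q \<longleftrightarrow> is_ideal Q \<and> Q \<noteq> UNIV \<and>
    (\<forall>a b. a * b \<in> Q \<longrightarrow> a \<in> Q \<or> (\<exists>n. b ^ n \<in> Q))"

definition primary_to :: "'a::comm_ring_1 set \<Rightarrow> 'a set \<Rightarrow> bool"
  where "primary_to P Q \<longleftrightarrow> primary_ideal Q \<and> ideal_radical Q = P"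

definition reduction_of :: "'a::comm_ring_1 set \<Rightarrow> 'a set \<Rightarrow> bool"
  where "reduction_of J I \<longleftrightarrow> is_ideal J \<and> J \<subseteq> I \<and>
    (\<exists>r. ideal_power I (r + 1) = ideal_mult J (ideal_power I r))"

definition ideal_core :: "'a::comm_ring_1 set \<Rightarrow> 'a set"
  where "ideal_core I = \<Inter>{J. reduction_of J I}"


section \<open>Polynomials and monomial ideals\<close>

text \<open>
  \<open>('v, 'k) mpoly\<close> is the polynomial ring over \<open>'k\<close> in the variables indexed by \<open>'v\<close>;
  a polynomial maps exponent vectors to coefficients, and its multiplication is convolution.
\<close>

type_synonym ('v, 'k) mpoly = "('v \<Rightarrow>\<^sub>0 nat) \<Rightarrow>\<^sub>0 'k"

definition mon :: "('v \<Rightarrow>\<^sub>0 nat) \<Rightarrow> ('v, 'k::comm_ring_1) mpoly"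
  where "mon a = Poly_Mapping.single a 1"

definition Var :: "'v \<Rightarrow> ('v, 'k::comm_ring_1) mpoly"
  where "Var i = mon (Poly_Mapping.single i 1)"

definition Const :: "'k \<Rightarrow> ('v, 'k::comm_ring_1) mpoly"
  where "Const c = Poly_Mapping.single 0 c"

definition monomial_ideal :: "('v, 'k::comm_ring_1) mpoly set \<Rightarrow> bool"
  where "monomial_ideal L \<longleftrightarrow> (\<exists>S \<subseteq> range mon. L = ideal_gen S)"

definition largest_monomial_subideal :: "('v, 'k::comm_ring_1) mpoly set \<Rightarrow> ('v, 'k) mpoly set"
  where "largest_monomial_subideal L = (GREATEST M. monomial_ideal M \<and> M \<subseteq> L)"

definition smallest_monomial_superideal :: "('v, 'k::comm_ring_1) mpoly set \<Rightarrow> ('v, 'k) mpoly set"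
  where "smallest_monomial_superideal L = (LEAST M. monomial_ideal M \<and> L \<subseteq> M)"

definition minimal_monomial_generators ::
    "('v, 'k::comm_ring_1) mpoly set \<Rightarrow> ('v, 'k) mpoly set \<Rightarrow> bool"
  where "minimal_monomial_generators G I \<longleftrightarrow>
    G \<subseteq> range mon \<and> ideal_gen G = I \<and> (\<forall>G'. G' \<subset> G \<longrightarrow> ideal_gen G' \<noteq> I)"

text \<open>
  The \<open>GREATEST\<close> and \<open>LEAST\<close> above are attained for every ideal \<open>L\<close>.
\<close>

lemma largest_monomial_subideal_eq:
  fixes L :: "('v, 'k::comm_ring_1) mpoly set"
  assumes "is_ideal L"
  shows "largest_monomial_subideal L = ideal_gen (L \<inter> range mon)"
  unfolding largest_monomial_subideal_def
proof (rule Greatest_equality)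
  show "monomial_ideal (ideal_gen (L \<inter> range mon)) \<and> ideal_gen (L \<inter> range mon) \<subseteq> L"
    using assms ring_module.span_minimal[of "L \<inter> range mon" L]
    by (auto simp: monomial_ideal_def)
next
  fix M :: "('v, 'k) mpoly set"
  assume "monomial_ideal M \<and> M \<subseteq> L"
  then obtain S where S: "S \<subseteq> range mon" "M = ideal_gen S" "M \<subseteq> L"
    by (auto simp: monomial_ideal_def)
  then have "S \<subseteq> L \<inter> range mon"
    using ring_module.span_superset[of S] by blast
  then show "M \<subseteq> ideal_gen (L \<inter> range mon)"
    using S ring_module.span_mono by blast
qed

lemma mpoly_eq_sum: "p = (\<Sum>a\<in>Poly_Mapping.keys p. Const (Poly_Mapping.lookup p a) * mon a)"
  for p :: "('v, 'k::comm_ring_1) mpoly"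
proof -
  have "Poly_Mapping.lookup (\<Sum>a\<in>Poly_Mapping.keys p. Const (Poly_Mapping.lookup p a) * mon a) b
      = Poly_Mapping.lookup p b" for b
    by (simp add: Const_def mon_def mult_single lookup_sum lookup_single when_def
        in_keys_iff)
  then show ?thesis
    by (intro poly_mapping_eqI) simp
qed

lemma monomial_ideal_keys:
  fixes M :: "('v, 'k::comm_ring_1) mpoly set"
  assumes "monomial_ideal M" "p \<in> M" "a \<in> Poly_Mapping.keys p"
  shows "mon a \<in> M"
proof -
  obtain S where S: "S \<subseteq> range mon" "M = ideal_gen S"
    using assms(1) by (auto simp: monomial_ideal_def)
  let ?N = "{p :: ('v, 'k) mpoly. \<forall>a\<in>Poly_Mapping.keys p. (mon a :: ('v, 'k) mpoly) \<in> M}"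
  have "is_ideal ?N"
  proof (rule ring_module.subspaceI)
    show "0 \<in> ?N" by simp
  next
    fix x y assume "x \<in> ?N" "y \<in> ?N"
    then show "x + y \<in> ?N"
      using keys_add[of x y] by blast
  next
    fix c x assume x: "x \<in> ?N"
    show "c * x \<in> ?N"
    proof safe
      fix a assume "a \<in> Poly_Mapping.keys (c * x)"
      then obtain u v where "a = u + v" "v \<in> Poly_Mapping.keys x"
        using keys_mult[of c x] by blast
      then have a: "(mon a :: ('v, 'k) mpoly) = mon u * mon v" and v: "(mon v :: ('v, 'k) mpoly) \<in> M"
        using x by (simp_all add: mon_def mult_single)
      show "(mon a :: ('v, 'k) mpoly) \<in> M"
        using v unfolding a S(2) by (rule ring_module.span_scale)
    qed
  qed
  moreover have "S \<subseteq> ?N"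
  proof
    fix s assume s: "s \<in> S"
    then obtain b where "s = mon b" using S(1) by blast
    moreover have "s \<in> M" using s S(2) ring_module.span_base by blast
    ultimately show "s \<in> ?N" by (auto simp: mon_def)
  qed
  ultimately have "M \<subseteq> ?N"
    using S(2) ring_module.span_minimal by blast
  then show ?thesis using assms by blast
qed

lemma smallest_monomial_superideal_eq:
  fixes L :: "('v, 'k::comm_ring_1) mpoly set"
  shows "smallest_monomial_superideal L = ideal_gen (mon ` (\<Union>p\<in>L. Poly_Mapping.keys p))"
  unfolding smallest_monomial_superideal_def
proof (rule Least_equality)
  let ?S = "mon ` (\<Union>p\<in>L. Poly_Mapping.keys p) :: ('v, 'k) mpoly set"
  have "p \<in> ideal_gen ?S" if "p \<in> L" for p
  proof -
    have "Const (Poly_Mapping.lookup p a) * mon a \<in> ideal_gen ?S" if "a \<in> Poly_Mapping.keys p" for a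
      by (rule ring_module.span_scale, rule ring_module.span_base) (use that \<open>p \<in> L\<close> in blast)
    then have "(\<Sum>a\<in>Poly_Mapping.keys p. Const (Poly_Mapping.lookup p a) * mon a) \<in> ideal_gen ?S"
      by (rule ring_module.span_sum)
    then show ?thesis
      by (simp only: mpoly_eq_sum[of p, symmetric])
  qed
  moreover have "monomial_ideal (ideal_gen ?S)"
    unfolding monomial_ideal_def by (intro exI[of _ ?S] conjI refl) auto
  ultimately show "monomial_ideal (ideal_gen ?S) \<and> L \<subseteq> ideal_gen ?S"
    by blast
next
  fix M :: "('v, 'k) mpoly set"
  assume M: "monomial_ideal M \<and> L \<subseteq> M"
  then have "mon ` (\<Union>p\<in>L. Poly_Mapping.keys p) \<subseteq> M"
    using monomial_ideal_keys by blast
  moreover have "is_ideal M"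
    using M by (auto simp: monomial_ideal_def)
  ultimately show "ideal_gen (mon ` (\<Union>p\<in>L. Poly_Mapping.keys p)) \<subseteq> M"
    by (rule ring_module.span_minimal)
qed


section \<open>The Zariski topology on affine space\<close>

text \<open>
  Affine space with coordinates indexed by a finite set \<open>X\<close>: the points are the functions
  \<open>X \<rightarrow> k\<close>, represented extensionally, and the closed sets are the zero loci of sets
  of polynomials in the variables from \<open>X\<close>.
\<close>

definition mpoly_eval :: "('x \<Rightarrow> 'k::comm_ring_1) \<Rightarrow> ('x, 'k) mpoly \<Rightarrow> 'k"
  where "mpoly_eval p F = (\<Sum>a\<in>Poly_Mapping.keys F.
    Poly_Mapping.lookup F a * (\<Prod>x\<in>Poly_Mapping.keys a. p x ^ Poly_Mapping.lookup a x))"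

definition affine_points :: "'x set \<Rightarrow> ('x \<Rightarrow> 'k::field) set"
  where "affine_points X = X \<rightarrow>\<^sub>E UNIV"

definition zariski_closed :: "'x set \<Rightarrow> ('x \<Rightarrow> 'k::field) set \<Rightarrow> bool"
  where "zariski_closed X Z \<longleftrightarrow>
    (\<exists>P. (\<forall>F\<in>P. \<forall>a\<in>Poly_Mapping.keys F. Poly_Mapping.keys a \<subseteq> X) \<and>
         Z = {p \<in> affine_points X. \<forall>F\<in>P. mpoly_eval p F = 0})"

definition zariski_open :: "'x set \<Rightarrow> ('x \<Rightarrow> 'k::field) set \<Rightarrow> bool"
  where "zariski_open X U \<longleftrightarrow> U \<subseteq> affine_points X \<and> zariski_closed X (affine_points X - U)"

definition zariski_dense :: "'x set \<Rightarrow> ('x \<Rightarrow> 'k::field) set \<Rightarrow> bool"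
  where "zariski_dense X U \<longleftrightarrow> U \<subseteq> affine_points X \<and>
    (\<forall>Z. zariski_closed X Z \<and> U \<subseteq> Z \<longrightarrow> Z = affine_points X)"

end

theory Submission
  imports Defs "HOL-Analysis.Determinants" "HOL-Computational_Algebra.Polynomial" "HOL-Computational_Algebra.Primes"
begin

text \<open>
  If \<open>d\<close> combinations \<open>g\<close> of the generators of \<open>I\<close> generate a reduction locally at the origin, then
  \<open>s * x_l ^ b_l = (\<Sum>j. M l j * g j)\<close> with \<open>s(0) \<noteq> 0\<close>, where \<open>s\<close> and \<open>M\<close> can be chosen polynomial in the
  coefficients \<open>\<lambda>\<close> of the combinations. By a theorem of Wiebe, \<open>y\<close> lies in the ideal of \<open>g\<close> locally at the
  origin iff \<open>det M * y\<close> lies in the ideal of the \<open>x_l ^ b_l\<close>. This is a closed condition on \<open>\<lambda>\<close>, so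
  a monomial lying in \<open>K\<close> for general \<open>\<lambda>\<close> lies in every reduction, once the powers
  \<open>x_i ^ (d * n i)\<close> are known to lie in every reduction; the latter is proved by reduction modulo
  primes. Conversely the general \<open>K\<close> is itself a reduction, and the core is a monomial ideal because
  it is invariant under the torus. The colon formula is Gorenstein duality modulo \<open>\<alpha>\<close>.
\<close>

text \<open>The d elements found in a given reduction have polynomial, not scalar, coefficients over
  the monomial generators. Hence \<lambda> is a system of indeterminates that may also be
  specialised to polynomials in x: a coefficient that vanishes at general scalars vanishes
  identically, and so at polynomial values too. Every reduction has its own s, M and b_l; two such
  choices are compared only through K, at a scalar point where both constant terms of s are nonzero.
  The powers in \<alpha> make this comparison global. J may have zeros away from the origin, whereas
  K contains all monomials of large degree, so any s with s(0) nonzero is a unit modulo K. The price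
  is a case of the Briancon-Skoda theorem for x_i ^ (d * n i); d comes from the pigeonhole
  principle: a product of d * q factors taken from d elements contains the q-th power of one of
  them. As k may have any characteristic, M and s have integer coefficients; at integer values one
  large prime detects a nonzero coefficient, and the resulting polynomial identity specialises to
  k.\<close>

abbreviation "lookup \<equiv> Poly_Mapping.lookup"
abbreviation "keys \<equiv> Poly_Mapping.keys"
abbreviation "single \<equiv> Poly_Mapping.single"

(* oriented against mult.assoc, so it loops with algebra_simps *)
declare ring_module.scale_scale [simp del]

section \<open>Polynomials and their evaluation\<close>

text \<open>Evaluations, coefficient maps and the constant term run between many different
  polynomial rings and get composed, so \<open>rhom h\<close> serves mostly as a fact about a
  particular map.\<close>

locale rhom =
  fixes h :: "'a::comm_ring_1 \<Rightarrow> 'b::comm_ring_1"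
  assumes add: "h (a + b) = h a + h b"
    and mult: "h (a * b) = h a * h b"
    and one [simp]: "h 1 = 1"
begin

lemma zero [simp]: "h 0 = 0"
  using add[of 0 0] by simp

lemma minus: "h (- a) = - h a"
  using add[of a "- a"] by (simp add: eq_neg_iff_add_eq_0 add.commute)

lemma diff: "h (a - b) = h a - h b"
  using add[of a "- b"] minus[of b] by simp

lemma sum: "h (sum f A) = (\<Sum>x\<in>A. h (f x))"
  by (induction A rule: infinite_finite_induct) (auto simp: add)

lemma prod: "h (prod f A) = (\<Prod>x\<in>A. h (f x))"
  by (induction A rule: infinite_finite_induct) (auto simp: mult)

lemma power: "h (a ^ n) = h a ^ n"
  by (induction n) (auto simp: mult)

lemma of_nat: "h (of_nat n) = of_nat n"
  by (induction n) (auto simp: add)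

lemma of_int: "h (of_int n) = of_int n"
  by (cases n) (auto simp: of_nat minus add diff)

lemma det: "h (det (\<chi> i j. M i j)) = det (\<chi> i j. h (M i j))"
  by (simp add: det_def sum prod mult of_int)

lemma ideal_gen_image:
  assumes "p \<in> ideal_gen S"
  shows "h p \<in> ideal_gen (h ` S)"
proof -
  have "is_ideal {p. h p \<in> ideal_gen (h ` S)}"
    by (auto simp: ring_module.subspace_def add mult ring_module.span_zero
        intro: ring_module.span_add ring_module.span_scale)
  then have "ideal_gen S \<subseteq> {p. h p \<in> ideal_gen (h ` S)}"
    by (intro ring_module.span_minimal) (auto intro: ring_module.span_base)
  then show ?thesis using assms by blast
qed

end

lemma rhom_comp: "rhom h \<Longrightarrow> rhom g \<Longrightarrow> rhom (\<lambda>x. g (h x))"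
  by (simp add: rhom_def)

lemma rhom_id: "rhom (\<lambda>x. x)"
  by (simp add: rhom_def)

lemma rhom_of_int: "rhom of_int"
  by (simp add: rhom_def)

lemma rhom_Const: "rhom Const"
  by (simp add: rhom_def Const_def single_add mult_single)

text \<open>Exponents are natural numbers, so only 0 + 0 gives 0: the constant term is evaluation at
  the origin.\<close>

lemma rhom_lookup_0: "rhom (\<lambda>p :: ('x, 'c::comm_ring_1) mpoly. lookup p 0)"
proof -
  have "lookup (p * q) 0 = lookup p 0 * lookup q 0" for p q :: "('x, 'c) mpoly"
  proof -
    have eq: "(0 = l + m) = (l = 0 \<and> m = 0)" for l m :: "'x \<Rightarrow>\<^sub>0 nat"
      by (auto simp: poly_mapping_eq_iff lookup_add fun_eq_iff)
    have "(\<Sum>m. lookup q m when 0 = l + m) = (lookup q 0 when l = 0)" for l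
      unfolding eq by (cases "l = 0") (auto simp: when_def cong: Sum_any.cong)
    then show ?thesis
      by (simp add: lookup_mult mult_when)
  qed
  then show ?thesis
    by (simp add: rhom_def lookup_add)
qed

lemma mpoly_eq_sum_single: "p = (\<Sum>a\<in>keys p. single a (lookup p a))"
  for p :: "('x, 'c::comm_ring_1) mpoly"
  by (subst mpoly_eq_sum) (simp add: Const_def mon_def mult_single)

lemma mpoly_induct [case_names zero add single]:
  fixes p :: "('x, 'c::comm_ring_1) mpoly"
  assumes "P 0" "\<And>p q. P p \<Longrightarrow> P q \<Longrightarrow> P (p + q)" "\<And>a c. P (single a c)"
  shows "P p"
proof -
  have "P (\<Sum>a\<in>A. single a (lookup p a))" if "finite A" for A
    using that by (induction A) (auto intro: assms)
  then show ?thesis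
    by (subst mpoly_eq_sum_single) auto
qed

definition monval :: "('x \<Rightarrow> 'b::comm_ring_1) \<Rightarrow> ('x \<Rightarrow>\<^sub>0 nat) \<Rightarrow> 'b"
  where "monval v a = (\<Prod>x\<in>keys a. v x ^ lookup a x)"

text \<open>With separate maps for coefficients and variables, one definition covers evaluation,
  substitution and change of the coefficient ring.\<close>

definition peval :: "('c::comm_ring_1 \<Rightarrow> 'b::comm_ring_1) \<Rightarrow> ('x \<Rightarrow> 'b) \<Rightarrow> ('x, 'c) mpoly \<Rightarrow> 'b"
  where "peval h v F = (\<Sum>a\<in>keys F. h (lookup F a) * monval v a)"

lemma mpoly_eval_eq_peval: "mpoly_eval v F = peval (\<lambda>c. c) v F"
  by (simp add: mpoly_eval_def peval_def monval_def)

lemma monval_superset: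
  assumes "finite A" "keys a \<subseteq> A"
  shows "monval v a = (\<Prod>x\<in>A. v x ^ lookup a x)"
  unfolding monval_def using assms
  by (intro prod.mono_neutral_left) (auto simp: in_keys_iff)

lemma monval_0 [simp]: "monval v 0 = 1"
  by (simp add: monval_def)

lemma keys_add_nat: "keys (a + b) = keys a \<union> keys b" for a b :: "'x \<Rightarrow>\<^sub>0 nat"
  by (auto simp: in_keys_iff lookup_add)

lemma monval_add: "monval v (a + b) = monval v a * monval v b"
  by (simp add: monval_superset[of "keys a \<union> keys b"] keys_add_nat lookup_add power_add prod.distrib)

lemma monval_single [simp]: "monval v (single x n) = v x ^ n"
  by (cases "n = 0") (auto simp: monval_def)

lemma (in rhom) monval: "h (monval v a) = monval (\<lambda>x. h (v x)) a"
  by (simp add: monval_def prod power)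

lemma peval_superset:
  assumes "h 0 = 0" "finite A" "keys F \<subseteq> A"
  shows "peval h v F = (\<Sum>a\<in>A. h (lookup F a) * monval v a)"
  unfolding peval_def using assms
  by (intro sum.mono_neutral_left) (auto simp: in_keys_iff)

lemma peval_single: "h 0 = 0 \<Longrightarrow> peval h v (single a c) = h c * monval v a"
  by (cases "c = 0") (auto simp: peval_def)

context rhom
begin

lemma peval_add: "peval h v (F + G) = peval h v F + peval h v G"
  using keys_add[of F G]
  by (simp add: peval_superset[of h "keys F \<union> keys G"] lookup_add add sum.distrib algebra_simps)

lemma peval_0: "peval h v 0 = 0"
  by (simp add: peval_def)

lemma peval_term: "peval h v (single a c) = h c * monval v a"
  by (rule peval_single) (rule zero)

lemma rhom_peval: "rhom (peval h v)"
proof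
  show "peval h v (F + G) = peval h v F + peval h v G" for F G
    by (rule peval_add)
  show "peval h v 1 = 1"
    using peval_single[of h v 0 1] by simp
  show "peval h v (F * G) = peval h v F * peval h v G" for F G
  proof (induction F rule: mpoly_induct)
    case (single a c)
    show ?case
    proof (induction G rule: mpoly_induct)
      case (add p q)
      then show ?case by (simp only: distrib_left peval_add)
    next
      case (single b d)
      have "peval h v (single a c * single b d) = h (c * d) * monval v (a + b)"
        by (simp only: mult_single peval_term)
      then show ?case
        by (simp only: peval_term mult monval_add) (simp only: mult_ac)
    qed (simp add: peval_0)
  next
    case (add p q)
    then show ?case by (simp only: distrib_right peval_add)
  qed (simp add: peval_0)
qed

end

lemma (in rhom) peval_Const [simp]: "peval h v (Const c) = h c"
  by (simp add: Const_def peval_single)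

lemma (in rhom) peval_mon [simp]: "peval h v (mon a) = monval v a"
  by (simp add: mon_def peval_single)

lemma (in rhom) peval_Var [simp]: "peval h v (Var x) = v x"
  by (simp add: Var_def)

lemma rhom_peval_comp:
  assumes "rhom g" "rhom h"
  shows "g (peval h v F) = peval (\<lambda>c. g (h c)) (\<lambda>x. g (v x)) F"
  using assms by (simp add: peval_def rhom.sum rhom.mult rhom.monval)

lemma Var_power: "Var x ^ n = mon (single x n)"
  by (induction n) (auto simp: Var_def mon_def mult_single single_add[symmetric])

lemma mon_add: "mon (a + b) = mon a * mon b"
  by (simp add: mon_def mult_single)

lemma mon_0 [simp]: "mon 0 = 1"
  by (simp add: mon_def)

lemma single_eq: "single a c = Const c * mon a"
  by (simp add: Const_def mon_def mult_single)

lemma prod_mon: "(\<Prod>x\<in>A. mon (f x)) = mon (\<Sum>x\<in>A. f x)"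
  by (induction A rule: infinite_finite_induct) (auto simp: mon_add)

lemma mon_power: "mon a ^ n = mon (\<Sum>i<n. a)"
  by (induction n) (auto simp: mon_add add.commute mult.commute)

lemma monval_Var: "monval Var a = mon a"
proof -
  have "(\<Sum>x\<in>keys a. single x (lookup a x)) = a"
    by (rule poly_mapping_eqI) (auto simp: lookup_sum lookup_single when_def in_keys_iff)
  then show ?thesis
    by (simp add: monval_def Var_power prod_mon)
qed

lemma peval_Const_Var [simp]: "peval Const Var F = F"
  unfolding peval_def monval_Var by (rule mpoly_eq_sum[symmetric])

text \<open>Taken as an instance of \<open>peval\<close> so that it is a homomorphism at once; the
  coefficientwise description is \<open>lookup_cmap\<close>.\<close>

definition cmap :: "('c::comm_ring_1 \<Rightarrow> 'b::comm_ring_1) \<Rightarrow> ('x, 'c) mpoly \<Rightarrow> ('x, 'b) mpoly"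
  where "cmap h = peval (\<lambda>c. Const (h c)) Var"

lemma rhom_cmap:
  assumes "rhom h"
  shows "rhom (cmap h)"
  unfolding cmap_def by (rule rhom.rhom_peval[OF rhom_comp[OF assms rhom_Const]])

lemma lookup_cmap: "h 0 = 0 \<Longrightarrow> lookup (cmap h F) a = h (lookup F a)"
  by (auto simp: cmap_def peval_def monval_Var lookup_sum single_eq[symmetric] lookup_single
      when_def in_keys_iff)

lemma keys_cmap: "h 0 = 0 \<Longrightarrow> keys (cmap h F) \<subseteq> keys F"
  by (auto simp: in_keys_iff lookup_cmap)

lemma cmap_mon:
  assumes "rhom h"
  shows "cmap h (mon a) = mon a"
  unfolding cmap_def rhom.peval_mon[OF rhom_comp[OF assms rhom_Const]] by (rule monval_Var)

lemma cmap_Const: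
  assumes "rhom h"
  shows "cmap h (Const c) = Const (h c)"
  unfolding cmap_def rhom.peval_Const[OF rhom_comp[OF assms rhom_Const]] ..

lemma lookup_0_mon: "lookup (mon a) 0 = (if a = 0 then 1 else 0)"
  by (simp add: mon_def lookup_single when_def)

lemma lookup_mon: "lookup (mon a) b = (if a = b then 1 else 0)"
  by (simp add: mon_def lookup_single when_def)

lemma lookup_single_mult: "lookup (single a c * p) (a + b) = c * lookup p b"
  for p :: "('x, 'c::comm_ring_1) mpoly"
  by (induction p rule: mpoly_induct)
    (auto simp: distrib_left lookup_add mult_single lookup_single when_def)

lemma lookup_Const_mult: "lookup (Const c * p) b = c * lookup p b"
  using lookup_single_mult[of 0 c p b] by (simp add: Const_def)

lemma lookup_mon_mult: "lookup (mon a * p) (a + b) = lookup p b"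
  using lookup_single_mult[of a 1 p b] by (simp add: mon_def)

lemma keys_uminus [simp]: "keys (- p) = keys p" for p :: "('x, 'c::comm_ring_1) mpoly"
  by (auto simp: in_keys_iff)

lemma keys_diff_subset: "keys (p - q) \<subseteq> keys p \<union> keys q" for p q :: "('x, 'c::comm_ring_1) mpoly"
  by (auto simp: in_keys_iff lookup_minus)

lemma keys_mult_subset: "keys (p * q) \<subseteq> {a + b | a b. a \<in> keys p \<and> b \<in> keys q}"
  by (rule keys_mult)

section \<open>Monomial ideals\<close>

text \<open>For up-closed \<open>E\<close> these are the monomial ideals. Other sets, such as a
  singleton or the support of one polynomial, are used to bound supports.\<close>

definition mideal :: "('x \<Rightarrow>\<^sub>0 nat) set \<Rightarrow> ('x, 'c::comm_ring_1) mpoly set"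
  where "mideal E = {p. keys p \<subseteq> E}"

definition up_closed :: "('x \<Rightarrow>\<^sub>0 nat) set \<Rightarrow> bool"
  where "up_closed E \<longleftrightarrow> (\<forall>a\<in>E. \<forall>c. a + c \<in> E)"

lemma up_closedD: "up_closed E \<Longrightarrow> a \<in> E \<Longrightarrow> c + a \<in> E"
  by (auto simp: up_closed_def add.commute)

lemma mon_in_mideal [simp]: "(mon a :: ('x, 'c::comm_ring_1) mpoly) \<in> mideal E \<longleftrightarrow> a \<in> E"
  by (simp add: mideal_def mon_def)

lemma mideal_mult_in:
  assumes "p \<in> mideal E" "q \<in> mideal E'" "\<And>a b. a \<in> E \<Longrightarrow> b \<in> E' \<Longrightarrow> a + b \<in> E''"
  shows "p * q \<in> mideal E''"
  using assms keys_mult_subset[of p q] unfolding mideal_def by blast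

lemma is_ideal_mideal: "up_closed E \<Longrightarrow> is_ideal (mideal E)"
proof (rule ring_module.subspaceI)
  show "0 \<in> mideal E" by (simp add: mideal_def)
  show "p + q \<in> mideal E" if "p \<in> mideal E" "q \<in> mideal E" for p q
    using that keys_add[of p q] by (auto simp: mideal_def)
  show "c * p \<in> mideal E" if "up_closed E" "p \<in> mideal E" for c p
    by (rule mideal_mult_in[of c UNIV p E]) (use that in \<open>auto simp: mideal_def up_closedD\<close>)
qed

lemma mideal_add: "p \<in> mideal E \<Longrightarrow> q \<in> mideal E \<Longrightarrow> p + q \<in> mideal E"
  using keys_add[of p q] by (auto simp: mideal_def)

lemma mideal_diff: "p \<in> mideal E \<Longrightarrow> q \<in> mideal E \<Longrightarrow> p - q \<in> mideal E"
  using keys_diff_subset[of p q] by (auto simp: mideal_def)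

lemma mideal_sum: "(\<And>x. x \<in> A \<Longrightarrow> f x \<in> mideal E) \<Longrightarrow> sum f A \<in> mideal E"
  by (induction A rule: infinite_finite_induct) (auto simp: mideal_add, auto simp: mideal_def)

lemma mideal_Const_mult: "p \<in> mideal E \<Longrightarrow> Const c * p \<in> mideal E"
  by (auto simp: mideal_def in_keys_iff lookup_Const_mult subset_iff dest: mult_not_zero)

lemma mideal_subset_ideal:
  fixes L :: "('x, 'c::comm_ring_1) mpoly set"
  assumes "is_ideal L" "\<And>a. a \<in> E \<Longrightarrow> mon a \<in> L"
  shows "mideal E \<subseteq> L"
proof
  fix p :: "('x, 'c) mpoly" assume "p \<in> mideal E"
  then have "(\<Sum>a\<in>keys p. Const (lookup p a) * mon a) \<in> L"
    by (intro ring_module.subspace_sum[OF assms(1)] ring_module.subspace_scale[OF assms(1)] assms(2))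
      (auto simp: mideal_def)
  then show "p \<in> L" by (simp only: mpoly_eq_sum[symmetric])
qed

lemma ideal_gen_mon:
  "ideal_gen (mon ` A) = (mideal {a + c | a c. a \<in> A} :: ('x, 'c::comm_ring_1) mpoly set)"
proof (rule antisym)
  have up: "up_closed {a + c | a c. a \<in> A}"
    unfolding up_closed_def by clarsimp (metis add.assoc)
  show "ideal_gen (mon ` A) \<subseteq> (mideal {a + c | a c. a \<in> A} :: ('x, 'c) mpoly set)"
    by (rule ring_module.span_minimal[OF _ is_ideal_mideal[OF up]])
      (auto, metis add.right_neutral)
  show "(mideal {a + c | a c. a \<in> A} :: ('x, 'c) mpoly set) \<subseteq> ideal_gen (mon ` A)"
  proof (rule mideal_subset_ideal)
    fix b assume "b \<in> {a + c | a c. a \<in> A}"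
    then obtain a c where "b = c + a" "a \<in> A" by (auto simp: add.commute)
    then show "(mon b :: ('x, 'c) mpoly) \<in> ideal_gen (mon ` A)"
      by (auto simp: mon_add intro!: ring_module.span_scale intro: ring_module.span_base)
  qed auto
qed

lemma exp_diff_add: "b \<le> lookup a i \<Longrightarrow> \<exists>c. a = single i b + c"
  for a :: "'x \<Rightarrow>\<^sub>0 nat"
  by (rule exI[of _ "a - single i b"], rule poly_mapping_eqI)
    (auto simp: lookup_add lookup_minus lookup_single when_def)

definition big :: "('x \<Rightarrow> nat) \<Rightarrow> ('x \<Rightarrow>\<^sub>0 nat) set"
  where "big b = {a. \<exists>i. b i \<le> lookup a i}"

lemma up_closed_big: "up_closed (big b)"
  by (auto simp: up_closed_def big_def lookup_add intro: trans_le_add1)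

lemma ideal_gen_powers:
  "ideal_gen (range (\<lambda>i. Var i ^ b i)) = (mideal (big b) :: ('x, 'c::comm_ring_1) mpoly set)"
proof -
  have "{a + c | a c. a \<in> range (\<lambda>i. single i (b i))} = big b"
  proof (intro equalityI subsetI)
    fix x assume "x \<in> big b"
    then obtain i where "b i \<le> lookup x i" by (auto simp: big_def)
    from exp_diff_add[OF this] obtain c where "x = single i (b i) + c" ..
    then show "x \<in> {a + c | a c. a \<in> range (\<lambda>i. single i (b i))}" by blast
  next
    fix x assume "x \<in> {a + c | a c. a \<in> range (\<lambda>i. single i (b i))}"
    then obtain i c where "x = single i (b i) + c" by auto
    then have "b i \<le> lookup x i" by (simp add: lookup_add)
    then show "x \<in> big b" by (auto simp: big_def)
  qed
  moreover have "range (\<lambda>i. Var i ^ b i :: ('x, 'c) mpoly) = mon ` range (\<lambda>i. single i (b i))"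
    by (auto simp: Var_power)
  ultimately show ?thesis
    using ideal_gen_mon[of "range (\<lambda>i. single i (b i))"] by simp
qed

lemma ideal_gen_image_iff:
  fixes z :: "'i \<Rightarrow> 'a::comm_ring_1"
  assumes A: "finite A"
  shows "x \<in> ideal_gen (z ` A) \<longleftrightarrow> (\<exists>q. x = (\<Sum>j\<in>A. q j * z j))"
proof
  assume "x \<in> ideal_gen (z ` A)"
  then show "\<exists>q. x = (\<Sum>j\<in>A. q j * z j)"
  proof (induction rule: ring_module.span_induct_alt)
    case base
    show ?case by (intro exI[of _ "\<lambda>_. 0"]) simp
  next
    case (step c x y)
    then obtain i q where i: "i \<in> A" "x = z i" "y = (\<Sum>j\<in>A. q j * z j)" by auto
    moreover have "(\<Sum>j\<in>A. (if j = i then c else 0) * z j) = c * z i"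
      using A i(1) by (subst sum.remove[of _ i]) auto
    ultimately show ?case
      by (intro exI[of _ "\<lambda>j. (if j = i then c else 0) + q j"])
        (simp add: distrib_right sum.distrib)
  qed
qed (auto intro!: ring_module.span_sum ring_module.span_scale intro: ring_module.span_base)

lemma ideal_gen_range_iff:
  fixes z :: "'n::finite \<Rightarrow> 'a::comm_ring_1"
  shows "x \<in> ideal_gen (range z) \<longleftrightarrow> (\<exists>q. x = (\<Sum>j\<in>UNIV. q j * z j))"
  by (rule ideal_gen_image_iff) simp

definition mdeg :: "('n::finite \<Rightarrow>\<^sub>0 nat) \<Rightarrow> nat"
  where "mdeg a = (\<Sum>i\<in>UNIV. lookup a i)"

lemma mdeg_add: "mdeg (a + b) = mdeg a + mdeg b"
  by (simp add: mdeg_def lookup_add sum.distrib)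

lemma mdeg_0 [simp]: "mdeg 0 = 0"
  by (simp add: mdeg_def)

lemma mdeg_eq_0_iff [simp]: "mdeg a = 0 \<longleftrightarrow> a = 0"
  by (auto simp: mdeg_def poly_mapping_eq_iff fun_eq_iff)

lemma ideal_mono_mon:
  assumes "is_ideal L" "mon a \<in> L"
  shows "mon (a + c) \<in> L"
  using ring_module.subspace_scale[OF assms, of "mon c"] by (simp add: mon_add mult.commute)

lemma large_degree_in_big:
  fixes b :: "'n::finite \<Rightarrow> nat"
  assumes "(\<Sum>i\<in>UNIV. b i) \<le> mdeg a"
  shows "a \<in> big b"
proof (rule ccontr)
  assume "a \<notin> big b"
  then have "mdeg a < (\<Sum>i\<in>UNIV. b i)"
    unfolding mdeg_def by (intro sum_strict_mono) (auto simp: big_def not_le)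
  with assms show False by simp
qed

lemma large_degree_in_ideal:
  fixes L :: "('n::finite, 'c::comm_ring_1) mpoly set"
  assumes L: "is_ideal L" and b: "\<And>i. mon (single i (b i)) \<in> L"
  shows "\<exists>B. \<forall>a. B \<le> mdeg a \<longrightarrow> mon a \<in> L"
proof (intro exI[of _ "\<Sum>i\<in>UNIV. b i"] allI impI)
  fix a :: "'n \<Rightarrow>\<^sub>0 nat" assume "(\<Sum>i\<in>UNIV. b i) \<le> mdeg a"
  then obtain i where "b i \<le> lookup a i"
    using large_degree_in_big[of b a] by (auto simp: big_def)
  from exp_diff_add[OF this] obtain c where "a = single i (b i) + c" ..
  with ideal_mono_mon[OF L b] show "mon a \<in> L" by blast
qed

text \<open>For t = 1 - s / s(0), which has no constant term, a high power of t lies in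
  \<open>L\<close>. The finite geometric series in t therefore inverts s modulo \<open>L\<close> up
  to a scalar.\<close>

lemma unit_cancel:
  fixes s :: "('n::finite, 'k::field) mpoly"
  assumes L: "is_ideal L" and B: "\<And>a. B \<le> mdeg a \<Longrightarrow> mon a \<in> L"
    and s: "lookup s 0 \<noteq> 0" and sy: "s * y \<in> L"
  shows "y \<in> L"
proof -
  define t where "t = 1 - Const (inverse (lookup s 0)) * s"
  have t: "t \<in> mideal {a. 1 \<le> mdeg a}"
  proof -
    have "lookup t 0 = 0"
      using s by (simp add: t_def lookup_minus lookup_Const_mult)
    then have "a \<noteq> 0" if "a \<in> keys t" for a
      using that by (metis in_keys_iff)
    then have "1 \<le> mdeg a" if "a \<in> keys t" for a
      using that mdeg_eq_0_iff[of a] by (cases "mdeg a") auto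
    then show ?thesis by (auto simp: mideal_def)
  qed
  have "t ^ k \<in> mideal {a. k \<le> mdeg a}" for k
  proof (induction k)
    case (Suc k)
    then show ?case
      using mideal_mult_in[OF t Suc, of "{a. Suc k \<le> mdeg a}"] by (auto simp: mdeg_add)
  qed (auto simp: mideal_def)
  moreover have "mideal {a. B \<le> mdeg a} \<subseteq> L"
    using B by (intro mideal_subset_ideal L) auto
  ultimately have "t ^ B \<in> L" by blast
  then have tB: "y * t ^ B \<in> L" by (rule ring_module.subspace_scale[OF L])
  have "1 - t = Const (inverse (lookup s 0)) * s"
    by (simp only: t_def diff_diff_eq2 add_diff_cancel_left')
  then have "(1 - t) * y \<in> L"
    using ring_module.subspace_scale[OF L sy, of "Const (inverse (lookup s 0))"]
    by (simp only: mult.assoc)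
  then have "(\<Sum>i<B. t ^ i) * ((1 - t) * y) \<in> L" by (rule ring_module.subspace_scale[OF L])
  moreover have "(\<Sum>i<B. t ^ i) * ((1 - t) * y) = (1 - t ^ B) * y"
    unfolding one_diff_power_eq[of t B] by (simp only: mult_ac)
  ultimately have "(1 - t ^ B) * y + y * t ^ B \<in> L"
    using tB ring_module.subspace_add[OF L] by metis
  then show ?thesis by (simp only: left_diff_distrib mult_1 mult.commute[of y] diff_add_cancel)
qed

section \<open>Polynomial functions on infinite domains\<close>

lemma infinite_ex_power_neq:
  assumes "infinite (UNIV :: 'c::idom set)" "u \<noteq> v"
  shows "\<exists>t::'c. t \<noteq> 0 \<and> t ^ u \<noteq> t ^ v"
proof -
  let ?q = "monom 1 u - monom 1 v :: 'c poly"
  have "coeff ?q u \<noteq> 0" using assms by (simp add: coeff_monom)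
  then have "?q \<noteq> 0" by (metis coeff_0)
  then have "finite (insert 0 {t. poly ?q t = 0})"
    using poly_roots_finite by blast
  then obtain t where "t \<notin> insert 0 {t. poly ?q t = 0}"
    using assms(1) by (metis ex_new_if_finite)
  then show ?thesis by (intro exI[of _ t]) (simp add: poly_monom)
qed

definition tscale :: "'x \<Rightarrow> 'c \<Rightarrow> ('x, 'c::comm_ring_1) mpoly \<Rightarrow> ('x, 'c) mpoly"
  where "tscale i t = peval Const (\<lambda>j. if j = i then Const t * Var j else Var j)"

lemma Const_0 [simp]: "Const 0 = 0"
  by (rule rhom.zero[OF rhom_Const])

lemma Const_1 [simp]: "Const 1 = 1"
  by (rule rhom.one[OF rhom_Const])

lemma rhom_tscale: "rhom (tscale i t)"
  unfolding tscale_def by (rule rhom.rhom_peval[OF rhom_Const])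

lemma tscale_single: "tscale i t (single a c) = single a (t ^ lookup a i * c)"
proof -
  have "monval (\<lambda>j. if j = i then Const t * Var j else Var j) a
    = (\<Prod>j\<in>keys a. (if j = i then Const t else 1) ^ lookup a j) * monval Var a"
    unfolding monval_def prod.distrib[symmetric] by (intro prod.cong) (auto simp: power_mult_distrib)
  also have "(\<Prod>j\<in>keys a. (if j = i then Const t else 1 :: ('a, 'b) mpoly) ^ lookup a j) = Const t ^ lookup a i"
  proof (cases "i \<in> keys a")
    case True
    then show ?thesis by (subst prod.remove[of _ i]) auto
  next
    case False
    then have "(\<Prod>j\<in>keys a. (if j = i then Const t else 1 :: ('a, 'b) mpoly) ^ lookup a j) = 1"
      by (intro prod.neutral) auto
    with False show ?thesis by (simp add: in_keys_iff)
  qed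
  finally have "tscale i t (single a c) = Const c * (Const t ^ lookup a i * mon a)"
    by (simp only: tscale_def rhom.peval_term[OF rhom_Const] monval_Var)
  also have "\<dots> = Const (t ^ lookup a i * c) * mon a"
    by (simp only: rhom.power[OF rhom_Const] rhom.mult[OF rhom_Const] mult_ac)
  finally show ?thesis by (simp only: single_eq)
qed

lemma lookup_tscale: "lookup (tscale i t p) a = t ^ lookup a i * lookup p a"
proof (induction p rule: mpoly_induct)
  case (add p q)
  then show ?case by (simp only: rhom.add[OF rhom_tscale] lookup_add distrib_left)
qed (auto simp: rhom.zero[OF rhom_tscale] tscale_single lookup_single when_def)

text \<open>Subtracting a multiple of a polynomial from a torus translate of it cancels one of its terms.\<close>

lemma torus_invariant_term:
  fixes L :: "('x, 'c::idom) mpoly set"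
  assumes inf: "infinite (UNIV :: 'c set)"
    and diff: "\<And>p q. p \<in> L \<Longrightarrow> q \<in> L \<Longrightarrow> p - q \<in> L"
    and scale: "\<And>c p. p \<in> L \<Longrightarrow> Const c * p \<in> L"
    and tscale: "\<And>i t p. t \<noteq> 0 \<Longrightarrow> p \<in> L \<Longrightarrow> tscale i t p \<in> L"
    and "p \<in> L" "a \<in> keys p"
  shows "\<exists>c. c \<noteq> 0 \<and> single a c \<in> L"
  using assms(5,6)
proof (induction "card (keys p)" arbitrary: p rule: less_induct)
  case less
  show ?case
  proof (cases "keys p = {a}")
    case True
    then have "p = single a (lookup p a)"
      using mpoly_eq_sum_single[of p] by simp
    moreover have "lookup p a \<noteq> 0" using less.prems by (simp add: in_keys_iff)
    ultimately show ?thesis using less.prems(1) by metis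
  next
    case False
    then obtain b where b: "b \<in> keys p" "b \<noteq> a" using less.prems by blast
    then obtain i where i: "lookup a i \<noteq> lookup b i"
      by (metis poly_mapping_eqI)
    obtain t :: 'c where t: "t \<noteq> 0" "t ^ lookup a i \<noteq> t ^ lookup b i"
      using infinite_ex_power_neq[OF inf i] by blast
    let ?q = "tscale i t p - Const (t ^ lookup b i) * p"
    have l: "lookup ?q e = (t ^ lookup e i - t ^ lookup b i) * lookup p e" for e
      by (simp add: lookup_minus lookup_tscale lookup_Const_mult left_diff_distrib)
    have "keys ?q \<subset> keys p"
      using b by (auto simp: in_keys_iff l)
    then have "card (keys ?q) < card (keys p)" by (simp add: psubset_card_mono)
    moreover have "?q \<in> L" using less.prems t by (intro diff scale tscale) auto
    moreover have "a \<in> keys ?q" using less.prems t by (simp add: in_keys_iff l)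
    ultimately show ?thesis by (rule less.hyps)
  qed
qed

text \<open>The polynomials that vanish at all points are stable under the torus, so a nonzero one
  would yield a single term vanishing at the point with all coordinates 1. The set of variables may
  be infinite.\<close>

lemma poly_fun_zero:
  fixes F :: "('x, 'c::idom) mpoly"
  assumes inf: "infinite (UNIV :: 'c set)" and F: "\<And>v. peval (\<lambda>c. c) v F = 0"
  shows "F = 0"
proof (rule ccontr)
  assume "F \<noteq> 0"
  then obtain a where a: "a \<in> keys F"
    by (auto simp: poly_mapping_eq_iff fun_eq_iff in_keys_iff)
  note e = rhom.rhom_peval[OF rhom_id]
  let ?L = "{F :: ('x, 'c) mpoly. \<forall>v. peval (\<lambda>c. c) v F = 0}"
  have "\<exists>c. c \<noteq> 0 \<and> single a c \<in> ?L"
  proof (rule torus_invariant_term[OF inf _ _ _ _ a])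
    fix j and t :: 'c and p assume p: "p \<in> ?L"
    show "tscale j t p \<in> ?L"
      using p unfolding tscale_def by (auto simp: rhom_peval_comp[OF e rhom_Const] rhom.peval_Const[OF rhom_id])
  next
    fix p q assume "p \<in> ?L" "q \<in> ?L"
    then show "p - q \<in> ?L" by (simp add: rhom.diff[OF e])
  next
    fix c p assume "p \<in> ?L"
    then show "Const c * p \<in> ?L" by (simp add: rhom.mult[OF e])
  next
    show "F \<in> ?L" using F by blast
  qed
  then obtain c :: 'c where "c \<noteq> 0" "peval (\<lambda>c. c) (\<lambda>_. 1 :: 'c) (single a c) = 0" by blast
  then show False by (simp add: rhom.peval_term[OF rhom_id] monval_def)
qed

text \<open>On the line through \<open>p\<close> and \<open>q\<close> both polynomials become
  nonzero in one variable, and their product has finitely many roots. This is the irreducibility of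
  affine space in the form needed below.\<close>

lemma common_nonzero_on_line:
  fixes F G :: "('x, 'k::field) mpoly"
  assumes inf: "infinite (UNIV :: 'k set)"
    and "peval (\<lambda>c. c) p F \<noteq> 0" "peval (\<lambda>c. c) q G \<noteq> 0"
  shows "\<exists>t. peval (\<lambda>c. c) (\<lambda>x. p x + t * (q x - p x)) F \<noteq> 0 \<and>
    peval (\<lambda>c. c) (\<lambda>x. p x + t * (q x - p x)) G \<noteq> 0"
proof -
  have C: "rhom (\<lambda>c::'k. [:c:])" by (simp add: rhom_def)
  define H where "H F = peval (\<lambda>c. [:c:]) (\<lambda>x. [:p x, q x - p x:]) F" for F
  have H: "poly (H F) t = peval (\<lambda>c. c) (\<lambda>x. p x + t * (q x - p x)) F" for F t
  proof -
    have "rhom (\<lambda>r. poly r t)" by (simp add: rhom_def)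
    then show ?thesis
      using rhom_peval_comp[OF _ C, of "\<lambda>r. poly r t" "\<lambda>x. [:p x, q x - p x:]" F] by (simp add: H_def)
  qed
  have "H F * H G \<noteq> 0"
    using assms(2,3) H[of F 0] H[of G 1] by auto
  then have "finite {t. poly (H F * H G) t = 0}" by (rule poly_roots_finite)
  then obtain t where "poly (H F * H G) t \<noteq> 0"
    using inf by (metis (mono_tags, lifting) ex_new_if_finite mem_Collect_eq)
  then show ?thesis by (intro exI[of _ t]) (auto simp: H)
qed

section \<open>Determinants over commutative rings\<close>

text \<open>Matrices are plain functions, so that exchanging a row or applying a homomorphism is an
  operation on functions.\<close>

definition dt :: "('n::finite \<Rightarrow> 'n \<Rightarrow> 'a::comm_ring_1) \<Rightarrow> 'a"
  where "dt M = det (\<chi> i j. M i j)"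

lemma dt_leibniz: "dt M = (\<Sum>p | p permutes UNIV. of_int (sign p) * (\<Prod>i\<in>UNIV. M i (p i)))"
  by (simp add: dt_def det_def)

lemma (in rhom) dt: "h (dt M) = dt (\<lambda>i j. h (M i j))"
  unfolding dt_def by (rule det)

lemma dt_mult: "dt (\<lambda>i j. \<Sum>l\<in>UNIV. M i l * D l j) = dt M * dt D"
  unfolding dt_def det_mul[symmetric] by (simp add: matrix_matrix_mult_def)

lemma dt_column_in_ideal:
  fixes M :: "'b::finite \<Rightarrow> 'b \<Rightarrow> 'a::comm_ring_1"
  assumes L: "is_ideal L" and M: "\<And>i. M i k \<in> L"
  shows "dt M \<in> L"
  unfolding dt_leibniz
proof (intro ring_module.subspace_sum[OF L] ring_module.subspace_scale[OF L])
  fix p :: "'b \<Rightarrow> 'b" assume "p \<in> {p. p permutes UNIV}"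
  then have "p permutes UNIV" by blast
  from permutes_inverses(1)[OF this] obtain i where i: "p i = k" by blast
  have "(\<Prod>i\<in>UNIV. M i (p i)) = (\<Prod>i\<in>UNIV - {i}. M i (p i)) * M i (p i)"
    by (subst prod.remove[of _ i]) (auto simp: mult.commute)
  then show "(\<Prod>i\<in>UNIV. M i (p i)) \<in> L"
    using ring_module.subspace_scale[OF L M[of i]] i by metis
qed

text \<open>Telescoping. The factors are congruent only after multiplication by \<open>h\<close>,
  and a single factor \<open>h\<close> is enough for the whole product.\<close>

lemma prod_diff_in_ideal:
  assumes L: "is_ideal L" and uv: "\<And>i. i \<in> A \<Longrightarrow> h * (u i - v i) \<in> L"
  shows "h * ((\<Prod>i\<in>A. u i) - (\<Prod>i\<in>A. v i)) \<in> L"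
  using uv
proof (induction A rule: infinite_finite_induct)
  case (insert x A)
  have "h * ((\<Prod>i\<in>insert x A. u i) - (\<Prod>i\<in>insert x A. v i))
    = u x * (h * ((\<Prod>i\<in>A. u i) - (\<Prod>i\<in>A. v i))) + (\<Prod>i\<in>A. v i) * (h * (u x - v x))"
    using insert.hyps by (simp add: algebra_simps)
  also have "\<dots> \<in> L"
    by (rule ring_module.subspace_add[OF L]; rule ring_module.subspace_scale[OF L])
      (use insert in auto)
  finally show ?case .
qed (auto simp: ring_module.subspace_0[OF L])

lemma dt_diff_in_ideal:
  assumes L: "is_ideal L" and XY: "\<And>i j. h * (X i j - Y i j) \<in> L"
  shows "h * (dt X - dt Y) \<in> L"
proof -
  have "h * (dt X - dt Y) = (\<Sum>p | p permutes UNIV. of_int (sign p) *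
      (h * ((\<Prod>i\<in>UNIV. X i (p i)) - (\<Prod>i\<in>UNIV. Y i (p i)))))"
    by (simp add: dt_leibniz sum_subtractf[symmetric] sum_distrib_left algebra_simps)
  also have "\<dots> \<in> L"
    by (rule ring_module.subspace_sum[OF L], rule ring_module.subspace_scale[OF L],
        rule prod_diff_in_ideal[OF L XY])
  finally show ?thesis .
qed

text \<open>Cramer's rule without division: column k is replaced by \<open>M x\<close> and expanded
  linearly, and every summand other than l = k has two equal columns.\<close>

lemma dt_cramer:
  "x k * dt M = dt (\<lambda>i j. if j = k then \<Sum>l\<in>UNIV. M i l * x l else M i j)"
proof -
  define A where "A = (\<chi> i j. M j i)"
  have tr: "dt N = det (\<chi> i j. N j i)" for N
    using det_transpose[of "\<chi> i j. N j i"] by (simp add: dt_def transpose_def)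
  have "dt (\<lambda>i j. if j = k then \<Sum>l\<in>UNIV. M i l * x l else M i j)
      = det (\<chi> i. if i = k then (\<Sum>l\<in>UNIV. x l *s (A $ l)) else A $ i)"
    unfolding tr by (rule arg_cong[of _ _ det])
      (auto simp: vec_eq_iff A_def vector_scalar_mult_def mult.commute)
  also have "\<dots> = (\<Sum>l\<in>UNIV. det (\<chi> i. if i = k then x l *s (A $ l) else A $ i))"
    by (rule det_linear_row_sum) simp
  also have "\<dots> = (\<Sum>l\<in>UNIV. x l * det (\<chi> i. if i = k then A $ l else A $ i))"
    by (simp only: det_row_mul)
  also have "\<dots> = (\<Sum>l\<in>UNIV. if l = k then x l * det A else 0)"
  proof (intro sum.cong refl)
    fix l
    show "x l * det (\<chi> i. if i = k then A $ l else A $ i) = (if l = k then x l * det A else 0)"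
    proof (cases "l = k")
      case True
      then have "(\<chi> i. if i = k then A $ l else A $ i) = A" by (auto simp: vec_eq_iff)
      with True show ?thesis by simp
    next
      case False
      then have "det (\<chi> i. if i = k then A $ l else A $ i) = 0"
        by (intro det_identical_rows[of l k]) (auto simp: row_def)
      with False show ?thesis by simp
    qed
  qed
  also have "\<dots> = x k * det A" by simp
  also have "det A = dt M" unfolding tr A_def ..
  finally show ?thesis by simp
qed

text \<open>Cramer's rule modulo \<open>L\<close>: the column \<open>M g\<close> vanishes modulo
  \<open>L\<close>, so the determinant annihilates each \<open>g k\<close> there.\<close>

lemma dt_mult_in_ideal:
  assumes L: "is_ideal L" and M: "\<And>i. (\<Sum>j\<in>UNIV. M i j * g j) \<in> L"
  shows "g k * dt M \<in> L"
  unfolding dt_cramer by (rule dt_column_in_ideal[OF L, of _ k]) (simp add: M)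

lemma dt_row_diff:
  "dt (\<lambda>i. if i = k then u else M i) - dt (\<lambda>i. if i = k then v else M i)
    = dt (\<lambda>i. if i = k then \<lambda>j. u j - v j else M i)"
proof -
  have "dt (\<lambda>i. if i = k then u else M i)
      = det (\<chi> i. if i = k then (\<chi> j. u j - v j) + (\<chi> j. v j) else (\<chi> j. M i j))"
    unfolding dt_def by (rule arg_cong[of _ _ det]) (auto simp: vec_eq_iff)
  also have "\<dots> = det (\<chi> i. if i = k then (\<chi> j. u j - v j) else (\<chi> j. M i j))
      + det (\<chi> i. if i = k then (\<chi> j. v j) else (\<chi> j. M i j))"
    by (rule det_row_add)
  also have "(\<chi> i. if i = k then (\<chi> j. u j - v j) else (\<chi> j. M i j))
      = (\<chi> i j. (if i = k then \<lambda>j. u j - v j else M i) j)" by (auto simp: vec_eq_iff)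
  also have "(\<chi> i. if i = k then (\<chi> j. v j) else (\<chi> j. M i j))
      = (\<chi> i j. (if i = k then v else M i) j)" by (auto simp: vec_eq_iff)
  finally show ?thesis by (simp add: dt_def)
qed

section \<open>Duality modulo powers of the variables\<close>

text \<open>The exponent of the socle generator modulo the powers x_i ^ b i, for positive
  \<open>b i\<close>.\<close>

definition tope :: "('n::finite \<Rightarrow> nat) \<Rightarrow> 'n \<Rightarrow>\<^sub>0 nat"
  where "tope b = Abs_poly_mapping (\<lambda>i. b i - 1)"

lemma lookup_tope [simp]: "lookup (tope b) i = b i - 1"
  unfolding tope_def by (subst lookup_Abs_poly_mapping) auto

lemma tope_eq_sum: "tope b = (\<Sum>i\<in>UNIV. single i (b i - 1))"
  by (rule poly_mapping_eqI) (auto simp: lookup_sum lookup_single when_def)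

lemma dt_diagonal: "(\<And>i j. i \<noteq> j \<Longrightarrow> M i j = 0) \<Longrightarrow> dt M = (\<Prod>i\<in>UNIV. M i i)"
  unfolding dt_def by (subst det_diagonal) auto

text \<open>The rows of \<open>C\<close> are exchanged one by one for those of the diagonal matrix
  \<open>D\<close>, which acts in the same way on the vector of variables. The difference of two
  successive determinants is det r, where row k of r annihilates that vector. By Cramer, x_k * det r
  lies in the ideal of the powers of the other variables, so det r has no term at
  \<open>tope b\<close>.\<close>

lemma coeff_dt_tope:
  fixes s :: "('n::finite, 'c::comm_ring_1) mpoly"
  assumes b: "\<And>i. 1 \<le> b i" and C: "\<And>i. (\<Sum>j\<in>UNIV. C i j * Var j) = s * Var i ^ b i"
  shows "lookup (dt C) (tope b) = lookup s 0 ^ CARD('n)"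
proof -
  define D where "D i j = (if i = j then s * Var i ^ (b i - 1) else 0)" for i j
  define CT where "CT T i = (if i \<in> T then D i else C i)" for T i
  have D: "(\<Sum>j\<in>UNIV. D i j * Var j) = s * Var i ^ b i" for i
  proof -
    have "(\<Sum>j\<in>UNIV. D i j * Var j) = (\<Sum>j\<in>UNIV. if i = j then s * Var i ^ (b i - 1) * Var i else 0)"
      by (rule sum.cong) (auto simp: D_def)
    also have "\<dots> = s * (Var i ^ (b i - 1) * Var i)" by (simp add: mult.assoc)
    also have "Var i ^ (b i - 1) * Var i = Var i ^ b i"
      using b[of i] by (metis le_add_diff_inverse2 power_add power_one_right)
    finally show ?thesis .
  qed
  have CT: "(\<Sum>j\<in>UNIV. CT T i j * Var j) = s * Var i ^ b i" for T i
    by (simp add: CT_def C D)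
  have "lookup (dt (CT T)) (tope b) = lookup (dt C) (tope b)" for T
  proof (induction T rule: finite_induct[OF finite])
    case 1
    then show ?case by (simp add: CT_def)
  next
    case (2 k T)
    define r where "r i = (if i = k then \<lambda>j. D k j - C k j else CT T i)" for i
    have "dt (CT (insert k T)) - dt (CT T) = dt (\<lambda>i. if i = k then D k else CT T i)
        - dt (\<lambda>i. if i = k then C k else CT T i)"
      using 2 by (intro arg_cong2[where f = minus] arg_cong[of _ _ dt]) (auto simp: CT_def)
    also have "\<dots> = dt r" unfolding r_def by (rule dt_row_diff)
    finally have diff: "dt (CT (insert k T)) - dt (CT T) = dt r" .
    let ?E = "{a. \<exists>i. i \<noteq> k \<and> b i \<le> lookup a i}"
    have up: "up_closed ?E"
      by (auto simp: up_closed_def lookup_add intro: trans_le_add1)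
    have "(\<Sum>j\<in>UNIV. r i j * Var j) \<in> mideal ?E" for i
    proof (cases "i = k")
      case True
      have "(\<Sum>j\<in>UNIV. r k j * Var j) = (\<Sum>j\<in>UNIV. D k j * Var j) - (\<Sum>j\<in>UNIV. C k j * Var j)"
        by (simp add: r_def left_diff_distrib sum_subtractf)
      with True show ?thesis
        by (simp add: C D mideal_def)
    next
      case False
      then have "Var i ^ b i \<in> mideal ?E" by (auto simp: Var_power)
      then have "s * Var i ^ b i \<in> mideal ?E"
        by (rule ring_module.subspace_scale[OF is_ideal_mideal[OF up]])
      with False show ?thesis by (simp add: r_def CT)
    qed
    then have "Var k * dt r \<in> mideal ?E"
      by (rule dt_mult_in_ideal[OF is_ideal_mideal[OF up]])
    moreover have "single k 1 + tope b \<notin> ?E"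
      using b by (auto simp: lookup_add lookup_single when_def not_le Suc_le_eq)
    ultimately have "single k 1 + tope b \<notin> keys (Var k * dt r)"
      unfolding mideal_def by blast
    then have "lookup (Var k * dt r) (single k 1 + tope b) = 0"
      by (simp only: in_keys_iff not_not)
    moreover have "lookup (Var k * dt r) (single k 1 + tope b) = lookup (dt r) (tope b)"
      unfolding Var_def by (rule lookup_mon_mult)
    ultimately have "lookup (dt r) (tope b) = 0" by simp
    then show ?case using 2 by (simp flip: diff add: lookup_minus)
  qed
  moreover have "CT UNIV = D" by (simp add: fun_eq_iff CT_def)
  ultimately have "lookup (dt C) (tope b) = lookup (dt D) (tope b)" by metis
  also have "dt D = (\<Prod>i\<in>UNIV. D i i)"
    by (rule dt_diagonal) (auto simp: D_def)
  also have "\<dots> = mon (tope b) * s ^ CARD('n)"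
    by (simp add: D_def prod.distrib Var_power prod_mon tope_eq_sum mult.commute)
  also have "lookup (mon (tope b) * s ^ CARD('n)) (tope b) = lookup (s ^ CARD('n)) 0"
    using lookup_mon_mult[of "tope b" _ 0] by simp
  also have "\<dots> = lookup s 0 ^ CARD('n)"
    by (rule rhom.power[OF rhom_lookup_0])
  finally show ?thesis .
qed

lemma mpoly_vector_space: "vector_space (\<lambda>(c::'k::field) (p :: ('x, 'k) mpoly). Const c * p)"
  by standard
    (simp_all add: distrib_left distrib_right rhom.add[OF rhom_Const] rhom.mult[OF rhom_Const] mult.assoc)

lemma ex_functional:
  fixes L :: "('x, 'k::field) mpoly set"
  assumes L: "is_ideal L" and y: "y \<notin> L"
  shows "\<exists>l. (\<forall>p q. l (p + q) = l p + l q) \<and> (\<forall>c p. l (Const c * p) = c * l p) \<and>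
    (\<forall>p\<in>L. l p = 0) \<and> l y = (1::'k)"
proof -
  interpret V: vector_space "\<lambda>(c::'k) (p :: ('x, 'k) mpoly). Const c * p"
    by (rule mpoly_vector_space)
  interpret W: vector_space_pair "\<lambda>(c::'k) (p :: ('x, 'k) mpoly). Const c * p" "\<lambda>(c::'k) d. c * d"
    by unfold_locales (simp_all add: distrib_left distrib_right)
  have sub: "V.subspace L"
    by (auto simp: V.subspace_def ring_module.subspace_0[OF L] ring_module.subspace_add[OF L]
        ring_module.subspace_scale[OF L])
  obtain B where B: "B \<subseteq> L" "V.independent B" "L \<subseteq> V.span B"
    using V.maximal_independent_subset .
  have "V.span B \<subseteq> L" by (rule V.span_minimal[OF B(1) sub])
  with y have yB: "y \<notin> V.span B" by blast
  then have ind: "V.independent (insert y B)" by (rule V.independent_insertI) (rule B(2))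
  define l where "l = W.construct (insert y B) (\<lambda>b. if b = y then 1 else 0)"
  have lin: "Vector_Spaces.linear (\<lambda>c p. Const c * p) (\<lambda>c d. c * d) l"
    unfolding l_def by (rule W.linear_construct[OF ind])
  then interpret l: Vector_Spaces.linear "\<lambda>(c::'k) (p :: ('x, 'k) mpoly). Const c * p" "\<lambda>(c::'k) d. c * d" l .
  have "l b = 0" if "b \<in> B" for b
    using W.construct_basis[OF ind, of b] that yB V.span_base[of b B] by (auto simp: l_def)
  then have "l p = 0" if "p \<in> V.span B" for p
    using that by (rule l.eq_0_on_span)
  moreover have "l y = 1"
    using W.construct_basis[OF ind, of y] by (auto simp: l_def)
  ultimately show ?thesis
    using B(3) l.add l.scale by (intro exI[of _ l]) blast
qed

lemma finite_box: "finite (- big (b :: 'n::finite \<Rightarrow> nat))"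
proof (rule finite_imageD)
  show "finite (lookup ` (- big b))"
  proof (rule finite_subset)
    show "lookup ` (- big b) \<subseteq> Pi\<^sub>E UNIV (\<lambda>i. {..<b i})"
      by (auto simp: big_def PiE_def simp flip: not_le)
  qed (auto intro: finite_PiE)
  show "inj_on lookup (- big b)"
    by (auto simp: inj_on_def)
qed

lemma box_add_tope:
  assumes "u \<notin> big b"
  shows "(tope b - u) + u = tope b"
proof (rule poly_mapping_eqI)
  fix i
  have "lookup u i < b i" using assms by (auto simp: big_def not_le)
  then show "lookup ((tope b - u) + u) i = lookup (tope b) i"
    by (simp add: lookup_add lookup_minus)
qed

text \<open>Modulo the powers, sending (h, p) to the coefficient of h * p at \<open>tope b\<close>
  is a perfect pairing. A linear functional that vanishes on \<open>L\<close> but not at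
  \<open>y\<close> is therefore given by some h. Since \<open>L\<close> is an ideal, shifting any
  coefficient of h * p to the position \<open>tope b\<close> shows that it vanishes too. In effect,
  B : (B : L) = L for the ideal B of the powers.\<close>

lemma ex_colon_separating:
  fixes L :: "('n::finite, 'k::field) mpoly set"
  assumes L: "is_ideal L" and b: "\<And>i. 1 \<le> b i" and bL: "mideal (big b) \<subseteq> L" and y: "y \<notin> L"
  shows "\<exists>h. (\<forall>p\<in>L. h * p \<in> mideal (big b)) \<and> h * y \<notin> mideal (big b)"
proof -
  obtain l where l: "\<And>p q. l (p + q) = l p + l q" "\<And>c p. l (Const c * p) = c * l p"
    "\<And>p. p \<in> L \<Longrightarrow> l p = 0" "l y = (1::'k)"
    using ex_functional[OF L y] by blast
  have l0: "l 0 = 0" using l(2)[of 0 0] by simp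
  have lsum: "l (sum f A) = (\<Sum>x\<in>A. l (f x))" for f :: "('n \<Rightarrow>\<^sub>0 nat) \<Rightarrow> _" and A
    by (induction A rule: infinite_finite_induct) (auto simp: l0 l(1))
  let ?X = "- big b"
  \<comment> \<open>The dual element of \<open>l\<close>: its coefficient at
    \<open>tope b - u\<close> is the value of \<open>l\<close> at the monomial with exponent
    \<open>u\<close>.\<close>
  define h where "h = (\<Sum>u\<in>?X. Const (l (mon u)) * mon (tope b - u))"
  have tau: "lookup (h * p) (tope b) = l p" for p
  proof -
    have "lookup (h * p) (tope b) = (\<Sum>u\<in>?X. lookup (Const (l (mon u)) * (mon (tope b - u) * p)) (tope b))"
      by (simp add: h_def sum_distrib_right lookup_sum mult.assoc)
    also have "\<dots> = (\<Sum>u\<in>?X. l (mon u) * lookup p u)"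
    proof (rule sum.cong[OF refl])
      fix u assume "u \<in> ?X"
      then have "lookup (mon (tope b - u) * p) (tope b) = lookup p u"
        using lookup_mon_mult[of "tope b - u" p u] box_add_tope[of u b] by simp
      then show "lookup (Const (l (mon u)) * (mon (tope b - u) * p)) (tope b) = l (mon u) * lookup p u"
        by (simp add: lookup_Const_mult)
    qed
    also have "\<dots> = l (\<Sum>u\<in>?X. Const (lookup p u) * mon u)"
      by (simp add: lsum l(2) mult.commute[of "l _"])
    also have "\<dots> = l p"
    proof -
      define q where "q = (\<Sum>u\<in>?X. Const (lookup p u) * mon u)"
      have "lookup q a = lookup p a" if "a \<in> ?X" for a
        using that finite_box[of b]
        by (simp add: q_def lookup_sum lookup_Const_mult lookup_mon if_distrib cong: if_cong)
      then have "p - q \<in> mideal (big b)"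
        by (force simp: mideal_def in_keys_iff lookup_minus)
      then have "l (p - q) = 0" using bL l(3) by blast
      then show ?thesis using l(1)[of "p - q" q] by (simp add: q_def)
    qed
    finally show ?thesis .
  qed
  have "h * p \<in> mideal (big b)" if "p \<in> L" for p
  proof (rule ccontr)
    assume "h * p \<notin> mideal (big b)"
    then obtain c where c: "c \<in> keys (h * p)" "c \<notin> big b" by (auto simp: mideal_def)
    have "lookup (mon (tope b - c) * (h * p)) (tope b) = lookup (h * p) c"
      using lookup_mon_mult[of "tope b - c" "h * p" c] box_add_tope[OF c(2)] by simp
    moreover have "mon (tope b - c) * (h * p) = h * (mon (tope b - c) * p)"
      by (simp only: mult_ac)
    ultimately have "lookup (h * p) c = l (mon (tope b - c) * p)"
      by (simp add: tau)
    also have "\<dots> = 0"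
      by (rule l(3)) (rule ring_module.subspace_scale[OF L that])
    finally show False using c(1) by (simp add: in_keys_iff)
  qed
  moreover have "h * y \<notin> mideal (big b)"
  proof
    assume "h * y \<in> mideal (big b)"
    moreover have "tope b \<notin> big b"
      using b by (auto simp: big_def not_le Suc_le_eq)
    ultimately have "tope b \<notin> keys (h * y)" unfolding mideal_def by blast
    then show False using tau[of y] l(4) by (simp add: in_keys_iff)
  qed
  ultimately show ?thesis by blast
qed

lemma mon_in_powers_colon_iff:
  fixes L :: "('x, 'c::comm_ring_1) mpoly set"
  shows "(\<forall>p\<in>L. mon a * p \<in> mideal E) \<longleftrightarrow> (\<forall>p\<in>L. \<forall>e\<in>keys p. a + e \<in> E)"
proof -
  have "mon a * p \<in> mideal E \<longleftrightarrow> (\<forall>e\<in>keys p. a + e \<in> E)" for p :: "('x, 'c) mpoly"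
  proof
    assume "mon a * p \<in> mideal E"
    then show "\<forall>e\<in>keys p. a + e \<in> E"
      by (auto simp: mideal_def in_keys_iff lookup_mon_mult subset_iff)
  next
    assume "\<forall>e\<in>keys p. a + e \<in> E"
    then show "mon a * p \<in> mideal E"
      using keys_mult_subset[of "mon a" p] by (auto simp: mideal_def mon_def)
  qed
  then show ?thesis by blast
qed

text \<open>A monomial multiplies p into a monomial ideal iff it does so with each term of p. So B :
  C and B : Mono(C) contain the same monomials, and for C = B : K duality turns B : C into
  K.\<close>

lemma monomial_colon_formula:
  fixes K :: "('n::finite, 'k::field) mpoly set"
  assumes K: "is_ideal K" and b: "\<And>i. 1 \<le> b i" and bK: "mideal (big b) \<subseteq> K"
  shows "largest_monomial_subideal K = ideal_colon (mideal (big b))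
    (smallest_monomial_superideal (ideal_colon (mideal (big b)) K))"
proof -
  let ?B = "mideal (big b) :: ('n, 'k) mpoly set"
  let ?C = "ideal_colon ?B K"
  define S where "S = smallest_monomial_superideal ?C"
  have B: "is_ideal ?B" by (rule is_ideal_mideal[OF up_closed_big])
  have S: "S = ideal_gen (mon ` (\<Union>p\<in>?C. keys p))"
    unfolding S_def by (rule smallest_monomial_superideal_eq)
  have in_S: "r \<in> ideal_colon ?B S \<longleftrightarrow> (\<forall>p\<in>?C. \<forall>e\<in>keys p. r * mon e \<in> ?B)" for r
  proof
    assume r: "r \<in> ideal_colon ?B S"
    show "\<forall>p\<in>?C. \<forall>e\<in>keys p. r * mon e \<in> ?B"
    proof (intro ballI)
      fix p e assume "p \<in> ?C" "e \<in> keys p"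
      then have "mon e \<in> S" unfolding S by (intro ring_module.span_base) blast
      then show "r * mon e \<in> ?B" using r by (simp add: ideal_colon_def)
    qed
  next
    assume r: "\<forall>p\<in>?C. \<forall>e\<in>keys p. r * mon e \<in> ?B"
    have "is_ideal {q. r * q \<in> ?B}"
      by (auto simp: ring_module.subspace_def distrib_left ring_module.subspace_0[OF B]
          ring_module.subspace_add[OF B] mult.left_commute[of r] ring_module.subspace_scale[OF B])
    then have "S \<subseteq> {q. r * q \<in> ?B}"
      unfolding S using r by (intro ring_module.span_minimal) auto
    then show "r \<in> ideal_colon ?B S" by (auto simp: ideal_colon_def)
  qed
  have mon_iff: "mon a \<in> K \<longleftrightarrow> mon a \<in> ideal_colon ?B S" for a
  proof
    assume a: "mon a \<in> K"
    have "\<forall>p\<in>?C. mon a * p \<in> ?B"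
      using a by (auto simp: ideal_colon_def mult.commute)
    then show "mon a \<in> ideal_colon ?B S"
      unfolding in_S mon_in_powers_colon_iff by (simp flip: mon_add)
  next
    assume "mon a \<in> ideal_colon ?B S"
    then have "\<forall>p\<in>?C. mon a * p \<in> ?B"
      unfolding in_S mon_in_powers_colon_iff by (simp flip: mon_add)
    then show "mon a \<in> K"
      using ex_colon_separating[OF K b bK, of "mon a"] by (auto simp: ideal_colon_def mult.commute)
  qed
  have "largest_monomial_subideal K = ideal_gen (K \<inter> range mon)"
    by (rule largest_monomial_subideal_eq[OF K])
  also have "\<dots> = ideal_colon ?B S"
  proof (rule antisym)
    have "is_ideal (ideal_colon ?B S)"
      by (auto simp: ring_module.subspace_def ideal_colon_def distrib_right mult.assoc
          ring_module.subspace_0[OF B] ring_module.subspace_add[OF B] ring_module.subspace_scale[OF B])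
    then show "ideal_gen (K \<inter> range mon) \<subseteq> ideal_colon ?B S"
      using mon_iff by (intro ring_module.span_minimal) auto
    show "ideal_colon ?B S \<subseteq> ideal_gen (K \<inter> range mon)"
    proof
      fix r assume r: "r \<in> ideal_colon ?B S"
      have "mon u \<in> K" if u: "u \<in> keys r" for u
        unfolding mon_iff in_S
      proof (intro ballI)
        fix p e assume "p \<in> ?C" "e \<in> keys p"
        then have "mon e * r \<in> ?B" using r by (simp add: in_S mult.commute)
        then have "e + u \<in> big b"
          using mon_in_powers_colon_iff[of "{r}" e "big b"] u by auto
        then show "mon u * mon e \<in> ?B" by (simp flip: mon_add add: add.commute)
      qed
      then have "mideal (keys r) \<subseteq> ideal_gen (K \<inter> range mon)"
        by (intro mideal_subset_ideal) (auto intro: ring_module.span_base)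
      then show "r \<in> ideal_gen (K \<inter> range mon)" by (auto simp: mideal_def)
    qed
  qed
  finally show ?thesis by (simp add: S_def)
qed

section \<open>The transition determinant of two parameter systems\<close>

lemma monval_diff_in_ideal:
  assumes L: "is_ideal L" and uv: "\<And>x. u x - v x \<in> L"
  shows "monval u a - monval v a \<in> L"
proof -
  have "u x ^ n - v x ^ n \<in> L" for x n
  proof (induction n)
    case (Suc n)
    have "u x ^ Suc n - v x ^ Suc n = u x * (u x ^ n - v x ^ n) + v x ^ n * (u x - v x)"
      by (simp add: algebra_simps)
    then show ?case
      using ring_module.subspace_add[OF L ring_module.subspace_scale[OF L Suc]
          ring_module.subspace_scale[OF L uv]] by metis
  qed (simp add: ring_module.subspace_0[OF L])
  then show ?thesis
    using prod_diff_in_ideal[OF L, of "keys a" 1 "\<lambda>x. u x ^ lookup a x" "\<lambda>x. v x ^ lookup a x"]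
    by (simp add: monval_def)
qed

lemma peval_diff_in_ideal:
  assumes "rhom h" and L: "is_ideal L" and uv: "\<And>x. u x - v x \<in> L"
  shows "peval h u F - peval h v F \<in> L"
proof -
  have "peval h u F - peval h v F = (\<Sum>a\<in>keys F. h (lookup F a) * (monval u a - monval v a))"
    by (simp add: peval_def sum_subtractf right_diff_distrib)
  also have "\<dots> \<in> L"
    by (rule ring_module.subspace_sum[OF L], rule ring_module.subspace_scale[OF L],
        rule monval_diff_in_ideal[OF L uv])
  finally show ?thesis .
qed

lemma single_eq_0_iff: "single i n = 0 \<longleftrightarrow> n = 0"
  by (metis lookup_single_eq lookup_zero single_zero)

lemma lookup_mult_Const: "lookup (p * Const c) a = lookup p a * c"
  using lookup_Const_mult[of c p a] by (simp add: mult.commute)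

text \<open>The Bezoutian of \<open>g\<close>, a polynomial in two sets of variables, provides a generator of the
  socle modulo powers of the variables: the polynomials in \<open>x\<close> are the coefficients, and \<open>y\<close> is the
  outer set of variables.\<close>

lemma colon_subset_transition_det:
  fixes g :: "'n::finite \<Rightarrow> ('n, 'k::field) mpoly"
  assumes b: "\<And>i. 1 \<le> b i" and s: "lookup s 0 \<noteq> 0"
    and M: "\<And>i. (\<Sum>j\<in>UNIV. M i j * g j) = s * Var i ^ b i"
    and h: "\<And>j. h * g j \<in> mideal (big b)"
  shows "\<exists>e r. lookup e 0 \<noteq> 0 \<and> e * h - dt M * r \<in> mideal (big b)"
proof -
  let ?B = "mideal (big b) :: ('n, 'k) mpoly set"
  have B: "is_ideal ?B" by (rule is_ideal_mideal[OF up_closed_big])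
  \<comment> \<open>\<open>Const p\<close> is p in the inner variables x, and \<open>cy p\<close> is
    p in the outer variables y. Their difference lies in the ideal of the x_j - y_j, which are the
    \<open>z j\<close>.\<close>
  define cy :: "('n, 'k) mpoly \<Rightarrow> ('n, ('n, 'k) mpoly) mpoly" where "cy = cmap Const"
  have hy: "rhom cy" unfolding cy_def by (rule rhom_cmap[OF rhom_Const])
  note hx = rhom_Const
  define z :: "'n \<Rightarrow> ('n, ('n, 'k) mpoly) mpoly" where "z j = Const (Var j) - Var j" for j
  have ex_diff: "\<exists>q. Const p - cy p = (\<Sum>j\<in>UNIV. q j * z j)" for p
  proof -
    note CC = rhom_comp[OF rhom_Const rhom_Const]
    have "(Const p :: ('n, ('n, 'k) mpoly) mpoly) = peval (\<lambda>c. Const (Const c)) (\<lambda>j. Const (Var j)) p"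
      using rhom_peval_comp[OF rhom_Const rhom_Const, of Var p] by simp
    moreover have "peval (\<lambda>c. Const (Const c)) (\<lambda>j. Const (Var j)) p - peval (\<lambda>c. Const (Const c)) Var p
        \<in> ideal_gen (range z)"
      by (rule peval_diff_in_ideal[OF CC]) (auto simp: z_def intro: ring_module.span_base)
    ultimately have "Const p - cy p \<in> ideal_gen (range z)"
      by (simp add: cy_def cmap_def)
    then show ?thesis by (simp only: ideal_gen_range_iff)
  qed
  obtain Q1 where Q1: "\<And>p. Const p - cy p = (\<Sum>j\<in>UNIV. Q1 p j * z j)"
    using ex_diff by metis
  \<comment> \<open>This is the ideal of all x_i ^ b i and y_i ^ b i, described by top coefficients
    in y: multiplication by a monomial in y moves any coefficient below \<open>b\<close> to the
    position \<open>tope b\<close>.\<close>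
  define N where "N = {F. \<forall>G. lookup (G * F) (tope b) \<in> ?B}"
  have N: "is_ideal N"
    unfolding N_def
    by (rule ring_module.subspaceI)
      (auto simp: distrib_left lookup_add mult.assoc[symmetric] intro: ring_module.subspace_0[OF B]
        ring_module.subspace_add[OF B])
  have Nx: "Const p \<in> N" if "p \<in> ?B" for p
    using ring_module.subspace_scale[OF B that] by (simp add: N_def lookup_mult_Const)
  have Ny_power: "Var i ^ b i \<in> N" for i
  proof -
    have "lookup (G * Var i ^ b i) (tope b) = 0" for G :: "('n, ('n, 'k) mpoly) mpoly"
    proof -
      have "G * Var i ^ b i \<in> mideal {a. b i \<le> lookup a i}"
        by (rule mideal_mult_in[of _ UNIV _ "{a. b i \<le> lookup a i}"])
          (auto simp: Var_power lookup_add, simp add: mideal_def)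
      moreover have "tope b \<notin> {a. b i \<le> lookup a i}" using b[of i] by (simp add: not_le)
      ultimately have "tope b \<notin> keys (G * Var i ^ b i)" unfolding mideal_def by blast
      then show ?thesis by (simp add: in_keys_iff)
    qed
    then show ?thesis by (simp add: N_def ring_module.subspace_0[OF B])
  qed
  have Ny: "cy p \<in> N" if "p \<in> ?B" for p
  proof -
    have "mideal (big b) \<subseteq> N"
      unfolding ideal_gen_powers[symmetric] using Ny_power
      by (intro ring_module.span_minimal N) auto
    moreover have "cy p \<in> mideal (big b)"
      using that keys_cmap[of Const p] by (auto simp: mideal_def cy_def)
    ultimately show ?thesis by blast
  qed
  define w where "w i = s * Var i ^ b i" for i
  have wB: "w i \<in> ?B" for i
    unfolding w_def by (rule ring_module.subspace_scale[OF B]) (auto simp: Var_power big_def intro!: exI[of _ i])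
  \<comment> \<open>Product rule for M g: M(x) g(x) - M(y) g(y) = M(x) (g(x) - g(y)) + (M(x) - M(y))
    g(y). \<open>X\<close> is the matrix of the first summand and \<open>P\<close> that of the
    second.\<close>
  define X where "X i j = (\<Sum>l\<in>UNIV. Const (M i l) * Q1 (g l) j)" for i j
  define P where "P i j = (\<Sum>l\<in>UNIV. cy (g l) * Q1 (M i l) j)" for i j
  have Bz: "(\<Sum>j\<in>UNIV. (X i j + P i j) * z j) = Const (w i) - cy (w i)" for i
  proof -
    have "(\<Sum>j\<in>UNIV. (X i j + P i j) * z j)
      = (\<Sum>l\<in>UNIV. Const (M i l) * (\<Sum>j\<in>UNIV. Q1 (g l) j * z j))
        + (\<Sum>l\<in>UNIV. cy (g l) * (\<Sum>j\<in>UNIV. Q1 (M i l) j * z j))"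
      unfolding X_def P_def distrib_right sum.distrib sum_distrib_right sum_distrib_left
      by (simp add: mult.assoc) (intro arg_cong2[where f = plus]; rule sum.swap)
    also have "\<dots> = (\<Sum>l\<in>UNIV. Const (M i l) * Const (g l) - cy (M i l) * cy (g l))"
      unfolding Q1[symmetric] sum.distrib[symmetric] by (simp add: algebra_simps)
    also have "\<dots> = Const (\<Sum>l\<in>UNIV. M i l * g l) - cy (\<Sum>l\<in>UNIV. M i l * g l)"
      by (simp add: sum_subtractf rhom.sum[OF hx] rhom.sum[OF hy] rhom.mult[OF hx] rhom.mult[OF hy])
    finally show ?thesis by (simp only: M w_def)
  qed
  define E where "E = dt (\<lambda>i j. X i j + P i j)"
  have zE: "z k * E \<in> N" for k
    unfolding E_def by (rule dt_mult_in_ideal[OF N])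
      (use Bz Nx[OF wB] Ny[OF wB] ring_module.subspace_diff[OF N] in metis)
  have 1: "(Const h - cy h) * E \<in> N"
    unfolding Q1 sum_distrib_right mult.assoc
    by (rule ring_module.subspace_sum[OF N], rule ring_module.subspace_scale[OF N], rule zE)
  \<comment> \<open>Every entry of \<open>P\<close> is a combination of the \<open>cy (g l)\<close>,
    and h * g l lies in the ideal of the powers; hence h(y) annihilates \<open>P\<close> modulo
    \<open>N\<close>.\<close>
  have "cy h * (E - dt X) \<in> N"
    unfolding E_def
  proof (rule dt_diff_in_ideal[OF N])
    fix i j
    have "cy h * (X i j + P i j - X i j) = (\<Sum>l\<in>UNIV. Q1 (M i l) j * cy (h * g l))"
      by (simp add: P_def sum_distrib_left rhom.mult[OF hy] mult_ac)
    also have "\<dots> \<in> N"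
      by (rule ring_module.subspace_sum[OF N], rule ring_module.subspace_scale[OF N], rule Ny, rule h)
    finally show "cy h * (X i j + P i j - X i j) \<in> N" .
  qed
  with 1 have "(Const h - cy h) * E + cy h * (E - dt X) \<in> N"
    by (rule ring_module.subspace_add[OF N])
  moreover have "dt X = Const (dt M) * dt (\<lambda>l. Q1 (g l))"
    using dt_mult[of "\<lambda>i l. Const (M i l)" "\<lambda>l. Q1 (g l)"]
    by (simp add: X_def[abs_def] rhom.dt[OF hx])
  ultimately have "Const h * E - cy h * (Const (dt M) * dt (\<lambda>l. Q1 (g l))) \<in> N"
    by (simp add: algebra_simps)
  then have "Const h * E - Const (dt M) * (cy h * dt (\<lambda>l. Q1 (g l))) \<in> N"
    by (simp only: mult.left_commute)
  \<comment> \<open>Comparing coefficients at \<open>tope b\<close> in y leaves a congruence in x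
    alone, with the top coefficient of \<open>E\<close> as the factor e.\<close>
  then have "lookup (1 * (Const h * E - Const (dt M) * (cy h * dt (\<lambda>l. Q1 (g l))))) (tope b) \<in> ?B"
    unfolding N_def by blast
  then have "lookup E (tope b) * h - dt M * lookup (cy h * dt (\<lambda>l. Q1 (g l))) (tope b) \<in> ?B"
    by (simp add: lookup_minus lookup_Const_mult mult.commute[of h])
  \<comment> \<open>At x = 0 the matrix \<open>X + P\<close> sends the vector y to s(y) y_i ^ b i,
    the signs cancelling, so \<open>coeff_dt_tope\<close> gives s(0) ^ d, which is nonzero.\<close>
  moreover have "lookup (lookup E (tope b)) 0 \<noteq> 0"
  proof -
    let ?e = "\<lambda>p :: ('n, 'k) mpoly. lookup p 0"
    let ?E = "cmap ?e :: ('n, ('n, 'k) mpoly) mpoly \<Rightarrow> ('n, 'k) mpoly"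
    note he = rhom_cmap[OF rhom_lookup_0]
    have Ex: "?E (Const p) = Const (lookup p 0)" for p
      by (rule cmap_Const[OF rhom_lookup_0])
    have Ey: "?E (cy p) = p" for p
      by (rule poly_mapping_eqI) (simp add: lookup_cmap cy_def, simp add: Const_def)
    have "?E (Var j) = Var j" for j
      unfolding Var_def by (rule cmap_mon[OF rhom_lookup_0])
    moreover have "lookup (Var j :: ('n, 'k) mpoly) 0 = 0" for j
      by (simp add: Var_def lookup_0_mon single_eq_0_iff)
    ultimately have Ez: "?E (z j) = - Var j" for j
      by (simp add: z_def rhom.diff[OF he] Ex)
    have "(Var i ^ b i :: ('n, 'k) mpoly) = mon (single i (b i))" for i by (rule Var_power)
    moreover have "single i (b i) \<noteq> 0" for i
      using b[of i] by (simp add: single_eq_0_iff)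
    ultimately have w0: "lookup (w i) 0 = 0" for i
      by (simp add: w_def rhom.mult[OF rhom_lookup_0] lookup_0_mon)
    have "(\<Sum>j\<in>UNIV. ?E (X i j + P i j) * Var j) = s * Var i ^ b i" for i
    proof -
      have "?E (\<Sum>j\<in>UNIV. (X i j + P i j) * z j) = - w i"
        unfolding Bz by (simp add: rhom.diff[OF he] Ex Ey w0)
      then have "- (\<Sum>j\<in>UNIV. ?E (X i j + P i j) * Var j) = - w i"
        by (simp add: rhom.sum[OF he] rhom.mult[OF he] Ez sum_negf)
      then show ?thesis by (simp add: w_def)
    qed
    then have "lookup (dt (\<lambda>i j. ?E (X i j + P i j))) (tope b) = lookup s 0 ^ CARD('n)"
      by (rule coeff_dt_tope[OF b])
    then have "lookup (?E E) (tope b) = lookup s 0 ^ CARD('n)"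
      by (simp add: E_def rhom.dt[OF he])
    then show ?thesis using s by (simp add: lookup_cmap)
  qed
  ultimately show ?thesis by blast
qed

text \<open>For y outside the ideal of \<open>g\<close> and the powers, duality yields h with h * g
  j among the powers but h * y not. A unit multiple of h is a multiple of det M modulo the powers,
  so the assumption on \<open>dt M * y\<close> contradicts this. Getting rid of the powers costs the
  factor s, because s * Var i ^ b i lies in the ideal of \<open>g\<close>.\<close>

theorem transition_det_colon:
  fixes g :: "'n::finite \<Rightarrow> ('n, 'k::field) mpoly"
  assumes b: "\<And>i. 1 \<le> b i" and s: "lookup s 0 \<noteq> 0"
    and M: "\<And>i. (\<Sum>j\<in>UNIV. M i j * g j) = s * Var i ^ b i"
    and y: "dt M * y \<in> mideal (big b)"
  shows "s * y \<in> ideal_gen (range g)"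
proof -
  let ?B = "mideal (big b) :: ('n, 'k) mpoly set"
  have B: "is_ideal ?B" by (rule is_ideal_mideal[OF up_closed_big])
  let ?L = "ideal_gen (range g \<union> range (\<lambda>i. Var i ^ b i))"
  have "y \<in> ?L"
  proof (rule ccontr)
    assume "y \<notin> ?L"
    moreover have "?B \<subseteq> ?L"
      unfolding ideal_gen_powers[symmetric] by (rule ring_module.span_mono) blast
    ultimately obtain h where h: "\<And>p. p \<in> ?L \<Longrightarrow> h * p \<in> ?B" "h * y \<notin> ?B"
      using ex_colon_separating[of ?L b y] b by auto
    have "h * g j \<in> ?B" for j
      by (rule h(1)) (auto intro: ring_module.span_base)
    from colon_subset_transition_det[OF b s M this]
    obtain e r where e: "lookup e 0 \<noteq> 0" "e * h - dt M * r \<in> ?B" by blast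
    have "y * (e * h - dt M * r) + r * (dt M * y) \<in> ?B"
      by (rule ring_module.subspace_add[OF B ring_module.subspace_scale[OF B e(2)]
            ring_module.subspace_scale[OF B y]])
    then have "e * (h * y) \<in> ?B" by (simp add: algebra_simps)
    moreover have "mon a \<in> ?B" if "(\<Sum>i\<in>UNIV. b i) \<le> mdeg a" for a
      using large_degree_in_big[OF that] by simp
    ultimately have "h * y \<in> ?B" using unit_cancel[OF B _ e(1)] by blast
    with h(2) show False by blast
  qed
  then obtain u v where uv: "y = u + v" "u \<in> ideal_gen (range g)" "v \<in> ideal_gen (range (\<lambda>i. Var i ^ b i))"
    unfolding ring_module.span_Un by blast
  have "s * v \<in> ideal_gen (range g)"
  proof -
    obtain q where "v = (\<Sum>j\<in>UNIV. q j * Var j ^ b j)" using uv(3) ideal_gen_range_iff by metis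
    then have "s * v = (\<Sum>j\<in>UNIV. q j * (\<Sum>l\<in>UNIV. M j l * g l))"
      by (simp add: M sum_distrib_left mult.left_commute)
    also have "\<dots> \<in> ideal_gen (range g)"
      by (intro ring_module.span_sum ring_module.span_scale) (auto intro: ring_module.span_base)
    finally show ?thesis .
  qed
  then show ?thesis
    using uv by (simp add: distrib_left ring_module.span_add ring_module.span_scale)
qed

section \<open>A Frobenius argument over the integers\<close>

lemma prime_dvd_power_add:
  fixes a b :: "'a::comm_ring_1"
  assumes p: "prime p"
  shows "of_nat p dvd (a + b) ^ p - (a ^ p + b ^ p)"
proof -
  have p0: "p > 0" using p by (rule prime_gt_0_nat)
  have "(a + b) ^ p = (\<Sum>k\<in>{..p}. of_nat (p choose k) * a ^ k * b ^ (p - k))"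
    by (rule binomial_ring)
  also have "{..p} = insert 0 (insert p {0<..<p})" using p0 by auto
  also have "(\<Sum>k\<in>insert 0 (insert p {0<..<p}). of_nat (p choose k) * a ^ k * b ^ (p - k))
    = b ^ p + (a ^ p + (\<Sum>k\<in>{0<..<p}. of_nat (p choose k) * a ^ k * b ^ (p - k)))"
    using p0 by simp
  finally have "(a + b) ^ p - (a ^ p + b ^ p) = (\<Sum>k\<in>{0<..<p}. of_nat (p choose k) * a ^ k * b ^ (p - k))"
    by (simp add: algebra_simps)
  moreover have "of_nat p dvd (of_nat (p choose k) * a ^ k * b ^ (p - k) :: 'a)" if "k \<in> {0<..<p}" for k
  proof -
    have "p dvd (p choose k)" by (rule dvd_choose_prime) (use p that in auto)
    then have "(of_nat p :: 'a) dvd of_nat (p choose k)" by (auto elim!: dvdE)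
    then show ?thesis by (simp add: dvd_mult2)
  qed
  ultimately show ?thesis by (simp only:) (rule dvd_sum)
qed

text \<open>Iterated Frobenius: an error term divisible by p remains so under p-th powers.\<close>

lemma prime_dvd_power_sum:
  fixes u :: "'i \<Rightarrow> 'a::comm_ring_1"
  assumes p: "prime p" and A: "finite A"
  shows "of_nat p dvd (\<Sum>i\<in>A. u i) ^ p ^ e - (\<Sum>i\<in>A. u i ^ p ^ e)"
proof (induction e arbitrary: u)
  case (Suc e)
  have 1: "of_nat p dvd (\<Sum>i\<in>A. v i) ^ p - (\<Sum>i\<in>A. v i ^ p)" for v :: "'i \<Rightarrow> 'a"
    using A
  proof (induction A)
    case empty
    then show ?case using prime_gt_0_nat[OF p] by (simp add: power_0_left)
  next
    case (insert x A)
    have "(\<Sum>i\<in>insert x A. v i) ^ p - (\<Sum>i\<in>insert x A. v i ^ p)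
      = ((v x + sum v A) ^ p - (v x ^ p + sum v A ^ p)) + ((\<Sum>i\<in>A. v i) ^ p - (\<Sum>i\<in>A. v i ^ p))"
      using insert.hyps by simp
    then show ?case
      using prime_dvd_power_add[OF p, of "v x" "sum v A"] insert.IH by (simp only: dvd_add)
  qed
  obtain w where w: "(\<Sum>i\<in>A. u i) ^ p ^ e = (\<Sum>i\<in>A. u i ^ p ^ e) + of_nat p * w"
    using Suc[of u] by (auto simp: dvd_def algebra_simps)
  have "(\<Sum>i\<in>A. u i) ^ p ^ Suc e - (\<Sum>i\<in>A. u i ^ p ^ Suc e)
    = (((\<Sum>i\<in>A. u i ^ p ^ e) + of_nat p * w) ^ p - ((\<Sum>i\<in>A. u i ^ p ^ e) ^ p + (of_nat p * w) ^ p))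
      + (of_nat p * w) ^ p + ((\<Sum>i\<in>A. u i ^ p ^ e) ^ p - (\<Sum>i\<in>A. (u i ^ p ^ e) ^ p))"
    by (simp add: power_mult mult.commute[of p] w)
  moreover have 2: "of_nat p dvd (of_nat p * w) ^ p"
    using prime_gt_0_nat[OF p] by (simp add: power_mult_distrib dvd_power)
  ultimately show ?case
    by (simp only:) (intro dvd_add prime_dvd_power_add[OF p] 1 2)
qed simp

definition smul :: "nat \<Rightarrow> ('x \<Rightarrow>\<^sub>0 nat) \<Rightarrow> 'x \<Rightarrow>\<^sub>0 nat"
  where "smul q a = (\<Sum>i<q. a)"

lemma lookup_smul [simp]: "lookup (smul q a) i = q * lookup a i"
  by (simp add: smul_def lookup_sum)

lemma mon_smul: "mon a ^ q = mon (smul q a)"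
  by (simp add: smul_def mon_power)

lemma mdeg_smul: "mdeg (smul q a) = q * mdeg a"
  by (simp add: mdeg_def sum_distrib_left)

lemma single_power: "single a c ^ q = single (smul q a) (c ^ q)"
  for c :: "'c::comm_ring_1"
  by (simp add: single_eq power_mult_distrib mon_smul rhom.power[OF rhom_Const])

lemma lookup_of_nat_mult: "lookup (of_nat p * F) a = of_nat p * lookup F a"
  for F :: "('x, 'c::comm_ring_1) mpoly"
  using lookup_Const_mult[of "of_nat p" F a] by (simp add: rhom.of_nat[OF rhom_Const])

text \<open>A tight closure argument: modulo a large prime \<open>p\<close>, raising to a power \<open>q\<close> of \<open>p\<close> is additive, and
  the factor \<open>mon c\<close> is too small to push the \<open>q\<close>-th power of a monomial outside the ideal of the
  \<open>x_i ^ b i\<close> into the ideal of the \<open>x_i ^ (q * b i)\<close>.\<close>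

lemma frobenius_colon:
  fixes G :: "'n::finite \<Rightarrow> ('n, int) mpoly"
  assumes b: "\<And>i. 1 \<le> b i" and s: "lookup s 0 \<noteq> 0"
    and M: "\<And>i. (\<Sum>j\<in>UNIV. M i j * G j) = s * Var i ^ b i"
    and y: "\<And>q. s ^ (D * q) * mon c * y ^ q \<in> ideal_gen (range (\<lambda>j. G j ^ q))"
  shows "dt M * y \<in> mideal (big b)"
proof (rule ccontr)
  define P where "P = dt M * y"
  assume "dt M * y \<notin> mideal (big b)"
  then obtain a where a: "a \<in> keys P" "a \<notin> big b" by (auto simp: mideal_def P_def)
  \<comment> \<open>Larger than the absolute values of s(0) and of the offending coefficient, so
    that neither vanishes modulo p.\<close>
  obtain p where p: "prime p" "nat (\<bar>lookup s 0\<bar> + \<bar>lookup P a\<bar>) < p"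
    using bigger_prime by blast
  have ip: "prime (int p)" using p(1) by simp
  have ndvd: "\<not> int p dvd x" if "x \<noteq> 0" "\<bar>x\<bar> < int p" for x
    using that dvd_imp_le_int[of x "int p"] by auto
  have ps: "\<not> int p dvd lookup s 0" using s p(2) by (intro ndvd) auto
  define A where "A = {a \<in> keys P. a \<notin> big b \<and> \<not> int p dvd lookup P a}"
  have "\<not> int p dvd lookup P a" using a(1) p(2) by (intro ndvd) (auto simp: in_keys_iff)
  then have "a \<in> A" using a by (simp add: A_def)
  moreover have "finite A" by (simp add: A_def)
  \<comment> \<open>Least degree ensures that no other exponent of \<open>A\<close>, multiplied by q
    and shifted by a term of the power of s, can reach q * a0.\<close>
  ultimately have "\<exists>a0\<in>A. \<forall>a\<in>A. mdeg a0 \<le> mdeg a"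
    by (intro bexI[of _ "arg_min_on mdeg A"] ballI arg_min_least arg_min_if_finite(1)) auto
  then obtain a0 where a0: "a0 \<in> A" "\<And>a. a \<in> A \<Longrightarrow> mdeg a0 \<le> mdeg a" by blast
  \<comment> \<open>As p is at least 2, this power exceeds \<open>mdeg c\<close>; so adding c to q *
    a0 does not reach q * b l in any coordinate.\<close>
  define q where "q = p ^ mdeg c"
  have q: "mdeg c < q"
    unfolding q_def by (rule power_gt_expt) (rule prime_gt_1_nat[OF p(1), simplified One_nat_def])
  \<comment> \<open>The ideal generated by p and the Frobenius powers x_l ^ (q * b l), described by
    representatives over the integers.\<close>
  define Lq :: "('n, int) mpoly set" where "Lq = {of_nat p * H + F | H F. F \<in> mideal (big (\<lambda>l. q * b l))}"
  have Lq: "is_ideal Lq"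
  proof (rule ring_module.subspaceI)
    have B: "is_ideal (mideal (big (\<lambda>l. q * b l)) :: ('n, int) mpoly set)"
      by (rule is_ideal_mideal[OF up_closed_big])
    show "0 \<in> Lq"
      using ring_module.subspace_0[OF B] by (auto simp: Lq_def intro!: exI[of _ 0])
    fix x y :: "('n, int) mpoly" assume "x \<in> Lq"
    then obtain H F where x: "x = of_nat p * H + F" "F \<in> mideal (big (\<lambda>l. q * b l))"
      by (auto simp: Lq_def)
    { assume "y \<in> Lq"
      then obtain H' F' where y: "y = of_nat p * H' + F'" "F' \<in> mideal (big (\<lambda>l. q * b l))"
        by (auto simp: Lq_def)
      have "x + y = of_nat p * (H + H') + (F + F')" by (simp add: x y algebra_simps)
      then show "x + y \<in> Lq"
        using ring_module.subspace_add[OF B x(2) y(2)] unfolding Lq_def by blast }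
    have "y * x = of_nat p * (y * H) + y * F" by (simp add: x algebra_simps)
    then show "y * x \<in> Lq"
      using ring_module.subspace_scale[OF B x(2)] unfolding Lq_def by blast
  qed
  have "(dt M * G j) ^ q \<in> Lq" for j
  proof -
    have "G j * dt M \<in> ideal_gen (range (\<lambda>i. Var i ^ b i))"
      by (rule dt_mult_in_ideal) (auto simp: M intro!: ring_module.span_scale intro: ring_module.span_base)
    then obtain N where N: "dt M * G j = (\<Sum>l\<in>UNIV. N l * Var l ^ b l)"
      unfolding ideal_gen_range_iff by (auto simp: mult.commute)
    obtain H where "(\<Sum>l\<in>UNIV. N l * Var l ^ b l) ^ q = of_nat p * H + (\<Sum>l\<in>UNIV. (N l * Var l ^ b l) ^ q)"
      using prime_dvd_power_sum[OF p(1), of UNIV "\<lambda>l. N l * Var l ^ b l" "mdeg c"]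
      by (auto simp: q_def dvd_def algebra_simps)
    moreover have "(\<Sum>l\<in>UNIV. (N l * Var l ^ b l) ^ q) \<in> mideal (big (\<lambda>l. q * b l))"
    proof (rule mideal_sum)
      fix l
      have "(N l * Var l ^ b l) ^ q = N l ^ q * Var l ^ (q * b l)"
        by (simp add: power_mult_distrib power_mult[symmetric] mult.commute)
      moreover have "(Var l ^ (q * b l) :: ('n, int) mpoly) \<in> mideal (big (\<lambda>l. q * b l))"
        by (auto simp: Var_power big_def intro!: exI[of _ l])
      ultimately show "(N l * Var l ^ b l) ^ q \<in> mideal (big (\<lambda>l. q * b l))"
        by (simp add: ring_module.subspace_scale[OF is_ideal_mideal[OF up_closed_big]])
    qed
    ultimately show ?thesis unfolding N Lq_def by blast
  qed
  moreover have "dt M ^ q * F \<in> ideal_gen (range (\<lambda>j. (dt M * G j) ^ q))"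
    if F: "F \<in> ideal_gen (range (\<lambda>j. G j ^ q))" for F
  proof -
    obtain r where "F = (\<Sum>j\<in>UNIV. r j * G j ^ q)" using F unfolding ideal_gen_range_iff by blast
    then have "dt M ^ q * F = (\<Sum>j\<in>UNIV. r j * (dt M * G j) ^ q)"
      by (simp add: sum_distrib_left power_mult_distrib mult_ac)
    then show ?thesis unfolding ideal_gen_range_iff by blast
  qed
  ultimately have "dt M ^ q * (s ^ (D * q) * mon c * y ^ q) \<in> Lq"
    using y[of q] ring_module.span_minimal[OF _ Lq, of "range (\<lambda>j. (dt M * G j) ^ q)"] by blast
  moreover have "dt M ^ q * (s ^ (D * q) * mon c * y ^ q) = mon c * (s ^ (D * q) * P ^ q)"
    by (simp add: P_def power_mult_distrib mult_ac)
  ultimately obtain H F where HF: "mon c * (s ^ (D * q) * P ^ q) = of_nat p * H + F"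
    "F \<in> mideal (big (\<lambda>l. q * b l))" by (auto simp: Lq_def)
  have a0b: "lookup a0 l < b l" for l using a0(1) by (auto simp: A_def big_def not_le)
  have "c + smul q a0 \<notin> big (\<lambda>l. q * b l)"
  proof
    assume "c + smul q a0 \<in> big (\<lambda>l. q * b l)"
    then obtain l where l: "q * b l \<le> lookup c l + q * lookup a0 l" by (auto simp: big_def lookup_add)
    have "lookup c l \<le> mdeg c" unfolding mdeg_def by (rule member_le_sum) auto
    moreover have "q * Suc (lookup a0 l) \<le> q * b l" using a0b[of l] by (intro mult_le_mono2) simp
    ultimately show False using l q by simp
  qed
  then have "c + smul q a0 \<notin> keys F" using HF(2) unfolding mideal_def by blast
  then have "lookup (mon c * (s ^ (D * q) * P ^ q)) (c + smul q a0) = int p * lookup H (c + smul q a0)"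
    unfolding HF(1) by (simp add: lookup_add lookup_of_nat_mult in_keys_iff)
  then have dvd1: "int p dvd lookup (s ^ (D * q) * P ^ q) (smul q a0)"
    by (simp add: lookup_mon_mult)
  define S where "S = s ^ (D * q)"
  obtain H' where "P ^ q = of_nat p * H' + (\<Sum>a\<in>keys P. single a (lookup P a) ^ q)"
    using prime_dvd_power_sum[OF p(1) finite_keys, of "\<lambda>a. single a (lookup P a)" P "mdeg c"]
    unfolding mpoly_eq_sum_single[symmetric] by (auto simp: q_def dvd_def algebra_simps)
  then have "S * P ^ q = of_nat p * (S * H') + (\<Sum>a\<in>keys P. single (smul q a) (lookup P a ^ q) * S)"
    by (simp add: single_power distrib_left sum_distrib_left mult_ac)
  then have "lookup (S * P ^ q) (smul q a0) = int p * lookup (S * H') (smul q a0)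
      + (\<Sum>a\<in>keys P. lookup (single (smul q a) (lookup P a ^ q) * S) (smul q a0))"
    by (simp add: lookup_add lookup_sum lookup_of_nat_mult)
  then have dvd2: "int p dvd (\<Sum>a\<in>keys P. lookup (single (smul q a) (lookup P a ^ q) * S) (smul q a0))"
    using dvd1 by (simp add: S_def dvd_add_right_iff)
  \<comment> \<open>A contributing exponent a satisfies q * a + k = q * a0, so a is at most a0 in
    each coordinate and stays outside \<open>big b\<close>. Minimality of a0 keeps it out of
    \<open>A\<close>, which leaves only that its coefficient vanishes modulo p.\<close>
  have other: "int p dvd lookup (single (smul q a) (lookup P a ^ q) * S) (smul q a0)"
    if aP: "a \<in> keys P" "a \<noteq> a0" for a
  proof (cases "smul q a0 \<in> keys (single (smul q a) (lookup P a ^ q) * S)")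
    case True
    then obtain k where k: "smul q a0 = smul q a + k"
      using keys_mult_subset[of "single (smul q a) (lookup P a ^ q)" S] by (auto split: if_splits)
    have "a \<notin> big b"
    proof
      assume "a \<in> big b"
      then obtain l where "b l \<le> lookup a l" by (auto simp: big_def)
      moreover have "q * lookup a0 l = q * lookup a l + lookup k l"
        using k by (metis lookup_add lookup_smul)
      then have "q * lookup a l \<le> q * lookup a0 l" by simp
      then have "lookup a l \<le> lookup a0 l" using q by simp
      ultimately show False using a0b[of l] by simp
    qed
    moreover have "a \<notin> A"
    proof
      assume "a \<in> A"
      then have "mdeg a0 \<le> mdeg a" by (rule a0(2))
      moreover have "q * mdeg a0 = q * mdeg a + mdeg k"
        using arg_cong[OF k, of mdeg] by (simp add: mdeg_add mdeg_smul)
      ultimately have "mdeg k = 0" using mult_le_mono2[of "mdeg a0" "mdeg a" q] by linarith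
      then have "smul q a0 = smul q a" using k by simp
      then have "q * lookup a0 l = q * lookup a l" for l by (metis lookup_smul)
      then have "a0 = a" using q by (intro poly_mapping_eqI) simp
      with aP(2) show False by simp
    qed
    ultimately have "int p dvd lookup P a" using aP(1) by (auto simp: A_def)
    then have "int p dvd lookup P a ^ q" using q by (intro dvd_trans[OF _ dvd_power]) auto
    moreover have "lookup (single (smul q a) (lookup P a ^ q) * S) (smul q a0) = lookup P a ^ q * lookup S k"
      unfolding k by (rule lookup_single_mult)
    ultimately show ?thesis by simp
  qed (simp add: in_keys_iff)
  have a0P: "a0 \<in> keys P" using a0(1) by (simp add: A_def)
  have "int p dvd (\<Sum>a\<in>keys P - {a0}. lookup (single (smul q a) (lookup P a ^ q) * S) (smul q a0))"
    by (rule dvd_sum) (use other in auto)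
  with dvd2 have "int p dvd lookup (single (smul q a0) (lookup P a0 ^ q) * S) (smul q a0)"
    unfolding sum.remove[OF finite_keys a0P] by (simp add: dvd_add_left_iff)
  then have "int p dvd lookup P a0 ^ q * lookup S 0"
    using lookup_single_mult[of "smul q a0" "lookup P a0 ^ q" S 0] by simp
  then have "int p dvd lookup P a0 ^ q \<or> int p dvd lookup s 0 ^ (D * q)"
    using ip by (simp add: S_def rhom.power[OF rhom_lookup_0] prime_dvd_mult_iff)
  then have "int p dvd lookup P a0"
    using prime_dvd_power[OF ip] ps by blast
  then show False using a0(1) by (simp add: A_def)
qed

section \<open>Powers of a monomial ideal\<close>

text \<open>The exponents of the r-th power of the ideal generated by \<open>F\<close>. Starting
  from \<open>UNIV\<close> makes each stage up-closed although \<open>F\<close> is a mere set of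
  generators.\<close>

primrec pexp :: "('x \<Rightarrow>\<^sub>0 nat) set \<Rightarrow> nat \<Rightarrow> ('x \<Rightarrow>\<^sub>0 nat) set" where
  "pexp F 0 = UNIV"
| "pexp F (Suc r) = {a + b | a b. a \<in> F \<and> b \<in> pexp F r}"

text \<open>For up-closed \<open>E\<close> these are the exponents of the maximal ideal at the
  origin times the ideal of \<open>E\<close>; by Nakayama \<open>E - nonmin E\<close> then lists the
  minimal generators.\<close>

definition nonmin :: "('x \<Rightarrow>\<^sub>0 nat) set \<Rightarrow> ('x \<Rightarrow>\<^sub>0 nat) set"
  where "nonmin E = {a + c | a c. a \<in> E \<and> c \<noteq> 0}"

lemma up_closed_pexp: "up_closed (pexp F r)"
proof (induction r)
  case (Suc r)
  show ?case
    unfolding up_closed_def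
  proof (intro ballI allI)
    fix a c assume "a \<in> pexp F (Suc r)"
    then obtain u v where "a = u + v" "u \<in> F" "v \<in> pexp F r" by auto
    then have "a + c = u + (v + c)" "u \<in> F" "v + c \<in> pexp F r"
      using Suc by (auto simp: add.assoc up_closed_def)
    then show "a + c \<in> pexp F (Suc r)" by auto
  qed
qed (simp add: up_closed_def)

lemma up_closed_nonmin: "up_closed E \<Longrightarrow> up_closed (nonmin E)" for E :: "('x \<Rightarrow>\<^sub>0 nat) set"
  unfolding up_closed_def nonmin_def
proof clarify
  fix a c d :: "'x \<Rightarrow>\<^sub>0 nat" assume "\<forall>a\<in>E. \<forall>c. a + c \<in> E" "a \<in> E" "c \<noteq> 0"
  then have "a + d \<in> E" "a + c + d = (a + d) + c" "c \<noteq> 0" by (auto simp: add_ac)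
  then show "\<exists>a' c'. a + c + d = a' + c' \<and> a' \<in> E \<and> c' \<noteq> 0" by blast
qed

lemma pexp_add: "a \<in> pexp F r \<Longrightarrow> b \<in> pexp F s \<Longrightarrow> a + b \<in> pexp F (r + s)"
proof (induction r arbitrary: a)
  case 0
  then show ?case using up_closedD[OF up_closed_pexp] by auto
next
  case (Suc r)
  then obtain u v where "a = u + v" "u \<in> F" "v \<in> pexp F r" by auto
  then have "a + b = u + (v + b)" "u \<in> F" "v + b \<in> pexp F (r + s)"
    using Suc by (auto simp: add.assoc)
  then show ?case by auto
qed

lemma pexp_split: "c \<in> pexp F (r + s) \<Longrightarrow> \<exists>a b. c = a + b \<and> a \<in> pexp F r \<and> b \<in> pexp F s"
proof (induction r arbitrary: c)
  case 0
  then show ?case by (intro exI[of _ 0] exI[of _ c]) auto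
next
  case (Suc r)
  then obtain u v where uv: "c = u + v" "u \<in> F" "v \<in> pexp F (r + s)" by auto
  then obtain a b where ab: "v = a + b" "a \<in> pexp F r" "b \<in> pexp F s"
    using Suc.IH by blast
  have "c = (u + a) + b" using uv ab by (simp add: add.assoc)
  moreover have "u + a \<in> pexp F (Suc r)" using uv ab by auto
  ultimately show ?case using ab(3) by blast
qed

lemma pexp_antimono: "r \<le> s \<Longrightarrow> pexp F s \<subseteq> pexp F r"
proof
  fix c assume "r \<le> s" "c \<in> pexp F s"
  then obtain a b where "c = a + b" "a \<in> pexp F r"
    using pexp_split[of c F r "s - r"] by auto
  then show "c \<in> pexp F r" using up_closed_pexp[of F r] by (simp add: up_closed_def)
qed

lemma pexp_single:
  assumes "single i k \<in> pexp F 1"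
  shows "single i (s * k) \<in> pexp F s"
proof (induction s)
  case (Suc s)
  have "single i (Suc s * k) = single i k + single i (s * k)" by (simp add: single_add)
  then show ?case using pexp_add[OF assms Suc] by simp
qed simp

lemma is_ideal_pexp: "is_ideal (mideal (pexp F r))"
  by (rule is_ideal_mideal[OF up_closed_pexp])

lemma pexp_mult: "p \<in> mideal (pexp F r) \<Longrightarrow> q \<in> mideal (pexp F s) \<Longrightarrow> p * q \<in> mideal (pexp F (r + s))"
  by (rule mideal_mult_in) (auto intro: pexp_add)

lemma pexp_power: "p \<in> mideal (pexp F r) \<Longrightarrow> p ^ k \<in> mideal (pexp F (k * r))"
proof (induction k)
  case (Suc k)
  then show ?case using pexp_mult[of p F r "p ^ k" "k * r"] by simp
qed (simp add: mideal_def)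

lemma pexp_prod_power:
  assumes "\<And>x. x \<in> A \<Longrightarrow> f x \<in> mideal (pexp F 1)"
  shows "(\<Prod>x\<in>A. f x ^ k x) \<in> mideal (pexp F (\<Sum>x\<in>A. k x))"
  using assms
proof (induction A rule: infinite_finite_induct)
  case (insert x A)
  then show ?case
    using pexp_mult[OF pexp_power[of "f x" F 1 "k x"], of "\<Prod>x\<in>A. f x ^ k x" "\<Sum>x\<in>A. k x"] by simp
qed (auto simp: mideal_def)

lemma ideal_mult_mideal:
  assumes E: "up_closed E" and E': "up_closed E'"
  shows "ideal_mult (mideal E) (mideal E') = (mideal {a + b | a b. a \<in> E \<and> b \<in> E'} :: ('x, 'c::comm_ring_1) mpoly set)"
    (is "_ = mideal ?S")
proof (rule antisym)
  have S: "up_closed ?S"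
    unfolding up_closed_def
  proof clarify
    fix a b c :: "'x \<Rightarrow>\<^sub>0 nat" assume "a \<in> E" "b \<in> E'"
    then have "a + b + c = a + (b + c)" "a \<in> E" "b + c \<in> E'"
      using E' by (auto simp: up_closed_def add.assoc)
    then show "\<exists>u v. a + b + c = u + v \<and> u \<in> E \<and> v \<in> E'" by blast
  qed
  show "ideal_mult (mideal E) (mideal E') \<subseteq> (mideal ?S :: ('x, 'c) mpoly set)"
    unfolding ideal_mult_def
    by (intro ring_module.span_minimal is_ideal_mideal S) (auto intro!: mideal_mult_in)
  show "(mideal ?S :: ('x, 'c) mpoly set) \<subseteq> ideal_mult (mideal E) (mideal E')"
    unfolding ideal_mult_def
  proof (rule mideal_subset_ideal)
    fix c assume "c \<in> ?S"
    then obtain a b where "c = a + b" "a \<in> E" "b \<in> E'" by blast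
    then have "(mon c :: ('x, 'c) mpoly) = mon a * mon b" "(mon a :: ('x, 'c) mpoly) \<in> mideal E"
      "(mon b :: ('x, 'c) mpoly) \<in> mideal E'" by (simp_all add: mon_add)
    then have "(mon c :: ('x, 'c) mpoly) \<in> {a * b | a b. a \<in> mideal E \<and> b \<in> mideal E'}"
      by blast
    then show "(mon c :: ('x, 'c) mpoly) \<in> ideal_gen {a * b | a b. a \<in> mideal E \<and> b \<in> mideal E'}"
      by (rule ring_module.span_base)
  qed auto
qed

lemma ideal_power_mideal:
  "ideal_power (mideal (pexp F 1)) r = (mideal (pexp F r) :: ('x, 'c::comm_ring_1) mpoly set)"
proof (induction r)
  case (Suc r)
  have "{a + b | a b. a \<in> pexp F 1 \<and> b \<in> pexp F r} = pexp F (Suc r)"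
  proof (intro equalityI subsetI)
    fix c assume "c \<in> {a + b | a b. a \<in> pexp F 1 \<and> b \<in> pexp F r}"
    then obtain a b where "c = a + b" "a \<in> pexp F 1" "b \<in> pexp F r" by blast
    then show "c \<in> pexp F (Suc r)" using pexp_add[of a F 1 b r] by simp
  next
    fix c assume "c \<in> pexp F (Suc r)"
    then show "c \<in> {a + b | a b. a \<in> pexp F 1 \<and> b \<in> pexp F r}"
      using pexp_split[of c F 1 r] by (simp del: pexp.simps)
  qed
  with Suc show ?case
    by (simp only: ideal_power.simps ideal_mult_mideal[OF up_closed_pexp up_closed_pexp])
qed (simp add: mideal_def)

lemma ideal_gen_mon_pexp: "ideal_gen (mon ` F) = mideal (pexp F 1)"
  by (simp add: ideal_gen_mon)

lemma ex_minimal_exponent: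
  fixes a :: "'n::finite \<Rightarrow>\<^sub>0 nat"
  assumes "a \<in> E"
  shows "\<exists>e c. a = e + c \<and> e \<in> E - nonmin E"
  using assms
proof (induction "mdeg a" arbitrary: a rule: less_induct)
  case less
  show ?case
  proof (cases "a \<in> nonmin E")
    case True
    then obtain a' c where a': "a = a' + c" "a' \<in> E" "c \<noteq> 0" by (auto simp: nonmin_def)
    then have "mdeg a' < mdeg a" using mdeg_eq_0_iff[of c] by (simp add: mdeg_add del: mdeg_eq_0_iff)
    then obtain e d where "a' = e + d" "e \<in> E - nonmin E" using less.hyps a'(2) by blast
    then show ?thesis using a'(1) by (auto simp: add.assoc)
  next
    case False
    then show ?thesis using less.prems by (intro exI[of _ a] exI[of _ 0]) auto
  qed
qed

lemma minimal_exponent_bound: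
  assumes "single i k \<in> E" "a \<in> E - nonmin E"
  shows "lookup a i \<le> k"
proof (rule ccontr)
  assume "\<not> lookup a i \<le> k"
  then have k: "k < lookup a i" by simp
  from exp_diff_add[OF less_imp_le[OF this]] obtain c where c: "a = single i k + c" ..
  then have "c \<noteq> 0" using k by (auto simp: lookup_add)
  then have "a \<in> nonmin E" using c assms(1) by (auto simp: nonmin_def)
  with assms(2) show False by blast
qed

text \<open>The minimal exponents form an antichain, so one coordinate is determined by the others.\<close>

lemma card_minimal_exponents:
  fixes E :: "('n::finite \<Rightarrow>\<^sub>0 nat) set"
  assumes k: "\<And>i. single i (k i) \<in> E" "\<And>i. k i \<le> K"
  shows "finite (E - nonmin E)" "card (E - nonmin E) \<le> (K + 1) ^ (CARD('n) - 1)"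
proof -
  fix i0 :: 'n
  define R where "R a = restrict (lookup a) (UNIV - {i0})" for a :: "'n \<Rightarrow>\<^sub>0 nat"
  let ?P = "Pi\<^sub>E (UNIV - {i0}) (\<lambda>_. {..K})"
  have inj: "inj_on R (E - nonmin E)"
  proof -
    have le: "a = a'" if a: "a \<in> E - nonmin E" "a' \<in> E - nonmin E" "R a = R a'"
      "lookup a i0 \<le> lookup a' i0" for a a'
    proof -
      have eq: "lookup a i = lookup a' i" if "i \<noteq> i0" for i
        using fun_cong[OF a(3), of i] that by (simp add: R_def)
      have "a' = a + single i0 (lookup a' i0 - lookup a i0)"
        by (rule poly_mapping_eqI) (use eq a(4) in \<open>auto simp: lookup_add lookup_single when_def\<close>)
      moreover have "a' \<notin> nonmin E" using a(2) by blast
      ultimately have "single i0 (lookup a' i0 - lookup a i0) = 0"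
        using a(1) unfolding nonmin_def by blast
      with \<open>a' = a + _\<close> show ?thesis by simp
    qed
    show ?thesis
    proof (rule inj_onI)
      fix a a' assume "a \<in> E - nonmin E" "a' \<in> E - nonmin E" "R a = R a'"
      then show "a = a'"
        using le[of a a'] le[of a' a] by (cases "lookup a i0 \<le> lookup a' i0") auto
    qed
  qed
  have "lookup a i \<le> K" if "a \<in> E - nonmin E" for a i
    using minimal_exponent_bound[OF k(1) that] k(2) by (rule le_trans)
  then have sub: "R ` (E - nonmin E) \<subseteq> ?P"
    by (auto simp: R_def PiE_def split: if_splits)
  have fin: "finite ?P" by (auto intro: finite_PiE)
  show "finite (E - nonmin E)"
    using inj sub fin by (meson finite_imageD finite_subset)
  have "card (E - nonmin E) \<le> card ?P"
    using inj sub fin by (rule card_inj_on_le)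
  also have "card ?P = (K + 1) ^ (CARD('n) - 1)"
    by (simp add: card_PiE card_Diff_singleton)
  finally show "card (E - nonmin E) \<le> (K + 1) ^ (CARD('n) - 1)" .
qed

lemma finite_minimal_pexp:
  fixes F :: "('n::finite \<Rightarrow>\<^sub>0 nat) set"
  assumes pow: "\<And>i. single i (n i) \<in> pexp F 1"
  shows "finite (pexp F r - nonmin (pexp F r))"
  by (rule card_minimal_exponents[of "\<lambda>i. r * n i" _ "\<Sum>i\<in>UNIV. r * n i"])
    (rule pexp_single[OF pow], rule member_le_sum, auto)

section \<open>Reductions generated by few elements\<close>

lemma linear_system_nontrivial:
  fixes A :: "'e \<Rightarrow> 'u \<Rightarrow> 'k::field"
  assumes "finite E" "finite U" "card E < card U"
  shows "\<exists>C. (\<exists>u\<in>U. C u \<noteq> 0) \<and> (\<forall>e\<in>E. (\<Sum>u\<in>U. C u * A e u) = 0)"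
  using assms
proof (induction E arbitrary: A U rule: finite_induct)
  case empty
  then obtain u where "u \<in> U" by fastforce
  then show ?case by (intro exI[of _ "\<lambda>_. 1"]) auto
next
  case (insert e E)
  show ?case
  proof (cases "\<forall>u\<in>U. A e u = 0")
    case True
    obtain C where "\<exists>u\<in>U. C u \<noteq> 0" "\<forall>e\<in>E. (\<Sum>u\<in>U. C u * A e u) = 0"
      using insert.IH[of U A] insert.prems insert.hyps by auto
    with True show ?thesis by (intro exI[of _ C]) auto
  next
    case False
    then obtain u0 where u0: "u0 \<in> U" "A e u0 \<noteq> 0" by blast
    let ?V = "U - {u0}"
    \<comment> \<open>Gaussian elimination: equation e is solved for the unknown u0 and substituted
      into the others.\<close>
    define A' where "A' f u = A f u - A f u0 * A e u / A e u0" for f u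
    have "card E < card ?V" using insert u0 by simp
    then obtain C' where C': "\<exists>u\<in>?V. C' u \<noteq> 0" "\<And>f. f \<in> E \<Longrightarrow> (\<Sum>u\<in>?V. C' u * A' f u) = 0"
      using insert.IH[of ?V A'] insert.prems by auto
    define C where "C u = (if u = u0 then - (\<Sum>u\<in>?V. C' u * A e u) / A e u0 else C' u)" for u
    have sum: "(\<Sum>u\<in>U. C u * A f u) = - (\<Sum>u\<in>?V. C' u * A e u) / A e u0 * A f u0 + (\<Sum>u\<in>?V. C' u * A f u)" for f
      unfolding sum.remove[OF insert.prems(1) u0(1)] by (simp add: C_def)
    have "(\<Sum>u\<in>U. C u * A f u) = 0" if "f \<in> insert e E" for f
    proof (cases "f = e")
      case True
      then show ?thesis using u0(2) by (simp add: sum)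
    next
      case False
      then have "0 = (\<Sum>u\<in>?V. C' u * A' f u)" using that C'(2) by simp
      also have "\<dots> = (\<Sum>u\<in>?V. C' u * A f u) - (\<Sum>u\<in>?V. C' u * A e u) * (A f u0 / A e u0)"
        unfolding A'_def right_diff_distrib sum_subtractf sum_distrib_right
        by (simp add: mult_ac)
      finally show ?thesis by (simp add: sum)
    qed
    moreover have "\<exists>u\<in>U. C u \<noteq> 0" using C'(1) by (auto simp: C_def)
    ultimately show ?thesis by blast
  qed
qed

declare pexp.simps(2) [simp del]

text \<open>This is (G) I^r + m I^(r+1), with m the maximal ideal at the origin. The second summand
  makes \<open>red\<close> the condition that \<open>G\<close> generates a reduction after
  localisation at the origin, and only finitely many scalars enter modulo m.\<close>

definition redset :: "('x \<Rightarrow>\<^sub>0 nat) set \<Rightarrow> ('x, 'c::comm_ring_1) mpoly set \<Rightarrow> nat \<Rightarrow> ('x, 'c) mpoly set"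
  where "redset F G r = ideal_gen ({g * p | g p. g \<in> G \<and> p \<in> mideal (pexp F r)}
    \<union> mideal (nonmin (pexp F (Suc r))))"

definition red :: "('x \<Rightarrow>\<^sub>0 nat) set \<Rightarrow> ('x, 'c::comm_ring_1) mpoly set \<Rightarrow> nat \<Rightarrow> bool"
  where "red F G r \<longleftrightarrow> mideal (pexp F (Suc r)) \<subseteq> redset F G r"

lemma is_ideal_redset: "is_ideal (redset F G r)"
  unfolding redset_def by simp

lemma redset_gen: "g \<in> G \<Longrightarrow> p \<in> mideal (pexp F r) \<Longrightarrow> g * p \<in> redset F G r"
  unfolding redset_def by (rule ring_module.span_base) blast

lemma redset_nonmin: "p \<in> mideal (nonmin (pexp F (Suc r))) \<Longrightarrow> p \<in> redset F G r"
  unfolding redset_def by (rule ring_module.span_base) blast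

lemma redset_mult:
  assumes x: "x \<in> redset F G r" and p: "p \<in> mideal (pexp F k)"
  shows "p * x \<in> redset F G (r + k)"
proof -
  note R = is_ideal_redset[of F G "r + k"]
  have "is_ideal {x. p * x \<in> redset F G (r + k)}"
    by (auto simp: ring_module.subspace_def distrib_left ring_module.subspace_0[OF R]
        ring_module.subspace_add[OF R] mult.left_commute[of p] ring_module.subspace_scale[OF R])
  moreover have "p * (g * q) \<in> redset F G (r + k)" if "g \<in> G" "q \<in> mideal (pexp F r)" for g q
  proof -
    have "p * (g * q) = g * (q * p)" by (simp only: mult_ac)
    then show ?thesis using redset_gen[OF that(1) pexp_mult[OF that(2) p]] by (simp only:)
  qed
  moreover have "p * q \<in> redset F G (r + k)" if "q \<in> mideal (nonmin (pexp F (Suc r)))" for q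
  proof (rule redset_nonmin, rule mideal_mult_in[OF p that])
    fix a b assume a: "a \<in> pexp F k" and "b \<in> nonmin (pexp F (Suc r))"
    then obtain e c where e: "b = e + c" "e \<in> pexp F (Suc r)" "c \<noteq> 0" by (auto simp: nonmin_def)
    have "e + a \<in> pexp F (Suc (r + k))" using pexp_add[OF e(2) a] by simp
    moreover have "a + b = (e + a) + c" by (simp add: e(1) add_ac)
    ultimately show "a + b \<in> nonmin (pexp F (Suc (r + k)))" using e(3) unfolding nonmin_def by blast
  qed
  ultimately have "redset F G r \<subseteq> {x. p * x \<in> redset F G (r + k)}"
    unfolding redset_def[of F G r] by (intro ring_module.span_minimal) auto
  then show ?thesis using x by blast
qed

lemma red_shift:
  assumes "red F G r"
  shows "red F G (r + k)"
  unfolding red_def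
proof (rule mideal_subset_ideal[OF is_ideal_redset])
  fix a assume "a \<in> pexp F (Suc (r + k))"
  then obtain u v where uv: "a = u + v" "u \<in> pexp F (Suc r)" "v \<in> pexp F k"
    using pexp_split[of a F "Suc r" k] by auto
  then have "mon u \<in> redset F G r" using assms mon_in_mideal unfolding red_def by blast
  then have "mon v * mon u \<in> redset F G (r + k)" by (rule redset_mult) (simp add: uv(3))
  then show "mon a \<in> redset F G (r + k)" by (simp add: uv(1) mon_add mult.commute)
qed

text \<open>Telescoping, with orders counted: each step splits off one difference u x - v x, which
  belongs to \<open>G\<close>, and the remaining cofactor has order n. The prefactor
  \<open>q\<close> absorbs the factors already treated in the induction.\<close>

lemma redset_prod_diff:
  assumes uv: "\<And>x. x \<in> A \<Longrightarrow> u x \<in> mideal (pexp F 1)" "\<And>x. x \<in> A \<Longrightarrow> v x \<in> mideal (pexp F 1)"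
    "\<And>x. x \<in> A \<Longrightarrow> u x - v x \<in> G"
    and A: "finite A"
    and q: "q \<in> mideal (pexp F j)" "j + (\<Sum>x\<in>A. k x) = Suc n"
  shows "q * ((\<Prod>x\<in>A. u x ^ k x) - (\<Prod>x\<in>A. v x ^ k x)) \<in> redset F G n"
  using A uv q
proof (induction A arbitrary: q j)
  case empty
  then show ?case by (simp add: ring_module.subspace_0[OF is_ideal_redset])
next
  case (insert x A)
  define PA where "PA = (\<Prod>x\<in>A. u x ^ k x)"
  define PB where "PB = (\<Prod>x\<in>A. v x ^ k x)"
  have "q * u x ^ k x \<in> mideal (pexp F (j + k x))"
    using pexp_mult[OF insert.prems(4) pexp_power[OF insert.prems(1), of x "k x"]] by simp
  moreover have "(j + k x) + (\<Sum>x\<in>A. k x) = Suc n" using insert by simp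
  ultimately have 1: "(q * u x ^ k x) * (PA - PB) \<in> redset F G n"
    unfolding PA_def PB_def using insert by auto
  have 2: "(q * PB) * (u x ^ k x - v x ^ k x) \<in> redset F G n"
  proof (cases "k x")
    case 0
    then show ?thesis by (simp add: ring_module.subspace_0[OF is_ideal_redset])
  next
    case (Suc l)
    have "PB \<in> mideal (pexp F (\<Sum>x\<in>A. k x))"
      unfolding PB_def using insert.prems(2) by (intro pexp_prod_power) auto
    then have qPB: "q * PB \<in> mideal (pexp F (j + (\<Sum>x\<in>A. k x)))" by (rule pexp_mult[OF insert.prems(4)])
    have "(\<Sum>i<k x. v x ^ (k x - Suc i) * u x ^ i) \<in> mideal (pexp F l)"
    proof (rule mideal_sum)
      fix i assume "i \<in> {..<k x}"
      then have "(k x - Suc i) + i = l" using Suc by simp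
      then show "v x ^ (k x - Suc i) * u x ^ i \<in> mideal (pexp F l)"
        using pexp_mult[OF pexp_power[OF insert.prems(2), of x "k x - Suc i"]
            pexp_power[OF insert.prems(1), of x i]] by simp
    qed
    with qPB have "(q * PB) * (\<Sum>i<k x. v x ^ (k x - Suc i) * u x ^ i) \<in> mideal (pexp F (j + (\<Sum>x\<in>A. k x) + l))"
      by (rule pexp_mult)
    moreover have "j + (\<Sum>x\<in>A. k x) + l = n" using insert Suc by simp
    ultimately have "(u x - v x) * ((q * PB) * (\<Sum>i<k x. v x ^ (k x - Suc i) * u x ^ i)) \<in> redset F G n"
      using insert.prems(3) by (intro redset_gen) auto
    then show ?thesis by (simp only: power_diff_sumr2 mult_ac)
  qed
  have "q * ((\<Prod>x\<in>insert x A. u x ^ k x) - (\<Prod>x\<in>insert x A. v x ^ k x))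
      = (q * u x ^ k x) * (PA - PB) + (q * PB) * (u x ^ k x - v x ^ k x)"
    using insert.hyps by (simp add: PA_def PB_def algebra_simps)
  then show ?case
    using ring_module.subspace_add[OF is_ideal_redset 1 2] by simp
qed

text \<open>Noether normalization for the fiber ring of \<open>I\<close>: since \<open>I ^ s\<close> has at most
  \<open>O(s ^ (d - 1))\<close> minimal generators, any \<open>d + 1\<close> elements of \<open>I\<close> satisfy a homogeneous
  relation modulo \<open>\<mm> I ^ s\<close>, which a linear change makes monic in one of them.\<close>

lemma homogeneous_relation:
  fixes T :: "('n::finite, 'k::field) mpoly set"
  assumes pow: "\<And>i. single i (n i) \<in> pexp F 1"
    and T: "finite T" "card T = CARD('n)" "T \<subseteq> mideal (pexp F 1)" and t0: "t0 \<in> mideal (pexp F 1)"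
  shows "\<exists>U s C. finite U \<and> 0 < s \<and> (\<exists>u\<in>U. C u \<noteq> 0) \<and> (\<forall>u\<in>U. sum u T \<le> s) \<and> inj_on (\<lambda>u. restrict u T) U \<and>
    (\<Sum>u\<in>U. Const (C u) * ((\<Prod>g\<in>T. g ^ u g) * t0 ^ (s - sum u T))) \<in> mideal (nonmin (pexp F s))"
proof -
  define d where "d = CARD('n)"
  define N where "N = Suc (\<Sum>i\<in>UNIV. n i)"
  \<comment> \<open>Chosen for the count: s * N + 1 is at most d * N * (t + 1), whose power with
    exponent d - 1 is t * (t + 1) ^ (d - 1), less than the (t + 1) ^ d exponents in
    \<open>U\<close>. With s = d * t each of these can be completed to degree s by a power of
    t0.\<close>
  define t where "t = (d * N) ^ (d - 1)"
  define s where "s = d * t"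
  define U where "U = Pi\<^sub>E T (\<lambda>_. {..t})"
  define E where "E = pexp F s - nonmin (pexp F s)"
  have d: "d > 0" by (simp add: d_def)
  have N: "N > 0" by (simp add: N_def)
  have t: "t > 0" using d N by (simp add: t_def)
  have s0: "s > 0" using d t by (simp add: s_def)
  have nN: "n i \<le> N" for i
    unfolding N_def using member_le_sum[of i UNIV n] by simp
  have cardE: "finite E" "card E \<le> (s * N + 1) ^ (d - 1)"
    unfolding E_def d_def
    using card_minimal_exponents[of "\<lambda>i. s * n i" "pexp F s" "s * N"] pexp_single[OF pow] nN by auto
  have U: "finite U" "card U = (t + 1) ^ d"
    unfolding U_def using T by (auto simp: card_PiE d_def intro: finite_PiE)
  have "s * N + 1 \<le> d * N * (t + 1)"
    using d N by (simp add: s_def algebra_simps Suc_le_eq)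
  then have "(s * N + 1) ^ (d - 1) \<le> (d * N * (t + 1)) ^ (d - 1)" by (rule power_mono) simp
  also have "\<dots> = t * (t + 1) ^ (d - 1)" by (simp only: power_mult_distrib t_def)
  also have "\<dots> < (t + 1) * (t + 1) ^ (d - 1)" by simp
  also have "\<dots> = (t + 1) ^ d" using d by (simp flip: power_Suc)
  finally have card: "card E < card U" using cardE(2) U(2) by simp
  have sumU: "sum u T \<le> s" if "u \<in> U" for u
    using that sum_bounded_above[of T u t] T(2) by (auto simp: U_def s_def d_def)
  define W where "W u = (\<Prod>g\<in>T. g ^ u g) * t0 ^ (s - sum u T)" for u
  obtain C where C: "\<exists>u\<in>U. C u \<noteq> 0" "\<And>e. e \<in> E \<Longrightarrow> (\<Sum>u\<in>U. C u * lookup (W u) e) = 0"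
    using linear_system_nontrivial[OF cardE(1) U(1) card, of "\<lambda>e u. lookup (W u) e"] by blast
  have W: "W u \<in> mideal (pexp F s)" if "u \<in> U" for u
  proof -
    have "W u \<in> mideal (pexp F (sum u T + (s - sum u T) * 1))"
      unfolding W_def using T(3) by (intro pexp_mult pexp_power pexp_prod_power t0) auto
    then show ?thesis using sumU[OF that] by simp
  qed
  have "(\<Sum>u\<in>U. Const (C u) * W u) \<in> mideal (pexp F s)"
    by (intro mideal_sum mideal_Const_mult W)
  moreover have "lookup (\<Sum>u\<in>U. Const (C u) * W u) e = 0" if "e \<in> E" for e
    using C(2)[OF that] by (simp add: lookup_sum lookup_Const_mult)
  ultimately have "(\<Sum>u\<in>U. Const (C u) * W u) \<in> mideal (nonmin (pexp F s))"
    by (fastforce simp: mideal_def in_keys_iff E_def)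
  moreover have "inj_on (\<lambda>u. restrict u T) U"
    by (auto simp: inj_on_def U_def PiE_restrict)
  ultimately show ?thesis
    using U(1) s0 C(1) sumU unfolding W_def by (intro exI[of _ U] exI[of _ s] exI[of _ C]) blast
qed

text \<open>Injectivity on \<open>T\<close> makes the exponents distinct, so the coefficients cannot
  cancel and the sum is the value of a nonzero polynomial.\<close>

lemma ex_nonzero_value:
  fixes C :: "('g \<Rightarrow> nat) \<Rightarrow> 'k::field"
  assumes inf: "infinite (UNIV :: 'k set)" and T: "finite T" and U: "finite U" "inj_on (\<lambda>u. restrict u T) U"
    and C: "\<exists>u\<in>U. C u \<noteq> 0"
  shows "\<exists>c. (\<Sum>u\<in>U. C u * (\<Prod>g\<in>T. c g ^ u g)) \<noteq> 0"
proof -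
  define ex where "ex u = (\<Sum>g\<in>T. single g (u g))" for u :: "'g \<Rightarrow> nat"
  have lex: "lookup (ex u) g = (if g \<in> T then u g else 0)" for u g
    using T by (auto simp: ex_def lookup_sum lookup_single when_def)
  have inj: "inj_on ex U"
  proof (rule inj_onI)
    fix u v assume uv: "u \<in> U" "v \<in> U" "ex u = ex v"
    have "u g = v g" if "g \<in> T" for g using lex[of u g] lex[of v g] uv(3) that by simp
    then have "restrict u T = restrict v T" by (auto simp: restrict_def)
    then show "u = v" using U(2) uv by (auto simp: inj_on_def)
  qed
  define \<Phi> where "\<Phi> = (\<Sum>u\<in>U. single (ex u) (C u))"
  obtain u where u: "u \<in> U" "C u \<noteq> 0" using C by blast
  have "lookup \<Phi> (ex u) = (\<Sum>v\<in>U. if v = u then C v else 0)"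
    unfolding \<Phi>_def lookup_sum using inj u(1)
    by (intro sum.cong) (auto simp: lookup_single when_def inj_on_def)
  then have "\<Phi> \<noteq> 0" using u U(1) by auto
  then obtain c where c: "peval (\<lambda>x. x) c \<Phi> \<noteq> 0" using poly_fun_zero[OF inf] by blast
  have "monval c (ex u) = (\<Prod>g\<in>T. c g ^ u g)" for u
    by (subst monval_superset[OF T]) (auto simp: lex in_keys_iff split: if_splits)
  then have "peval (\<lambda>x. x) c \<Phi> = (\<Sum>u\<in>U. C u * (\<Prod>g\<in>T. c g ^ u g))"
    by (simp add: \<Phi>_def rhom.sum[OF rhom.rhom_peval[OF rhom_id]] rhom.peval_term[OF rhom_id])
  with c show ?thesis by auto
qed

lemma red_fewer_generators:
  fixes G :: "('n::finite, 'k::field) mpoly set"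
  assumes inf: "infinite (UNIV :: 'k set)"
    and pow: "\<And>i. single i (n i) \<in> pexp F 1"
    and V: "V \<subseteq> mideal (pexp F 1)" "\<And>p q. p \<in> V \<Longrightarrow> q \<in> V \<Longrightarrow> p - q \<in> V"
      "\<And>c p. p \<in> V \<Longrightarrow> Const c * p \<in> V"
    and G: "finite G" "G \<subseteq> V" "red F G r" "CARD('n) < card G"
  shows "\<exists>G' r'. finite G' \<and> G' \<subseteq> V \<and> red F G' r' \<and> card G' < card G"
proof -
  obtain T1 where T1: "T1 \<subseteq> G" "card T1 = Suc (CARD('n))" "finite T1"
    using obtain_subset_with_card_n[of "Suc (CARD('n))" G] G(4) by auto
  then obtain t0 where t0: "t0 \<in> T1" by fastforce
  define T where "T = T1 - {t0}"
  have T: "finite T" "card T = CARD('n)" "T \<subseteq> G" "t0 \<notin> T" "t0 \<in> G"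
    using T1 t0 by (auto simp: T_def)
  have t0I: "t0 \<in> mideal (pexp F 1)" and TI: "T \<subseteq> mideal (pexp F 1)"
    using T G(2) V(1) by auto
  obtain U s C where rel: "finite U" "0 < s" "\<exists>u\<in>U. C u \<noteq> 0" "\<forall>u\<in>U. sum u T \<le> s"
    "inj_on (\<lambda>u. restrict u T) U"
    "(\<Sum>u\<in>U. Const (C u) * ((\<Prod>g\<in>T. g ^ u g) * t0 ^ (s - sum u T))) \<in> mideal (nonmin (pexp F s))"
    using homogeneous_relation[OF pow T(1,2) TI t0I] by blast
  obtain c where c: "(\<Sum>u\<in>U. C u * (\<Prod>g\<in>T. c g ^ u g)) \<noteq> 0"
    using ex_nonzero_value[OF inf T(1) rel(1,5,3)] by blast
  define \<gamma> where "\<gamma> = (\<Sum>u\<in>U. C u * (\<Prod>g\<in>T. c g ^ u g))"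
  obtain s' where s': "s = Suc s'" using rel(2) by (cases s) auto
  define f where "f g = g - Const (c g) * t0" for g
  define G1 where "G1 = (G - insert t0 T) \<union> f ` T"
  have "f g \<in> V" if "g \<in> T" for g
    unfolding f_def using that G(2) T(3,5) by (intro V(2) V(3)) auto
  then have "G1 \<subseteq> V" unfolding G1_def using G(2) by auto
  have fin: "finite G1" using G(1) T(1) by (simp add: G1_def)
  have "card G1 \<le> card (G - insert t0 T) + card T"
    unfolding G1_def by (rule order_trans[OF card_Un_le]) (simp add: card_image_le T(1))
  also have "card (G - insert t0 T) = card G - Suc (card T)"
    using T G(1) by (subst card_Diff_subset) auto
  finally have card: "card G1 < card G" using G(4) T(2) by simp
  have t0s: "t0 ^ s \<in> redset F G1 s'"
  proof -
    note R = is_ideal_redset[of F G1 s']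
    have "Const (C u) * (t0 ^ (s - sum u T) * ((\<Prod>g\<in>T. g ^ u g) - (\<Prod>g\<in>T. (Const (c g) * t0) ^ u g))) \<in> redset F G1 s'"
      if "u \<in> U" for u
    proof (rule ring_module.subspace_scale[OF R], rule redset_prod_diff[where j = "s - sum u T"])
      show "t0 ^ (s - sum u T) \<in> mideal (pexp F (s - sum u T))"
        using pexp_power[OF t0I, of "s - sum u T"] by simp
      show "s - sum u T + sum u T = Suc s'" using rel(4) that s' by simp
      show "g - Const (c g) * t0 \<in> G1" if "g \<in> T" for g
        using that by (auto simp: G1_def f_def)
    qed (use TI T(1) in \<open>auto simp del: One_nat_def intro: mideal_Const_mult t0I\<close>)
    then have "(\<Sum>u\<in>U. Const (C u) * (t0 ^ (s - sum u T) * ((\<Prod>g\<in>T. g ^ u g) - (\<Prod>g\<in>T. (Const (c g) * t0) ^ u g)))) \<in> redset F G1 s'"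
      by (rule ring_module.subspace_sum[OF R])
    moreover have "(\<Sum>u\<in>U. Const (C u) * ((\<Prod>g\<in>T. g ^ u g) * t0 ^ (s - sum u T))) \<in> redset F G1 s'"
      using rel(6) unfolding s' by (rule redset_nonmin)
    ultimately have "(\<Sum>u\<in>U. Const (C u) * ((\<Prod>g\<in>T. g ^ u g) * t0 ^ (s - sum u T)))
       - (\<Sum>u\<in>U. Const (C u) * (t0 ^ (s - sum u T) * ((\<Prod>g\<in>T. g ^ u g) - (\<Prod>g\<in>T. (Const (c g) * t0) ^ u g)))) \<in> redset F G1 s'"
      by (intro ring_module.subspace_diff[OF R])
    also have "(\<Sum>u\<in>U. Const (C u) * ((\<Prod>g\<in>T. g ^ u g) * t0 ^ (s - sum u T)))
       - (\<Sum>u\<in>U. Const (C u) * (t0 ^ (s - sum u T) * ((\<Prod>g\<in>T. g ^ u g) - (\<Prod>g\<in>T. (Const (c g) * t0) ^ u g))))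
       = (\<Sum>u\<in>U. Const (C u) * (t0 ^ (s - sum u T) * (\<Prod>g\<in>T. (Const (c g) * t0) ^ u g)))"
      unfolding sum_subtractf[symmetric] by (rule sum.cong) (simp_all add: algebra_simps)
    also have "\<dots> = (\<Sum>u\<in>U. Const (C u * (\<Prod>g\<in>T. c g ^ u g)) * t0 ^ s)"
    proof (rule sum.cong[OF refl])
      fix u assume "u \<in> U"
      then have "t0 ^ s = t0 ^ (s - sum u T) * t0 ^ sum u T"
        using rel(4) by (simp flip: power_add)
      then show "Const (C u) * (t0 ^ (s - sum u T) * (\<Prod>g\<in>T. (Const (c g) * t0) ^ u g))
          = Const (C u * (\<Prod>g\<in>T. c g ^ u g)) * t0 ^ s"
        by (simp add: power_mult_distrib prod.distrib rhom.mult[OF rhom_Const] rhom.prod[OF rhom_Const]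
            rhom.power[OF rhom_Const] power_sum mult_ac)
    qed
    also have "\<dots> = Const \<gamma> * t0 ^ s"
      by (simp add: \<gamma>_def rhom.sum[OF rhom_Const] sum_distrib_right)
    finally have "Const (inverse \<gamma>) * (Const \<gamma> * t0 ^ s) \<in> redset F G1 s'"
      by (rule ring_module.subspace_scale[OF R])
    moreover have "Const (inverse \<gamma>) * (Const \<gamma> * t0 ^ s) = t0 ^ s"
      using c by (simp add: \<gamma>_def mult.assoc[symmetric] rhom.mult[OF rhom_Const, symmetric])
    ultimately show ?thesis by simp
  qed
  have base: "\<exists>p\<in>mideal (pexp F k). x - t0 * p \<in> redset F G1 k"
    if k: "red F G k" and x: "x \<in> mideal (pexp F (Suc k))" for x k
  proof -
    note R = is_ideal_redset[of F G1 k]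
    note P = is_ideal_pexp[of F k]
    let ?S = "{x. \<exists>p\<in>mideal (pexp F k). x - t0 * p \<in> redset F G1 k}"
    have "is_ideal ?S"
    proof (rule ring_module.subspaceI)
      show "0 \<in> ?S"
        using ring_module.subspace_0[OF P] ring_module.subspace_0[OF R] by (auto intro!: bexI[of _ 0])
    next
      fix x y assume "x \<in> ?S" "y \<in> ?S"
      then obtain p q where pq: "p \<in> mideal (pexp F k)" "q \<in> mideal (pexp F k)"
        "x - t0 * p \<in> redset F G1 k" "y - t0 * q \<in> redset F G1 k" by blast
      have "x + y - t0 * (p + q) = (x - t0 * p) + (y - t0 * q)" by (simp add: algebra_simps)
      then have "x + y - t0 * (p + q) \<in> redset F G1 k"
        using ring_module.subspace_add[OF R pq(3,4)] by (simp only:)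
      then show "x + y \<in> ?S"
        using ring_module.subspace_add[OF P pq(1,2)] by blast
    next
      fix a x assume "x \<in> ?S"
      then obtain p where p: "p \<in> mideal (pexp F k)" "x - t0 * p \<in> redset F G1 k" by blast
      have "a * x - t0 * (a * p) = a * (x - t0 * p)" by (simp add: algebra_simps)
      then have "a * x - t0 * (a * p) \<in> redset F G1 k"
        using ring_module.subspace_scale[OF R p(2)] by (simp only:)
      then show "a * x \<in> ?S"
        using ring_module.subspace_scale[OF P p(1)] by blast
    qed
    moreover have "g * p \<in> ?S" if g: "g \<in> G" and p: "p \<in> mideal (pexp F k)" for g p
    proof -
      consider "g = t0" | "g \<in> T" | "g \<in> G - insert t0 T" using g by blast
      then show ?thesis
      proof cases
        case 1
        then show ?thesis using p ring_module.subspace_0[OF R] by (auto intro!: bexI[of _ p])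
      next
        case 2
        then have "f g * p \<in> redset F G1 k" by (intro redset_gen p) (simp add: G1_def)
        moreover have "f g * p = g * p - t0 * (Const (c g) * p)" by (simp add: f_def algebra_simps)
        ultimately have "g * p - t0 * (Const (c g) * p) \<in> redset F G1 k" by (simp only:)
        then show ?thesis using mideal_Const_mult[OF p] by blast
      next
        case 3
        then have "g * p \<in> redset F G1 k" by (intro redset_gen p) (simp add: G1_def)
        then show ?thesis using ring_module.subspace_0[OF P] by (auto intro!: bexI[of _ 0])
      qed
    qed
    moreover have "q \<in> ?S" if "q \<in> mideal (nonmin (pexp F (Suc k)))" for q
      using redset_nonmin[OF that] ring_module.subspace_0[OF P] by (auto intro!: bexI[of _ 0])
    ultimately have "redset F G k \<subseteq> ?S"
      unfolding redset_def[of F G k] by (intro ring_module.span_minimal) blast+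
    then show ?thesis using x k unfolding red_def by blast
  qed
  \<comment> \<open>Each stage pulls out one more factor t0. At k = s' the power is t0 ^ s, which
    \<open>t0s\<close> absorbs.\<close>
  have iter: "\<exists>p\<in>mideal (pexp F r). x - t0 ^ Suc k * p \<in> redset F G1 (r + k)"
    if "x \<in> mideal (pexp F (Suc (r + k)))" for x k
    using that
  proof (induction k arbitrary: x)
    case 0
    then show ?case using base[OF G(3), of x] by simp
  next
    case (Suc k)
    have "\<exists>p\<in>mideal (pexp F (Suc (r + k))). x - t0 * p \<in> redset F G1 (Suc (r + k))"
      by (rule base) (use Suc.prems red_shift[OF G(3), of "Suc k"] in \<open>simp_all\<close>)
    then obtain p where p: "p \<in> mideal (pexp F (Suc (r + k)))" "x - t0 * p \<in> redset F G1 (Suc (r + k))" by blast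
    obtain p' where p': "p' \<in> mideal (pexp F r)" "p - t0 ^ Suc k * p' \<in> redset F G1 (r + k)"
      using Suc.IH[OF p(1)] by blast
    have "t0 * (p - t0 ^ Suc k * p') \<in> redset F G1 (Suc (r + k))"
      using redset_mult[OF p'(2) t0I] by simp
    with p(2) have "(x - t0 * p) + t0 * (p - t0 ^ Suc k * p') \<in> redset F G1 (Suc (r + k))"
      by (rule ring_module.subspace_add[OF is_ideal_redset])
    moreover have "(x - t0 * p) + t0 * (p - t0 ^ Suc k * p') = x - t0 ^ Suc (Suc k) * p'"
      by (simp add: algebra_simps)
    ultimately have "x - t0 ^ Suc (Suc k) * p' \<in> redset F G1 (Suc (r + k))" by (simp only:)
    then show ?case using p'(1) by (simp only: add_Suc_right) blast
  qed
  have "red F G1 (r + s')"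
    unfolding red_def
  proof
    fix x :: "('n, 'k) mpoly" assume "x \<in> mideal (pexp F (Suc (r + s')))"
    then obtain p where p: "p \<in> mideal (pexp F r)" "x - t0 ^ s * p \<in> redset F G1 (r + s')"
      using iter[of x s'] unfolding s' by blast
    have "t0 ^ s * p \<in> redset F G1 (r + s')"
      using redset_mult[OF t0s p(1)] by (simp add: mult.commute add.commute)
    with p(2) have "(x - t0 ^ s * p) + t0 ^ s * p \<in> redset F G1 (r + s')"
      by (rule ring_module.subspace_add[OF is_ideal_redset])
    then show "x \<in> redset F G1 (r + s')" by simp
  qed
  then show ?thesis using fin card \<open>G1 \<subseteq> V\<close> by blast
qed

lemma ex_small_reduction:
  fixes G :: "('n::finite, 'k::field) mpoly set"
  assumes inf: "infinite (UNIV :: 'k set)"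
    and pow: "\<And>i. single i (n i) \<in> pexp F 1"
    and V: "V \<subseteq> mideal (pexp F 1)" "\<And>p q. p \<in> V \<Longrightarrow> q \<in> V \<Longrightarrow> p - q \<in> V"
      "\<And>c p. p \<in> V \<Longrightarrow> Const c * p \<in> V"
    and G: "finite G" "G \<subseteq> V" "red F G r" "G \<noteq> {}"
  shows "\<exists>g :: 'n \<Rightarrow> ('n, 'k) mpoly. \<exists>r. range g \<subseteq> V \<and> red F (range g) r"
proof -
  have "\<exists>G r. finite G \<and> G \<subseteq> V \<and> red F G r \<and> card G \<le> CARD('n)"
    using G(1-3)
  proof (induction "card G" arbitrary: G r rule: less_induct)
    case less
    show ?case
    proof (cases "card G \<le> CARD('n)")
      case False
      then obtain G' r' where "finite G'" "G' \<subseteq> V" "red F G' r'" "card G' < card G"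
        using red_fewer_generators[OF inf pow V less.prems] by auto
      then show ?thesis using less.hyps by blast
    qed (use less.prems in blast)
  qed
  then obtain G' r' where G': "finite G'" "G' \<subseteq> V" "red F G' r'" "card G' \<le> CARD('n)" by blast
  have z: "0 \<in> V" using G(2,4) V(2) by (metis cancel_comm_monoid_add_class.diff_cancel ex_in_conv subsetD)
  obtain g0 where g0: "inj_on g0 G'" "g0 ` G' \<subseteq> (UNIV :: 'n set)"
    using card_le_inj[OF G'(1) finite G'(4)] by blast
  \<comment> \<open>Padding with 0 gives a family indexed by the variables, so that the transition
    matrices below are square.\<close>
  define g where "g i = (if i \<in> g0 ` G' then inv_into G' g0 i else 0)" for i
  have "range g \<subseteq> V"
    using G'(2) z by (auto simp: g_def inv_into_into)
  moreover have "G' \<subseteq> range g"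
  proof
    fix x assume "x \<in> G'"
    then have "g (g0 x) = x" using g0(1) by (simp add: g_def)
    then show "x \<in> range g" by (metis rangeI)
  qed
  then have "redset F G' r' \<subseteq> redset F (range g) r'"
    unfolding redset_def by (intro ring_module.span_mono) blast
  then have "red F (range g) r'" using G'(3) unfolding red_def by blast
  ultimately show ?thesis by blast
qed

section \<open>The generic reduction over the integers\<close>

text \<open>Generators are eliminated one at a time. Instead of being inverted, each 1 - D e e is
  multiplied into s, so no localised ring has to be formed.\<close>

lemma nakayama_localized:
  fixes el :: "'e \<Rightarrow> 'a::comm_ring_1"
  assumes N: "is_ideal N" and n: "is_ideal n" and E: "finite E"
    and D: "\<And>e e'. e \<in> E \<Longrightarrow> e' \<in> E \<Longrightarrow> D e e' \<in> n"
    and el: "\<And>e. e \<in> E \<Longrightarrow> el e - (\<Sum>e'\<in>E. D e e' * el e') \<in> N"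
  shows "\<exists>s. 1 - s \<in> n \<and> (\<forall>e\<in>E. s * el e \<in> N)"
  using E D el
proof (induction E arbitrary: D rule: finite_induct)
  case empty
  show ?case using ring_module.subspace_0[OF n] by (intro exI[of _ 1]) simp
next
  case (insert e E)
  define u where "u = 1 - D e e"
  \<comment> \<open>The relation for f is multiplied by u, the relation for e is used to replace u *
    el e, and the last summand restores el f, because 1 - u = D e e.\<close>
  define D' where "D' f g = D f e * D e g + u * D f g + (if g = f then D e e else 0)" for f g
  have ue: "u * el e - (\<Sum>f\<in>E. D e f * el f) \<in> N"
    using insert.prems(2)[of e] insert.hyps by (simp add: u_def algebra_simps)
  have D': "D' f g \<in> n" if "f \<in> E" "g \<in> E" for f g
    unfolding D'_def using insert.prems(1) that
    by (intro ring_module.subspace_add[OF n] ring_module.subspace_scale[OF n])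
      (auto simp: ring_module.subspace_0[OF n])
  have el': "el f - (\<Sum>g\<in>E. D' f g * el g) \<in> N" if f: "f \<in> E" for f
  proof -
    have 1: "el f - (D f e * el e + (\<Sum>g\<in>E. D f g * el g)) \<in> N"
      using insert.prems(2)[of f] insert.hyps f by simp
    have "(\<Sum>g\<in>E. (if g = f then D e e else 0) * el g) = (\<Sum>g\<in>E. if g = f then D e e * el g else 0)"
      by (rule sum.cong) auto
    also have "\<dots> = D e e * el f" using f insert.hyps by simp
    finally have "(\<Sum>g\<in>E. D' f g * el g) = D f e * (\<Sum>g\<in>E. D e g * el g) + u * (\<Sum>g\<in>E. D f g * el g) + D e e * el f"
      by (simp add: D'_def distrib_right sum.distrib sum_distrib_left mult.assoc)
    then have "el f - (\<Sum>g\<in>E. D' f g * el g) = u * (el f - (D f e * el e + (\<Sum>g\<in>E. D f g * el g)))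
        + D f e * (u * el e - (\<Sum>g\<in>E. D e g * el g))"
      by (simp add: u_def algebra_simps)
    then show ?thesis
      using ring_module.subspace_add[OF N ring_module.subspace_scale[OF N 1]
          ring_module.subspace_scale[OF N ue]] by metis
  qed
  obtain s where s: "1 - s \<in> n" "\<And>f. f \<in> E \<Longrightarrow> s * el f \<in> N"
    using insert.IH[OF D' el'] by blast
  have "1 - s * u = (1 - s) + s * D e e" by (simp add: u_def algebra_simps)
  then have "1 - s * u \<in> n"
    using ring_module.subspace_add[OF n s(1) ring_module.subspace_scale[OF n insert.prems(1)]]
    by (simp only: insertI1)
  moreover have "(s * u) * el f \<in> N" if "f \<in> insert e E" for f
  proof (cases "f = e")
    case True
    have "(s * u) * el e = s * (u * el e - (\<Sum>f\<in>E. D e f * el f)) + (\<Sum>f\<in>E. D e f * (s * el f))"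
      by (simp add: algebra_simps sum_distrib_left)
    moreover have "(\<Sum>f\<in>E. D e f * (s * el f)) \<in> N"
      by (rule ring_module.subspace_sum[OF N], rule ring_module.subspace_scale[OF N], rule s(2))
    ultimately show ?thesis
      using True ring_module.subspace_add[OF N ring_module.subspace_scale[OF N ue]] by metis
  next
    case False
    then have "u * (s * el f) \<in> N" using that by (intro ring_module.subspace_scale[OF N] s(2)) simp
    then show ?thesis by (simp add: mult_ac)
  qed
  ultimately show ?case by blast
qed

text \<open>Indeterminates \<open>Inl (i, j)\<close> stand for the coefficients \<open>\<lambda> i j\<close>; the further indeterminates
  \<open>Inr (e, i, v)\<close> stand for the coefficients in an expression of the generator \<open>e\<close> of \<open>I ^ (r + 1)\<close>
  through the reduction.\<close>

type_synonym 'n uvar = "('n \<times> nat) + (('n \<Rightarrow>\<^sub>0 nat) \<times> 'n \<times> ('n \<Rightarrow>\<^sub>0 nat))"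

type_synonym 'n upoly = "('n, ('n uvar, int) mpoly) mpoly"

definition lincomb :: "(nat \<Rightarrow> 'n \<Rightarrow>\<^sub>0 nat) \<Rightarrow> nat \<Rightarrow> ('n \<times> nat \<Rightarrow> ('n, 'c::comm_ring_1) mpoly) \<Rightarrow> 'n \<Rightarrow> ('n, 'c) mpoly"
  where "lincomb \<phi> m lam i = (\<Sum>j<m. lam (i, j) * mon (\<phi> j))"

definition ugen :: "(nat \<Rightarrow> 'n \<Rightarrow>\<^sub>0 nat) \<Rightarrow> nat \<Rightarrow> 'n \<Rightarrow> 'n upoly"
  where "ugen \<phi> m = lincomb \<phi> m (\<lambda>x. Const (Var (Inl x)))"

text \<open>The \<lambda> take polynomial values, because elements of a reduction are polynomial
  combinations of the generators; the auxiliary indeterminates take scalar values only.\<close>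

definition useval :: "('n \<times> nat \<Rightarrow> ('n, 'k::comm_ring_1) mpoly) \<Rightarrow>
    (('n \<Rightarrow>\<^sub>0 nat) \<times> 'n \<times> ('n \<Rightarrow>\<^sub>0 nat) \<Rightarrow> 'k) \<Rightarrow> 'n upoly \<Rightarrow> ('n, 'k) mpoly"
  where "useval lam a = peval (peval of_int (case_sum lam (\<lambda>t. Const (a t)))) Var"

text \<open>The product (G) I^r itself, without the summand m I^(r+1) of \<open>redset\<close>: the
  factor s of a chart replaces working modulo m.\<close>

definition red_ideal :: "('n \<Rightarrow>\<^sub>0 nat) set \<Rightarrow> ('n \<Rightarrow> ('n, 'c::comm_ring_1) mpoly) \<Rightarrow> nat \<Rightarrow> ('n, 'c) mpoly set"
  where "red_ideal F G r = ideal_gen {G i * p | i p. p \<in> mideal (pexp F r)}"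

lemma rhom_useval: "rhom (useval lam a)"
  unfolding useval_def by (rule rhom.rhom_peval[OF rhom.rhom_peval[OF rhom_of_int]])

lemma useval_Const: "useval lam a (Const t) = peval of_int (case_sum lam (\<lambda>t. Const (a t))) t"
  unfolding useval_def by (rule rhom.peval_Const[OF rhom.rhom_peval[OF rhom_of_int]])

lemma useval_mon: "useval lam a (mon e) = mon e"
  unfolding useval_def by (simp add: rhom.peval_mon[OF rhom.rhom_peval[OF rhom_of_int]] monval_Var)

lemma useval_ugen: "useval lam a (ugen \<phi> m i) = lincomb \<phi> m lam i"
  by (simp add: ugen_def lincomb_def rhom.sum[OF rhom_useval] rhom.mult[OF rhom_useval] useval_Const
      useval_mon rhom.peval_Var[OF rhom_of_int])

lemma red_ideal_iff:
  fixes G :: "'n::finite \<Rightarrow> ('n, 'c::comm_ring_1) mpoly"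
  shows "x \<in> red_ideal F G r \<longleftrightarrow> (\<exists>p. (\<forall>i. p i \<in> mideal (pexp F r)) \<and> x = (\<Sum>i\<in>UNIV. G i * p i))"
proof
  note P = is_ideal_pexp[of F r]
  assume "x \<in> red_ideal F G r"
  then show "\<exists>p. (\<forall>i. p i \<in> mideal (pexp F r)) \<and> x = (\<Sum>i\<in>UNIV. G i * p i)"
    unfolding red_ideal_def
  proof (induction rule: ring_module.span_induct_alt)
    case base
    show ?case using ring_module.subspace_0[OF P] by (intro exI[of _ "\<lambda>_. 0"]) simp
  next
    case (step c x y)
    then obtain i q p where x: "x = G i * q" "q \<in> mideal (pexp F r)"
      and y: "\<And>i. p i \<in> mideal (pexp F r)" "y = (\<Sum>j\<in>UNIV. G j * p j)" by auto
    have "(\<Sum>j\<in>UNIV. G j * (if j = i then c * q else 0)) = c * x"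
      by (subst sum.remove[of _ i]) (auto simp: x(1) mult_ac)
    moreover have "(if j = i then c * q else 0) + p j \<in> mideal (pexp F r)" for j
      using y(1) x(2) by (auto intro: ring_module.subspace_add[OF P] ring_module.subspace_scale[OF P])
    ultimately show ?case
      by (intro exI[of _ "\<lambda>j. (if j = i then c * q else 0) + p j"])
        (simp add: y(2) distrib_left sum.distrib)
  qed
next
  assume "\<exists>p. (\<forall>i. p i \<in> mideal (pexp F r)) \<and> x = (\<Sum>i\<in>UNIV. G i * p i)"
  then show "x \<in> red_ideal F G r"
    unfolding red_ideal_def by (auto intro!: ring_module.span_sum intro: ring_module.span_base)
qed

lemma red_ideal_subset:
  fixes G :: "'n::finite \<Rightarrow> ('n, 'c::comm_ring_1) mpoly"
  shows "red_ideal F G r \<subseteq> ideal_gen (range G)"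
  unfolding red_ideal_iff[abs_def] ideal_gen_range_iff[abs_def] subset_iff
  by (metis (no_types, lifting) mult.commute sum.cong)

lemma redset_range:
  fixes g :: "'n::finite \<Rightarrow> ('n, 'c::comm_ring_1) mpoly"
  assumes "x \<in> redset F (range g) r"
  shows "\<exists>p. (\<forall>i. p i \<in> mideal (pexp F r)) \<and>
    x - (\<Sum>i\<in>UNIV. g i * p i) \<in> mideal (nonmin (pexp F (Suc r)))"
proof -
  obtain y z where "x = y + z" and y: "y \<in> ideal_gen {h * p | h p. h \<in> range g \<and> p \<in> mideal (pexp F r)}"
    and z: "z \<in> ideal_gen (mideal (nonmin (pexp F (Suc r))))"
    using assms unfolding redset_def ring_module.span_Un by blast
  have "{h * p | h p. h \<in> range g \<and> p \<in> mideal (pexp F r)} = {g i * p | i p. p \<in> mideal (pexp F r)}"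
    by blast
  then have "y \<in> red_ideal F g r" using y by (simp only: red_ideal_def)
  moreover have "z \<in> mideal (nonmin (pexp F (Suc r)))"
    using z is_ideal_mideal[OF up_closed_nonmin[OF up_closed_pexp]] ring_module.span_eq_iff by blast
  ultimately show ?thesis
    unfolding red_ideal_iff using \<open>x = y + z\<close> by (metis add_diff_cancel_left')
qed

lemma in_pexp_1: "a \<in> F \<Longrightarrow> a \<in> pexp F (Suc 0)"
  by (simp add: pexp.simps) (metis add.right_neutral)

text \<open>The coefficients that express the minimal generators of I^(r+1) modulo m I^(r+1) become
  indeterminates whose actual values are kept in \<open>a\<close>. The universal relations then hold
  up to the ideal n of elements whose specialisation vanishes at the origin, and Nakayama for n
  yields s.\<close>

lemma ex_chart:
  fixes lam :: "'n \<times> nat \<Rightarrow> ('n::finite, 'k::field) mpoly"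
  assumes pow: "\<And>i. single i (n i) \<in> pexp (\<phi> ` {..<m}) 1"
    and red: "red (\<phi> ` {..<m}) (range (lincomb \<phi> m lam)) r"
  shows "\<exists>s a. lookup (useval lam a s) 0 \<noteq> 0 \<and>
    (\<forall>e\<in>pexp (\<phi> ` {..<m}) (Suc r). s * mon e \<in> red_ideal (\<phi> ` {..<m}) (ugen \<phi> m) r)"
proof -
  define F where "F = \<phi> ` {..<m}"
  define g where "g = lincomb \<phi> m lam"
  define E where "E = pexp F (Suc r) - nonmin (pexp F (Suc r))"
  have E: "finite E"
    unfolding E_def
    by (rule finite_minimal_pexp[OF pow, folded F_def])
  have "\<exists>p. (\<forall>i. p i \<in> mideal (pexp F r)) \<and>
      mon e - (\<Sum>i\<in>UNIV. g i * p i) \<in> mideal (nonmin (pexp F (Suc r)))" if "e \<in> E" for e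
  proof (rule redset_range)
    have "(mon e :: ('n, 'k) mpoly) \<in> mideal (pexp F (Suc r))" using that by (simp add: E_def)
    then show "mon e \<in> redset F (range g) r" using red unfolding red_def F_def g_def by blast
  qed
  then obtain p where p: "\<And>e i. e \<in> E \<Longrightarrow> p e i \<in> mideal (pexp F r)"
    "\<And>e. e \<in> E \<Longrightarrow> mon e - (\<Sum>i\<in>UNIV. g i * p e i) \<in> mideal (nonmin (pexp F (Suc r)))" by metis
  define a where "a = (\<lambda>(e, i, v). lookup (p e i) v)"
  define P :: "('n \<Rightarrow>\<^sub>0 nat) \<Rightarrow> 'n \<Rightarrow> 'n upoly"
    where "P e i = (\<Sum>v\<in>keys (p e i). Const (Var (Inr (e, i, v))) * mon v)" for e i
  have P: "P e i \<in> mideal (pexp F r)" if "e \<in> E" for e i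
    unfolding P_def using p(1)[OF that, of i]
    by (intro mideal_sum mideal_Const_mult) (auto simp: mideal_def mon_def)
  define ev where "ev t = lookup (peval of_int (case_sum lam (\<lambda>t. Const (a t))) t) 0" for t
  have hev: "rhom ev"
    unfolding ev_def by (rule rhom_comp[OF rhom.rhom_peval[OF rhom_of_int] rhom_lookup_0])
  note hc = rhom_cmap[OF hev]
  have ev_Var: "ev (Var x) = lookup (case_sum lam (\<lambda>t. Const (a t)) x) 0" for x
    by (simp add: ev_def rhom.peval_Var[OF rhom_of_int])
  \<comment> \<open>Only the constant terms of the coefficients matter modulo m: the difference
    between \<open>g i\<close> and \<open>g0 i\<close> lies in m I.\<close>
  define g0 where "g0 i = (\<Sum>j<m. Const (lookup (lam (i, j)) 0) * mon (\<phi> j))" for i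
  have cg: "cmap ev (ugen \<phi> m i) = g0 i" for i
    by (simp add: ugen_def lincomb_def g0_def rhom.sum[OF hc] rhom.mult[OF hc] cmap_Const[OF hev]
        cmap_mon[OF hev] ev_Var)
  have cP: "cmap ev (P e i) = p e i" for e i
  proof -
    have "cmap ev (P e i) = (\<Sum>v\<in>keys (p e i). Const (lookup (p e i) v) * mon v)"
      by (simp add: P_def rhom.sum[OF hc] rhom.mult[OF hc] cmap_Const[OF hev] cmap_mon[OF hev] ev_Var a_def)
        (simp add: Const_def)
    then show ?thesis by (simp only: mpoly_eq_sum[symmetric])
  qed
  have gg0: "(g i - g0 i) * q \<in> mideal (nonmin (pexp F (Suc r)))" if q: "q \<in> mideal (pexp F r)" for i q
  proof -
    have "g i - g0 i = (\<Sum>j<m. (lam (i, j) - Const (lookup (lam (i, j)) 0)) * mon (\<phi> j))"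
      by (simp add: g_def g0_def lincomb_def sum_subtractf left_diff_distrib)
    then have "(g i - g0 i) * q = (\<Sum>j<m. (lam (i, j) - Const (lookup (lam (i, j)) 0)) * (mon (\<phi> j) * q))"
      by (simp add: sum_distrib_right mult.assoc)
    also have "\<dots> \<in> mideal (nonmin (pexp F (Suc r)))"
    proof (rule mideal_sum)
      fix j assume j: "j \<in> {..<m}"
      have 1: "lam (i, j) - Const (lookup (lam (i, j)) 0) \<in> mideal {c. c \<noteq> 0}"
        by (auto simp: mideal_def in_keys_iff lookup_minus Const_def)
      have "mon (\<phi> j) * q \<in> mideal (pexp F (Suc r))"
        by (rule mideal_mult_in[of _ "{\<phi> j}" _ "pexp F r"])
          (use j q in \<open>auto simp: F_def pexp.simps\<close>)
      with 1 show "(lam (i, j) - Const (lookup (lam (i, j)) 0)) * (mon (\<phi> j) * q) \<in> mideal (nonmin (pexp F (Suc r)))"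
        by (rule mideal_mult_in) (unfold nonmin_def mem_Collect_eq, metis add.commute)
    qed
    finally show ?thesis .
  qed
  define n where "n = {x. lookup (useval lam a x) 0 = 0}"
  note hu = rhom_comp[OF rhom_useval[of lam a] rhom_lookup_0]
  have n: "is_ideal n"
    unfolding n_def
    by (rule ring_module.subspaceI) (auto simp: rhom.zero[OF hu] rhom.add[OF hu] rhom.mult[OF hu])
  define N where "N = red_ideal F (ugen \<phi> m) r"
  have N: "is_ideal N" unfolding N_def red_ideal_def by simp
  define Q where "Q e = mon e - (\<Sum>i\<in>UNIV. ugen \<phi> m i * P e i)" for e
  have ug: "ugen \<phi> m i \<in> mideal (pexp F 1)" for i
    unfolding ugen_def lincomb_def
    by (intro mideal_sum mideal_Const_mult) (auto simp: F_def intro: in_pexp_1)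
  have Q: "keys (Q e) \<subseteq> pexp F (Suc r)" if "e \<in> E" for e
  proof -
    have "Q e \<in> mideal (pexp F (Suc r))"
      unfolding Q_def using that pexp_mult[OF ug P[OF that]]
      by (intro mideal_diff mideal_sum) (auto simp: E_def)
    then show ?thesis by (simp add: mideal_def)
  qed
  \<comment> \<open>The specialisation of \<open>Q e\<close> lies in m I^(r+1), so it has no term at
    a minimal exponent.\<close>
  have evQ: "ev (lookup (Q e) c) = 0" if e: "e \<in> E" and c: "c \<in> E" for e c
  proof -
    have "ev (lookup (Q e) c) = lookup (cmap ev (Q e)) c"
      by (simp add: lookup_cmap rhom.zero[OF hev])
    also have "cmap ev (Q e) = mon e - (\<Sum>i\<in>UNIV. g0 i * p e i)"
      by (simp add: Q_def rhom.diff[OF hc] rhom.sum[OF hc] rhom.mult[OF hc] cmap_mon[OF hev] cg cP)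
    also have "\<dots> = (mon e - (\<Sum>i\<in>UNIV. g i * p e i)) + (\<Sum>i\<in>UNIV. (g i - g0 i) * p e i)" (is "_ = ?R")
      by (simp add: left_diff_distrib sum_subtractf)
    finally have "ev (lookup (Q e) c) = lookup ?R c" .
    moreover have "?R \<in> mideal (nonmin (pexp F (Suc r)))"
      by (intro mideal_add mideal_sum p(2) gg0 p(1) e)
    then have "c \<notin> keys ?R" using c unfolding E_def mideal_def by blast
    ultimately show ?thesis by (simp only: in_keys_iff not_not)
  qed
  \<comment> \<open>A fixed factorisation of every exponent through a minimal one sorts the terms of
    \<open>Q e\<close> into the entries \<open>D e e'\<close>.\<close>
  have "\<exists>f. c = fst f + snd f \<and> fst f \<in> E" if "c \<in> pexp F (Suc r)" for c
    using ex_minimal_exponent[OF that] by (auto simp: E_def)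
  then obtain mi where mi: "\<And>c. c \<in> pexp F (Suc r) \<Longrightarrow> c = fst (mi c) + snd (mi c)"
    "\<And>c. c \<in> pexp F (Suc r) \<Longrightarrow> fst (mi c) \<in> E" by metis
  define D where "D e e' = (\<Sum>c\<in>{c \<in> keys (Q e). fst (mi c) = e'}. Const (lookup (Q e) c) * mon (snd (mi c)))" for e e'
  have D: "D e e' \<in> n" if e: "e \<in> E" for e e'
    unfolding D_def
  proof (rule ring_module.subspace_sum[OF n])
    fix c assume c: "c \<in> {c \<in> keys (Q e). fst (mi c) = e'}"
    then have cE: "c \<in> pexp F (Suc r)" using Q[OF e] by blast
    have *: "lookup (useval lam a (Const (lookup (Q e) c) * mon (snd (mi c)))) 0
        = ev (lookup (Q e) c) * lookup (mon (snd (mi c))) 0"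
      by (simp add: rhom.mult[OF rhom_useval] useval_Const useval_mon rhom.mult[OF rhom_lookup_0] ev_def)
    show "Const (lookup (Q e) c) * mon (snd (mi c)) \<in> n"
    proof (cases "snd (mi c) = 0")
      case True
      then have "c \<in> E" using mi[OF cE] by simp
      then show ?thesis using * evQ[OF e] by (simp add: n_def)
    next
      case False
      then show ?thesis using * by (simp add: n_def lookup_0_mon)
    qed
  qed
  have sumD: "(\<Sum>e'\<in>E. D e e' * mon e') = Q e" if e: "e \<in> E" for e
  proof -
    have "(\<Sum>e'\<in>E. D e e' * mon e')
      = (\<Sum>e'\<in>E. \<Sum>c\<in>{c \<in> keys (Q e). fst (mi c) = e'}. Const (lookup (Q e) c) * mon c)"
      unfolding D_def sum_distrib_right
    proof (intro sum.cong refl)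
      fix e' c assume c: "c \<in> {c \<in> keys (Q e). fst (mi c) = e'}"
      then have "c = e' + snd (mi c)" using Q[OF e] mi(1)[of c] by auto
      then have "mon c = (mon e' * mon (snd (mi c)) :: 'n upoly)" by (metis mon_add)
      then show "Const (lookup (Q e) c) * mon (snd (mi c)) * mon e' = Const (lookup (Q e) c) * mon c"
        by (simp add: mult_ac)
    qed
    also have "\<dots> = (\<Sum>c\<in>keys (Q e). Const (lookup (Q e) c) * mon c)"
      by (rule sum.group) (use E Q[OF e] mi(2) in auto)
    finally show ?thesis by (simp only: mpoly_eq_sum[symmetric])
  qed
  have el: "mon e - (\<Sum>e'\<in>E. D e e' * mon e') \<in> N" if e: "e \<in> E" for e
  proof -
    have "mon e - (\<Sum>e'\<in>E. D e e' * mon e') = (\<Sum>i\<in>UNIV. ugen \<phi> m i * P e i)"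
      by (simp add: sumD[OF e] Q_def)
    then show ?thesis using P[OF e] unfolding N_def red_ideal_iff by blast
  qed
  have "\<exists>s. 1 - s \<in> n \<and> (\<forall>e\<in>E. s * mon e \<in> N)"
    by (rule nakayama_localized[where D = D, OF N n E]) (simp_all add: D el)
  then obtain s where s: "1 - s \<in> n" "\<And>e. e \<in> E \<Longrightarrow> s * mon e \<in> N" by blast
  have "lookup (useval lam a s) 0 = 1"
    using s(1) by (simp add: n_def rhom.diff[OF rhom_useval] rhom.one[OF rhom_useval] lookup_minus)
  moreover have "s * mon e \<in> N" if "e \<in> pexp F (Suc r)" for e
  proof -
    have "mon (snd (mi e)) * (s * mon (fst (mi e))) \<in> N"
      by (rule ring_module.subspace_scale[OF N s(2)]) (rule mi(2)[OF that])
    moreover have "mon (snd (mi e)) * (s * mon (fst (mi e))) = s * mon e"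
      using mi(1)[OF that] by (metis (no_types) mon_add mult.commute mult.left_commute)
    ultimately show ?thesis by simp
  qed
  ultimately show ?thesis unfolding N_def F_def by (metis one_neq_zero)
qed

text \<open>Each factor s trades one factor of I for some \<open>G i\<close>, as long as I^r is left
  over.\<close>

lemma red_ideal_power:
  fixes G :: "'n::finite \<Rightarrow> ('n, 'c::comm_ring_1) mpoly"
  assumes s: "\<And>e. e \<in> pexp F (Suc r) \<Longrightarrow> s * mon e \<in> red_ideal F G r"
    and p: "p \<in> mideal (pexp F (r + k))"
  shows "s ^ k * p \<in> ideal_gen {\<Prod>i\<in>UNIV. G i ^ u i | u. sum u UNIV = k}"
  using p
proof (induction k arbitrary: p)
  case 0
  have "(1 :: ('n, 'c) mpoly) \<in> {\<Prod>i\<in>UNIV. G i ^ u i | u. sum u UNIV = 0}"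
    by (intro CollectI exI[of _ "\<lambda>_. 0"]) simp
  then show ?case
    using ring_module.span_scale[OF ring_module.span_base, of 1 _ p] by simp
next
  case (Suc k)
  let ?I = "\<lambda>k. ideal_gen {\<Prod>i\<in>UNIV. G i ^ u i | u. sum u UNIV = k}"
  have G: "G i * x \<in> ?I (Suc k)" if "x \<in> ?I k" for i x
  proof -
    have "is_ideal {x. G i * x \<in> ?I (Suc k)}"
      by (auto simp: ring_module.subspace_def distrib_left ring_module.span_zero mult.left_commute[of "G i"]
          intro: ring_module.span_add ring_module.span_scale)
    moreover have "G i * (\<Prod>i\<in>UNIV. G i ^ u i) \<in> ?I (Suc k)" if "sum u UNIV = k" for u
    proof (rule ring_module.span_base)
      let ?v = "u(i := Suc (u i))"
      have "sum ?v UNIV = Suc k"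
        using that by (simp add: sum.remove[of UNIV i] )
      moreover have "(\<Prod>l\<in>UNIV. G l ^ ?v l) = G i * (\<Prod>l\<in>UNIV. G l ^ u l)"
        by (simp add: prod.remove[of UNIV i] mult.assoc)
      ultimately show "G i * (\<Prod>i\<in>UNIV. G i ^ u i) \<in> {\<Prod>i\<in>UNIV. G i ^ u i | u. sum u UNIV = Suc k}"
        by (intro CollectI exI[of _ ?v]) simp
    qed
    ultimately have "?I k \<subseteq> {x. G i * x \<in> ?I (Suc k)}"
      by (intro ring_module.span_minimal) auto
    then show ?thesis using that by blast
  qed
  have "is_ideal {p. s ^ Suc k * p \<in> ?I (Suc k)}"
    by (auto simp: ring_module.subspace_def distrib_left ring_module.span_zero mult.left_commute[of "s * s ^ k"]
        intro: ring_module.span_add ring_module.span_scale)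
  moreover have "s ^ Suc k * mon c \<in> ?I (Suc k)" if c: "c \<in> pexp F (r + Suc k)" for c
  proof -
    obtain a b where ab: "c = a + b" "a \<in> pexp F (Suc r)" "b \<in> pexp F k"
      using pexp_split[of c F "Suc r" k] c by auto
    obtain q where q: "\<And>i. q i \<in> mideal (pexp F r)" "s * mon a = (\<Sum>i\<in>UNIV. G i * q i)"
      using s[OF ab(2)] unfolding red_ideal_iff by blast
    have "s ^ Suc k * mon c = s ^ k * (mon b * (s * mon a))" by (simp add: ab(1) mon_add mult_ac)
    also have "\<dots> = (\<Sum>i\<in>UNIV. G i * (s ^ k * (q i * mon b)))"
      by (simp add: q(2) sum_distrib_left mult_ac)
    also have "\<dots> \<in> ?I (Suc k)"
    proof (rule ring_module.span_sum, rule G, rule Suc.IH)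
      fix i
      show "q i * mon b \<in> mideal (pexp F (r + k))"
        by (rule pexp_mult[OF q(1)]) (simp add: ab(3))
    qed
    finally show ?thesis .
  qed
  ultimately have "mideal (pexp F (r + Suc k)) \<subseteq> {p. s ^ Suc k * p \<in> ?I (Suc k)}"
    by (intro mideal_subset_ideal) auto
  then show ?case using Suc.prems by blast
qed

text \<open>Pigeonhole: among d * q factors from d elements, one element occurs at least q times.
  This accounts for the d in the exponents of \<alpha>.\<close>

lemma products_in_powers:
  fixes G :: "'n::finite \<Rightarrow> 'a::comm_ring_1"
  assumes "x \<in> ideal_gen {\<Prod>i\<in>UNIV. G i ^ u i | u. sum u UNIV = CARD('n) * q}"
  shows "x \<in> ideal_gen (range (\<lambda>j. G j ^ q))"
proof -
  have "(\<Prod>i\<in>UNIV. G i ^ u i) \<in> ideal_gen (range (\<lambda>j. G j ^ q))" if u: "sum u UNIV = CARD('n) * q" for u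
  proof -
    have "\<exists>j. q \<le> u j"
    proof (rule ccontr)
      assume "\<not> (\<exists>j. q \<le> u j)"
      then have "sum u UNIV < (\<Sum>j\<in>(UNIV :: 'n set). q)" by (intro sum_strict_mono) (auto simp: not_le)
      with u show False by simp
    qed
    then obtain j where j: "q \<le> u j" ..
    have "G j ^ u j = G j ^ (u j - q) * G j ^ q" using j by (simp flip: power_add)
    then have "(\<Prod>i\<in>UNIV. G i ^ u i) = ((\<Prod>i\<in>UNIV - {j}. G i ^ u i) * G j ^ (u j - q)) * G j ^ q"
      by (simp add: prod.remove[of UNIV j] mult_ac)
    also have "\<dots> \<in> ideal_gen (range (\<lambda>j. G j ^ q))"
      by (rule ring_module.span_scale, rule ring_module.span_base) blast
    finally show ?thesis .
  qed
  then have "ideal_gen {\<Prod>i\<in>UNIV. G i ^ u i | u. sum u UNIV = CARD('n) * q} \<subseteq> ideal_gen (range (\<lambda>j. G j ^ q))"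
    by (intro ring_module.span_minimal) auto
  then show ?thesis using assms by blast
qed

text \<open>The instance of the Briancon-Skoda theorem needed here. Since it is an identity between integer
  polynomials, it passes from integer values of the indeterminates to an arbitrary field.\<close>

lemma power_d_in_integer_reduction:
  fixes s :: "'n::finite upoly" and h :: "('n uvar, int) mpoly \<Rightarrow> 'k::field"
  assumes pow: "\<And>i. single i (n i) \<in> pexp F 1" and n: "\<And>i. 1 \<le> n i"
    and s: "\<And>e. e \<in> pexp F (Suc r) \<Longrightarrow> s * mon e \<in> red_ideal F G r"
    and M: "\<And>l. (\<Sum>j\<in>UNIV. M l j * G j) = s * Var l ^ (n l * Suc r)"
    and h: "rhom h" "h (lookup s 0) \<noteq> 0"
  shows "cmap h (dt M * mon (single i (CARD('n) * n i))) \<in> mideal (big (\<lambda>l. n l * Suc r))"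
proof -
  let ?b = "\<lambda>l. n l * Suc r"
  define d where "d = CARD('n)"
  define y :: "'n upoly" where "y = mon (single i (d * n i))"
  \<comment> \<open>The surplus from I^r: x^c times the q-th power of y has order r + d * q, so the
    multiplier c is independent of q, as the Frobenius argument requires.\<close>
  define c where "c = single i (r * n i)"
  have sq: "s ^ (d * q) * mon c * y ^ q \<in> ideal_gen (range (\<lambda>j. G j ^ q))" for q
  proof -
    have "single i ((r + d * q) * n i) = c + smul q (single i (d * n i))"
      by (rule poly_mapping_eqI) (simp add: c_def lookup_add lookup_single when_def algebra_simps)
    then have "mon c * y ^ q = mon (single i ((r + d * q) * n i))"
      by (simp add: y_def mon_smul mon_add)
    moreover have "(mon (single i ((r + d * q) * n i)) :: 'n upoly) \<in> mideal (pexp F (r + d * q))"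
      using pexp_single[OF pow] by simp
    ultimately have m: "mon c * y ^ q \<in> mideal (pexp F (r + d * q))" by simp
    have "s ^ (d * q) * (mon c * y ^ q) \<in> ideal_gen {\<Prod>i\<in>UNIV. G i ^ u i | u. sum u UNIV = d * q}"
      by (rule red_ideal_power[OF s m])
    then have "s ^ (d * q) * (mon c * y ^ q) \<in> ideal_gen (range (\<lambda>j. G j ^ q))"
      unfolding d_def by (rule products_in_powers)
    then show ?thesis by (simp only: mult.assoc)
  qed
  \<comment> \<open>The factor \<open>lookup s 0\<close> takes care of the integer points where the
    constant term of s vanishes and the Frobenius argument does not apply.\<close>
  have zero: "lookup (dt M * y) a * lookup s 0 = 0" if a: "a \<notin> big ?b" for a
  proof (rule poly_fun_zero)
    fix \<omega> :: "'n uvar \<Rightarrow> int"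
    define z where "z = peval (\<lambda>c::int. c) \<omega>"
    have z: "rhom z" unfolding z_def by (rule rhom.rhom_peval[OF rhom_id])
    note hz = rhom_cmap[OF z]
    show "peval (\<lambda>c. c) \<omega> (lookup (dt M * y) a * lookup s 0) = 0"
    proof (cases "z (lookup s 0) = 0")
      case False
      have "dt (\<lambda>l j. cmap z (M l j)) * cmap z y \<in> mideal (big ?b)"
      proof (rule frobenius_colon[where D = d and c = c])
        show "1 \<le> ?b l" for l using n[of l] by simp
        show "lookup (cmap z s) 0 \<noteq> 0" using False by (simp add: lookup_cmap rhom.zero[OF z])
        show "(\<Sum>j\<in>UNIV. cmap z (M l j) * cmap z (G j)) = cmap z s * Var l ^ ?b l" for l
        proof -
          have "(\<Sum>j\<in>UNIV. cmap z (M l j) * cmap z (G j)) = cmap z (\<Sum>j\<in>UNIV. M l j * G j)"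
            by (simp add: rhom.sum[OF hz] rhom.mult[OF hz])
          then show ?thesis unfolding M by (simp only: rhom.mult[OF hz] Var_power cmap_mon[OF z])
        qed
        show "cmap z s ^ (d * q) * mon c * cmap z y ^ q \<in> ideal_gen (range (\<lambda>j. cmap z (G j) ^ q))" for q
          using rhom.ideal_gen_image[OF hz sq[of q]]
          by (simp add: image_image rhom.mult[OF hz] rhom.power[OF hz] cmap_mon[OF z])
      qed
      then have "cmap z (dt M * y) \<in> mideal (big ?b)" by (simp add: rhom.mult[OF hz] rhom.dt[OF hz])
      then have "a \<notin> keys (cmap z (dt M * y))" using a unfolding mideal_def by blast
      then have "z (lookup (dt M * y) a) = 0" by (simp add: in_keys_iff lookup_cmap rhom.zero[OF z])
      then show ?thesis by (simp add: rhom.mult[OF z, unfolded z_def] z_def)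
    qed (simp add: rhom.mult[OF z, unfolded z_def] z_def)
  qed (simp add: infinite_UNIV_int)
  have "lookup (cmap h (dt M * y)) a = 0" if a: "a \<notin> big ?b" for a
  proof -
    have "h (lookup (dt M * y) a) * h (lookup s 0) = 0"
      by (simp only: rhom.mult[OF h(1), symmetric] zero[OF a] rhom.zero[OF h(1)])
    then show ?thesis using h by (simp add: lookup_cmap rhom.zero)
  qed
  then have "cmap h (dt M * y) \<in> mideal (big ?b)" by (auto simp: mideal_def in_keys_iff)
  then show ?thesis by (simp only: y_def d_def)
qed

text \<open>With the auxiliary indeterminates fixed at \<open>a\<close>, a coefficient of a
  universal polynomial becomes a polynomial over k in \<lambda> alone, hence a function on the
  parameter space.\<close>

definition ucoeff :: "(('n \<Rightarrow>\<^sub>0 nat) \<times> 'n \<times> ('n \<Rightarrow>\<^sub>0 nat) \<Rightarrow> 'k::comm_ring_1) \<Rightarrow>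
    ('n uvar, int) mpoly \<Rightarrow> ('n \<times> nat, 'k) mpoly"
  where "ucoeff a = peval of_int (case_sum Var (\<lambda>t. Const (a t)))"

lemma useval_const:
  fixes c :: "'n \<times> nat \<Rightarrow> 'k::comm_ring_1"
  shows "useval (\<lambda>x. Const (c x)) a P = cmap (peval of_int (case_sum c a)) P"
proof -
  have "peval of_int (case_sum (\<lambda>x. Const (c x)) (\<lambda>t. Const (a t))) q
      = (Const (peval of_int (case_sum c a) q) :: ('n, 'k) mpoly)" for q
    by (subst rhom_peval_comp[OF rhom_Const rhom_of_int])
      (auto simp: rhom.of_int[OF rhom_Const] intro!: arg_cong2[where f = "\<lambda>h v. peval h v q"] split: sum.split)
  then have "peval of_int (case_sum (\<lambda>x. Const (c x)) (\<lambda>t. Const (a t)))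
      = (\<lambda>q. Const (peval of_int (case_sum c a) q) :: ('n, 'k) mpoly)" by (rule ext)
  then show ?thesis by (simp only: useval_def cmap_def)
qed

lemma peval_ucoeff_Const:
  "peval Const lam (ucoeff a q) = peval of_int (case_sum lam (\<lambda>t. Const (a t))) q"
  unfolding ucoeff_def
  by (subst rhom_peval_comp[OF rhom.rhom_peval[OF rhom_Const] rhom_of_int])
    (auto simp: rhom.of_int[OF rhom_Const] rhom.peval_Const[OF rhom_Const] rhom.peval_Var[OF rhom_Const]
       rhom.of_int[OF rhom.rhom_peval[OF rhom_Const]]
      intro!: arg_cong2[where f = "\<lambda>h v. peval h v q"] split: sum.split)

lemma peval_ucoeff:
  "peval (\<lambda>c. c) c (ucoeff a q) = peval of_int (case_sum c a) q"
  unfolding ucoeff_def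
  by (subst rhom_peval_comp[OF rhom.rhom_peval[OF rhom_id] rhom_of_int])
    (auto simp: rhom.peval_Const[OF rhom_id] rhom.peval_Var[OF rhom_id]
       rhom.of_int[OF rhom.rhom_peval[OF rhom_id]]
      intro!: arg_cong2[where f = "\<lambda>h v. peval h v q"] split: sum.split)

lemma lookup_useval_const:
  "lookup (useval (\<lambda>x. Const (c x)) a P) e = peval (\<lambda>c. c) c (ucoeff a (lookup P e))"
  by (simp add: useval_const lookup_cmap rhom.zero[OF rhom.rhom_peval[OF rhom_of_int]] peval_ucoeff)

lemma lookup_Const_0: "lookup (Const c) 0 = c"
  by (simp add: Const_def)

text \<open>Evaluation at the origin commutes with substitution. Validity of a chart at polynomial
  \<lambda> therefore amounts to validity at the scalar point of their constant terms.\<close>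

lemma lookup_0_useval:
  "lookup (useval lam a P) 0 = peval (\<lambda>c. c) (\<lambda>x. lookup (lam x) 0) (ucoeff a (lookup P 0))"
proof -
  note h = rhom.rhom_peval[OF rhom_of_int, of "case_sum lam (\<lambda>t. Const (a t))"]
  have 1: "lookup (peval of_int (case_sum lam (\<lambda>t. Const (a t))) q) 0
      = peval of_int (case_sum (\<lambda>x. lookup (lam x) 0) a) q" for q
    by (subst rhom_peval_comp[OF rhom_lookup_0 rhom_of_int])
      (auto simp: rhom.of_int[OF rhom_lookup_0] lookup_Const_0
        intro!: arg_cong2[where f = "\<lambda>h v. peval h v q"] split: sum.split)
  have "lookup (useval lam a P) 0 = peval (\<lambda>q. lookup (peval of_int (case_sum lam (\<lambda>t. Const (a t))) q) 0) (\<lambda>x. lookup (Var x) 0) P"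
    unfolding useval_def by (rule rhom_peval_comp[OF rhom_lookup_0 h])
  also have "\<dots> = lookup (peval (\<lambda>q. Const (peval of_int (case_sum (\<lambda>x. lookup (lam x) 0) a) q)) Var P) 0"
    by (subst rhom_peval_comp[OF rhom_lookup_0 rhom_comp[OF rhom.rhom_peval[OF rhom_of_int] rhom_Const]])
      (simp add: 1 lookup_Const_0)
  also have "\<dots> = lookup (cmap (peval of_int (case_sum (\<lambda>x. lookup (lam x) 0) a)) P) 0"
    by (simp add: cmap_def)
  finally show ?thesis
    by (simp add: lookup_cmap rhom.zero[OF rhom.rhom_peval[OF rhom_of_int]] peval_ucoeff)
qed

text \<open>At polynomial \<lambda> a coefficient becomes a polynomial multiplying
  \<open>mon e\<close>. For e in \<open>E\<close> this does no harm because \<open>E\<close> is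
  up-closed, so only the coefficients outside \<open>E\<close> have to vanish.\<close>

lemma useval_in_mideal:
  assumes E: "up_closed E" and P: "\<And>e. e \<notin> E \<Longrightarrow> peval Const lam (ucoeff a (lookup P e)) = 0"
  shows "useval lam a P \<in> mideal E"
proof -
  have "useval lam a P = (\<Sum>e\<in>keys P. peval Const lam (ucoeff a (lookup P e)) * mon e)"
    by (simp add: useval_def peval_def[of _ Var] monval_Var peval_ucoeff_Const)
  also have "\<dots> \<in> mideal E"
  proof (rule mideal_sum)
    fix e
    show "peval Const lam (ucoeff a (lookup P e)) * mon e \<in> mideal E"
    proof (cases "e \<in> E")
      case True
      then show ?thesis by (intro ring_module.subspace_scale[OF is_ideal_mideal[OF E]]) simp
    next
      case False
      then show ?thesis
        by (simp add: P ring_module.subspace_0[OF is_ideal_mideal[OF E]])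
    qed
  qed
  finally show ?thesis .
qed

section \<open>The core of a monomial ideal\<close>

lemma is_ideal_mult [simp]: "is_ideal (ideal_mult A B)"
  by (simp add: ideal_mult_def)

lemma ideal_mult_mem: "a \<in> A \<Longrightarrow> b \<in> B \<Longrightarrow> a * b \<in> ideal_mult A B"
  unfolding ideal_mult_def by (rule ring_module.span_base) blast

lemma ideal_mult_mono: "A \<subseteq> A' \<Longrightarrow> ideal_mult A B \<subseteq> ideal_mult A' B"
  unfolding ideal_mult_def by (rule ring_module.span_mono) blast

lemma reduction_of_mideal_iff:
  fixes J :: "('x, 'c::comm_ring_1) mpoly set"
  shows "reduction_of J (mideal (pexp F 1)) \<longleftrightarrow> is_ideal J \<and> J \<subseteq> mideal (pexp F 1) \<and>
    (\<exists>r. mideal (pexp F (Suc r)) \<subseteq> ideal_mult J (mideal (pexp F r)))"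
proof -
  have "ideal_mult J (mideal (pexp F r)) \<subseteq> mideal (pexp F (Suc r))" if "J \<subseteq> mideal (pexp F 1)" for r
  proof -
    have "ideal_mult J (mideal (pexp F r)) \<subseteq> ideal_mult (mideal (pexp F 1)) (mideal (pexp F r))"
      by (rule ideal_mult_mono[OF that])
    also have "\<dots> \<subseteq> mideal (pexp F (Suc r))"
      unfolding ideal_mult_def using pexp_mult[of _ F 1 _ r]
      by (intro ring_module.span_minimal is_ideal_pexp) auto
    finally show ?thesis .
  qed
  then show ?thesis
    unfolding reduction_of_def ideal_power_mideal Suc_eq_plus1[symmetric] by blast
qed

lemma keys_tscale:
  fixes p :: "('x, 'c::idom) mpoly"
  shows "t \<noteq> 0 \<Longrightarrow> keys (tscale i t p) = keys p"
  by (auto simp: in_keys_iff lookup_tscale)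

lemma tscale_inverse:
  fixes p :: "('x, 'k::field) mpoly"
  shows "t \<noteq> 0 \<Longrightarrow> tscale i t (tscale i (inverse t) p) = p" "t \<noteq> 0 \<Longrightarrow> tscale i (inverse t) (tscale i t p) = p"
  by (rule poly_mapping_eqI, simp add: lookup_tscale power_mult_distrib[symmetric] mult.assoc[symmetric])+

text \<open>The torus preserves every monomial ideal and hence permutes the reductions of I. The
  preimage form says directly that the core is mapped into each \<open>J\<close>.\<close>

lemma reduction_of_torus_preimage:
  fixes J :: "('x, 'k::field) mpoly set"
  assumes t: "t \<noteq> 0" and J: "reduction_of J (mideal (pexp F 1))"
  shows "reduction_of {p. tscale i t p \<in> J} (mideal (pexp F 1))"
proof -
  let ?J = "{p. tscale i t p \<in> J}"
  note h = rhom_tscale[of i t] and g = rhom_tscale[of i "inverse t"]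
  obtain r where r: "is_ideal J" "J \<subseteq> mideal (pexp F 1)"
    "mideal (pexp F (Suc r)) \<subseteq> ideal_mult J (mideal (pexp F r))"
    using J unfolding reduction_of_mideal_iff by blast
  have keys: "tscale i u p \<in> mideal E \<longleftrightarrow> p \<in> mideal E" if "u \<noteq> 0" for u E and p :: "('x, 'k) mpoly"
    using that by (simp add: mideal_def keys_tscale)
  have "is_ideal ?J"
    by (rule ring_module.subspaceI)
      (auto simp: rhom.zero[OF h] rhom.add[OF h] rhom.mult[OF h] ring_module.subspace_0[OF r(1)]
        ring_module.subspace_add[OF r(1)] ring_module.subspace_scale[OF r(1)])
  moreover have "?J \<subseteq> mideal (pexp F 1)" using r(2) keys[OF t] by blast
  moreover have "mideal (pexp F (Suc r)) \<subseteq> ideal_mult ?J (mideal (pexp F r))"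
  proof
    fix x :: "('x, 'k) mpoly" assume "x \<in> mideal (pexp F (Suc r))"
    then have "tscale i t x \<in> ideal_mult J (mideal (pexp F r))" using r(3) keys[OF t] by blast
    then have "tscale i (inverse t) (tscale i t x)
        \<in> ideal_gen (tscale i (inverse t) ` {a * b | a b. a \<in> J \<and> b \<in> mideal (pexp F r)})"
      unfolding ideal_mult_def by (rule rhom.ideal_gen_image[OF g])
    moreover have "tscale i (inverse t) ` {a * b | a b. a \<in> J \<and> b \<in> mideal (pexp F r)}
        \<subseteq> {a * b | a b. a \<in> ?J \<and> b \<in> mideal (pexp F r)}"
    proof clarify
      fix a b :: "('x, 'k) mpoly" assume "a \<in> J" "b \<in> mideal (pexp F r)"
      then have "tscale i (inverse t) a \<in> ?J" "tscale i (inverse t) b \<in> mideal (pexp F r)"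
        using t by (simp_all add: tscale_inverse keys)
      then show "\<exists>a' b'. tscale i (inverse t) (a * b) = a' * b' \<and> a' \<in> ?J \<and> b' \<in> mideal (pexp F r)"
        by (metis rhom.mult[OF g])
    qed
    ultimately show "x \<in> ideal_mult ?J (mideal (pexp F r))"
      unfolding ideal_mult_def tscale_inverse(2)[OF t] using ring_module.span_mono by blast
  qed
  ultimately show ?thesis unfolding reduction_of_mideal_iff by blast
qed

lemma is_ideal_core: "is_ideal (ideal_core I)"
  unfolding ideal_core_def by (rule ring_module.subspace_Inter) (auto simp: reduction_of_def)

lemma core_monomial:
  fixes p :: "('x, 'k::field) mpoly"
  assumes inf: "infinite (UNIV :: 'k set)" and p: "p \<in> ideal_core (mideal (pexp F 1))" "a \<in> keys p"
  shows "(mon a :: ('x, 'k) mpoly) \<in> ideal_core (mideal (pexp F 1))"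
proof -
  let ?C = "ideal_core (mideal (pexp F 1)) :: ('x, 'k) mpoly set"
  note C = is_ideal_core[of "mideal (pexp F 1) :: ('x, 'k) mpoly set"]
  have "\<exists>c. c \<noteq> 0 \<and> single a c \<in> ?C"
  proof (rule torus_invariant_term[OF inf _ _ _ p])
    fix i and t :: 'k and p assume "t \<noteq> 0" "p \<in> ?C"
    then show "tscale i t p \<in> ?C"
      using reduction_of_torus_preimage[of t _ F i] unfolding ideal_core_def by blast
  qed (auto intro: ring_module.subspace_diff[OF C] ring_module.subspace_scale[OF C] simp del: One_nat_def)
  then obtain c where c: "c \<noteq> 0" "single a c \<in> ?C" by blast
  have "Const (inverse c) * single a c = mon a"
    using c(1) by (simp add: Const_def mon_def mult_single)
  with ring_module.subspace_scale[OF C c(2), of "Const (inverse c)"] show ?thesis by (simp only:)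
qed

lemma finite_subset_ideal_mult:
  assumes "x \<in> ideal_mult J P"
  shows "\<exists>G. finite G \<and> G \<subseteq> J \<and> x \<in> ideal_mult G P"
  using assms unfolding ideal_mult_def
proof (induction rule: ring_module.span_induct_alt)
  case base
  show ?case by (intro exI[of _ "{}"]) (auto simp: ring_module.span_zero)
next
  case (step c x y)
  then obtain a b G where ab: "x = a * b" "a \<in> J" "b \<in> P"
    and G: "finite G" "G \<subseteq> J" "y \<in> ideal_gen {a * b | a b. a \<in> G \<and> b \<in> P}" by blast
  have "y \<in> ideal_gen {a' * b | a' b. a' \<in> insert a G \<and> b \<in> P}"
    using G(3) ring_module.span_mono[of "{a * b | a b. a \<in> G \<and> b \<in> P}" "{a' * b | a' b. a' \<in> insert a G \<and> b \<in> P}"]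
    by blast
  moreover have "x \<in> ideal_gen {a' * b | a' b. a' \<in> insert a G \<and> b \<in> P}"
    by (rule ring_module.span_base) (use ab in blast)
  ultimately show ?case
    using G ab(2) by (intro exI[of _ "insert a G"]) (auto intro: ring_module.span_add ring_module.span_scale)
qed

text \<open>I^(r+1) has finitely many minimal generators, and each involves finitely many elements
  of \<open>J\<close>. Inserting 0 makes the set nonempty.\<close>

lemma reduction_red:
  fixes J :: "('n::finite, 'k::field) mpoly set"
  assumes pow: "\<And>i. single i (n i) \<in> pexp F 1" and J: "reduction_of J (mideal (pexp F 1))"
  shows "\<exists>G r. finite G \<and> G \<subseteq> J \<and> G \<noteq> {} \<and> red F G r"
proof -
  obtain r where r: "is_ideal J" "mideal (pexp F (Suc r)) \<subseteq> ideal_mult J (mideal (pexp F r))"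
    using J unfolding reduction_of_mideal_iff by blast
  define E where "E = pexp F (Suc r) - nonmin (pexp F (Suc r))"
  have E: "finite E"
    unfolding E_def
    by (rule finite_minimal_pexp[OF pow])
  have "\<exists>G. finite G \<and> G \<subseteq> J \<and> mon e \<in> ideal_mult G (mideal (pexp F r))" if "e \<in> E" for e
  proof (rule finite_subset_ideal_mult)
    have "(mon e :: ('n, 'k) mpoly) \<in> mideal (pexp F (Suc r))" using that by (simp add: E_def)
    then show "mon e \<in> ideal_mult J (mideal (pexp F r))" using r(2) by blast
  qed
  then obtain G where G: "\<And>e. e \<in> E \<Longrightarrow> finite (G e)" "\<And>e. e \<in> E \<Longrightarrow> G e \<subseteq> J"
    "\<And>e. e \<in> E \<Longrightarrow> mon e \<in> ideal_mult (G e) (mideal (pexp F r))" by metis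
  define G0 where "G0 = insert 0 (\<Union>e\<in>E. G e)"
  have sub: "ideal_mult G0 (mideal (pexp F r)) \<subseteq> redset F G0 r"
    unfolding ideal_mult_def redset_def by (rule ring_module.span_mono) blast
  have "mideal (pexp F (Suc r)) \<subseteq> redset F G0 r"
  proof (rule mideal_subset_ideal[OF is_ideal_redset])
    fix c assume "c \<in> pexp F (Suc r)"
    then obtain e c' where e: "c = e + c'" "e \<in> E" using ex_minimal_exponent[of c] unfolding E_def by blast
    have "ideal_mult (G e) (mideal (pexp F r)) \<subseteq> ideal_mult G0 (mideal (pexp F r))"
      by (rule ideal_mult_mono) (use e in \<open>auto simp: G0_def\<close>)
    then have "mon e \<in> redset F G0 r" using G(3)[OF e(2)] sub by blast
    then show "mon c \<in> redset F G0 r" unfolding e(1) by (rule ideal_mono_mon[OF is_ideal_redset])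
  qed
  moreover have "finite G0" "G0 \<subseteq> J" "G0 \<noteq> {}"
    unfolding G0_def using E G ring_module.subspace_0[OF r(1)] by auto
  ultimately show ?thesis unfolding red_def by blast
qed

text \<open>The data of a chart are polynomial in \<open>\<lambda>\<close>; where the constant term of \<open>s\<close> does not vanish,
  the specialized combinations generate a reduction locally at the origin.\<close>

definition chart :: "(nat \<Rightarrow> 'n::finite \<Rightarrow>\<^sub>0 nat) \<Rightarrow> nat \<Rightarrow> ('n \<Rightarrow> nat) \<Rightarrow> nat \<Rightarrow> 'n upoly \<Rightarrow> ('n \<Rightarrow> 'n \<Rightarrow> 'n upoly) \<Rightarrow> bool"
  where "chart \<phi> m n r s M \<longleftrightarrow>
    (\<forall>e\<in>pexp (\<phi> ` {..<m}) (Suc r). s * mon e \<in> red_ideal (\<phi> ` {..<m}) (ugen \<phi> m) r) \<and>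
    (\<forall>l. (\<Sum>j\<in>UNIV. M l j * ugen \<phi> m j) = s * Var l ^ (n l * Suc r))"

lemma ex_full_chart:
  fixes lam :: "'n \<times> nat \<Rightarrow> ('n::finite, 'k::field) mpoly"
  assumes pow: "\<And>i. single i (n i) \<in> pexp (\<phi> ` {..<m}) 1"
    and red: "red (\<phi> ` {..<m}) (range (lincomb \<phi> m lam)) r"
  shows "\<exists>s a M. lookup (useval lam a s) 0 \<noteq> 0 \<and> chart \<phi> m n r s M"
proof -
  obtain s a where s: "lookup (useval lam a s) 0 \<noteq> 0"
    "\<And>e. e \<in> pexp (\<phi> ` {..<m}) (Suc r) \<Longrightarrow> s * mon e \<in> red_ideal (\<phi> ` {..<m}) (ugen \<phi> m) r"
    using ex_chart[OF pow red] by blast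
  have "\<exists>q. s * Var l ^ (n l * Suc r) = (\<Sum>j\<in>UNIV. q j * ugen \<phi> m j)" for l
  proof -
    have "single l (n l * Suc r) \<in> pexp (\<phi> ` {..<m}) (Suc r)"
      using pexp_single[OF pow, of l "Suc r"] by (simp add: mult.commute)
    from s(2)[OF this] have "s * Var l ^ (n l * Suc r) \<in> ideal_gen (range (ugen \<phi> m))"
      unfolding Var_power using red_ideal_subset by blast
    then show ?thesis by (simp only: ideal_gen_range_iff)
  qed
  then have "\<forall>l. \<exists>q. s * Var l ^ (n l * Suc r) = (\<Sum>j\<in>UNIV. q j * ugen \<phi> m j)" by blast
  from choice[OF this] obtain M where "\<forall>l. s * Var l ^ (n l * Suc r) = (\<Sum>j\<in>UNIV. M l j * ugen \<phi> m j)" ..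
  then have "chart \<phi> m n r s M" using s(2) by (simp only: chart_def) blast
  with s(1) show ?thesis by blast
qed

lemma useval_chart:
  assumes "chart \<phi> m n r s M"
  shows "(\<Sum>j\<in>UNIV. useval lam a (M l j) * lincomb \<phi> m lam j) = useval lam a s * Var l ^ (n l * Suc r)"
proof -
  have "(\<Sum>j\<in>UNIV. useval lam a (M l j) * lincomb \<phi> m lam j) = useval lam a (\<Sum>j\<in>UNIV. M l j * ugen \<phi> m j)"
    by (simp add: rhom.sum[OF rhom_useval] rhom.mult[OF rhom_useval] useval_ugen)
  also have "\<dots> = useval lam a (s * Var l ^ (n l * Suc r))"
    using assms by (simp add: chart_def)
  finally show ?thesis by (simp add: rhom.mult[OF rhom_useval] Var_power useval_mon)
qed

lemma chart_colon:
  fixes lam :: "'n::finite \<times> nat \<Rightarrow> ('n, 'k::field) mpoly"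
  assumes "chart \<phi> m n r s M" "\<And>i. 1 \<le> n i" "lookup (useval lam a s) 0 \<noteq> 0"
    and "useval lam a (dt M) * y \<in> mideal (big (\<lambda>l. n l * Suc r))"
  shows "useval lam a s * y \<in> ideal_gen (range (lincomb \<phi> m lam))"
proof (rule transition_det_colon)
  show "1 \<le> n i * Suc r" for i using assms(2)[of i] by simp
qed (use assms(3,4) useval_chart[OF assms(1)] in \<open>simp_all add: rhom.dt[OF rhom_useval]\<close>)

text \<open>Scalar values of \<lambda> specialise coefficient by coefficient, so the integer
  identity applies. Polynomial values are reached only later, through identities in
  \<lambda>.\<close>

lemma chart_power_d:
  fixes c :: "'n::finite \<times> nat \<Rightarrow> 'k::field"
  assumes ch: "chart \<phi> m n r s M" and n: "\<And>i. 1 \<le> n i" and pow: "\<And>i. single i (n i) \<in> pexp (\<phi> ` {..<m}) 1"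
    and s: "lookup (useval (\<lambda>x. Const (c x)) a s) 0 \<noteq> 0"
  shows "useval (\<lambda>x. Const (c x)) a (dt M) * mon (single i (CARD('n) * n i)) \<in> mideal (big (\<lambda>l. n l * Suc r))"
proof -
  let ?h = "peval of_int (case_sum c a) :: ('n uvar, int) mpoly \<Rightarrow> 'k"
  have h: "rhom ?h" by (rule rhom.rhom_peval[OF rhom_of_int])
  have "cmap ?h (dt M * mon (single i (CARD('n) * n i))) \<in> mideal (big (\<lambda>l. n l * Suc r))"
    by (rule power_d_in_integer_reduction[OF pow n _ _ h])
      (use ch s in \<open>auto simp: chart_def useval_const lookup_cmap rhom.zero[OF h]\<close>)
  then show ?thesis
    by (simp add: useval_const rhom.mult[OF rhom_cmap[OF h]] cmap_mon[OF h])
qed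

text \<open>The direction opposite to \<open>chart_colon\<close>: on the combinations it is Cramer's
  rule, on the powers of the variables it is the Briancon-Skoda instance.\<close>

lemma chart_in_colon:
  fixes c :: "'n::finite \<times> nat \<Rightarrow> 'k::field"
  assumes ch: "chart \<phi> m n r s M" and n: "\<And>i. 1 \<le> n i" and pow: "\<And>i. single i (n i) \<in> pexp (\<phi> ` {..<m}) 1"
    and s: "lookup (useval (\<lambda>x. Const (c x)) a s) 0 \<noteq> 0"
    and y: "y \<in> ideal_gen (range (lincomb \<phi> m (\<lambda>x. Const (c x))) \<union> range (\<lambda>i. Var i ^ (CARD('n) * n i)))"
  shows "useval (\<lambda>x. Const (c x)) a (dt M) * y \<in> mideal (big (\<lambda>l. n l * Suc r))"
proof -
  let ?B = "mideal (big (\<lambda>l. n l * Suc r)) :: ('n, 'k) mpoly set"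
  let ?D = "useval (\<lambda>x. Const (c x)) a (dt M)"
  note B = is_ideal_mideal[OF up_closed_big[of "\<lambda>l. n l * Suc r"], where ?'b = 'k]
  have "is_ideal {y. ?D * y \<in> ?B}"
    by (auto simp: ring_module.subspace_def distrib_left ring_module.subspace_0[OF B]
        ring_module.subspace_add[OF B] mult.left_commute[of ?D] ring_module.subspace_scale[OF B]
        simp del: mult_Suc_right)
  moreover have "?D * lincomb \<phi> m (\<lambda>x. Const (c x)) j \<in> ?B" for j
  proof -
    have "lincomb \<phi> m (\<lambda>x. Const (c x)) j * dt (\<lambda>l j. useval (\<lambda>x. Const (c x)) a (M l j)) \<in> ?B"
    proof (rule dt_mult_in_ideal[OF B])
      fix l
      have "(Var l ^ (n l * Suc r) :: ('n, 'k) mpoly) \<in> ?B"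
        by (auto simp: Var_power big_def simp del: mult_Suc_right intro!: exI[of _ l])
      then show "(\<Sum>j\<in>UNIV. useval (\<lambda>x. Const (c x)) a (M l j) * lincomb \<phi> m (\<lambda>x. Const (c x)) j) \<in> ?B"
        unfolding useval_chart[OF ch] by (rule ring_module.subspace_scale[OF B])
    qed
    then show ?thesis by (simp only: rhom.dt[OF rhom_useval] mult.commute)
  qed
  moreover have "?D * Var i ^ (CARD('n) * n i) \<in> ?B" for i
    using chart_power_d[OF ch n pow s] by (simp only: Var_power)
  ultimately have "ideal_gen (range (lincomb \<phi> m (\<lambda>x. Const (c x))) \<union> range (\<lambda>i. Var i ^ (CARD('n) * n i)))
      \<subseteq> {y. ?D * y \<in> ?B}"
    by (intro ring_module.span_minimal) auto
  then show ?thesis using y by blast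
qed

section \<open>Nonvanishing loci and the Zariski topology\<close>

lemma ex_common_nonzero:
  fixes P :: "('x, 'k::field) mpoly set"
  assumes inf: "infinite (UNIV :: 'k set)" and "finite P" "\<And>F. F \<in> P \<Longrightarrow> \<exists>c. peval (\<lambda>c. c) c F \<noteq> 0"
  shows "\<exists>c. \<forall>F\<in>P. peval (\<lambda>c. c) c F \<noteq> 0"
proof -
  note e = rhom.rhom_peval[OF rhom_id]
  have "\<exists>c. peval (\<lambda>c. c) c (\<Prod>F\<in>P. F) \<noteq> 0"
    using assms(2,3)
  proof (induction P rule: finite_induct)
    case empty
    then show ?case by (simp add: rhom.one[OF e])
  next
    case (insert F P)
    obtain p where p: "peval (\<lambda>c. c) p F \<noteq> 0" using insert.prems[of F] by auto
    obtain q where q: "peval (\<lambda>c. c) q (\<Prod>F\<in>P. F) \<noteq> 0" using insert by auto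
    from common_nonzero_on_line[OF inf p q] show ?case
      using insert.hyps by (auto simp: rhom.mult[OF e])
  qed
  then show ?thesis using assms(2) by (auto simp: rhom.prod[OF e])
qed

text \<open>The universal ring has an indeterminate \<lambda> i j for every natural number j,
  whereas the parameter space has only the coordinates in \<open>X\<close>; the others are set to
  0.\<close>

definition restr :: "'x set \<Rightarrow> ('x, 'k::comm_ring_1) mpoly \<Rightarrow> ('x, 'k) mpoly"
  where "restr X = peval Const (\<lambda>x. if x \<in> X then Var x else 0)"

lemma keys_restr: "keys (restr X F) \<subseteq> {a. keys a \<subseteq> X}"
proof -
  let ?A = "{a :: 'a \<Rightarrow>\<^sub>0 nat. keys a \<subseteq> X}"
  have mult: "p * q \<in> mideal ?A" if "p \<in> mideal ?A" "q \<in> mideal ?A" for p q :: "('a, 'b) mpoly"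
    by (rule mideal_mult_in[OF that]) (auto simp: keys_add_nat)
  have one: "1 \<in> mideal ?A" by (simp add: mideal_def)
  have pw: "p ^ n \<in> mideal ?A" if "p \<in> mideal ?A" for p :: "('a, 'b) mpoly" and n
    by (induction n) (auto simp: one mult that)
  have pr: "(\<Prod>x\<in>S. f x) \<in> mideal ?A" if "\<And>x. x \<in> S \<Longrightarrow> f x \<in> mideal ?A" for S and f :: "'a \<Rightarrow> ('a, 'b) mpoly"
    using that by (induction S rule: infinite_finite_induct) (auto simp: one mult)
  have "restr X F \<in> mideal ?A"
    unfolding restr_def peval_def monval_def
    by (intro mideal_sum mideal_Const_mult pr pw) (auto simp: Var_def, simp add: mideal_def)
  then show ?thesis by (simp add: mideal_def)
qed

lemma peval_restr:
  "peval (\<lambda>c. c) c (restr X F) = peval (\<lambda>c. c) (\<lambda>x. if x \<in> X then c x else 0) F"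
proof -
  note e = rhom.rhom_peval[OF rhom_id]
  have "(\<lambda>x. peval (\<lambda>c. c) c (if x \<in> X then Var x else 0)) = (\<lambda>x. if x \<in> X then c x else 0)"
    by (auto simp: rhom.peval_Var[OF rhom_id] rhom.zero[OF e])
  then show ?thesis
    unfolding restr_def rhom_peval_comp[OF e rhom_Const] by (simp add: rhom.peval_Const[OF rhom_id])
qed

lemma peval_Const_restr:
  assumes "\<And>x. x \<notin> X \<Longrightarrow> lam x = 0"
  shows "peval Const lam (restr X F) = peval Const lam F"
proof -
  note e = rhom.rhom_peval[OF rhom_Const]
  have "(\<lambda>x. peval Const lam (if x \<in> X then Var x else 0)) = lam"
    using assms by (auto simp: rhom.peval_Var[OF rhom_Const] rhom.zero[OF e])
  then show ?thesis
    unfolding restr_def rhom_peval_comp[OF e rhom_Const] by (simp add: rhom.peval_Const[OF rhom_Const])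
qed

lemma zariski_principal_open:
  fixes F :: "('x, 'k::field) mpoly"
  assumes inf: "infinite (UNIV :: 'k set)" and X: "keys F \<subseteq> {a. keys a \<subseteq> X}"
    and p: "mpoly_eval p F \<noteq> 0"
  shows "zariski_open X {c \<in> affine_points X. mpoly_eval c F \<noteq> 0}"
    and "zariski_dense X {c \<in> affine_points X. mpoly_eval c F \<noteq> 0}"
proof -
  let ?U = "{c \<in> affine_points X. mpoly_eval c F \<noteq> 0}"
  have "affine_points X - ?U = {c \<in> affine_points X. \<forall>G\<in>{F}. mpoly_eval c G = 0}" by auto
  then show "zariski_open X ?U"
    unfolding zariski_open_def zariski_closed_def using X by (intro conjI exI[of _ "{F}"]) auto
  show "zariski_dense X ?U"
    unfolding zariski_dense_def
  proof (intro conjI allI impI)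
    fix Z assume Z: "zariski_closed X Z \<and> ?U \<subseteq> Z"
    then obtain P where P: "\<And>G. G \<in> P \<Longrightarrow> keys G \<subseteq> {a. keys a \<subseteq> X}"
      "Z = {c \<in> affine_points X. \<forall>G\<in>P. mpoly_eval c G = 0}"
      unfolding zariski_closed_def by blast
    have "mpoly_eval q G = 0" if q: "q \<in> affine_points X" and G: "G \<in> P" for q G
    proof (rule ccontr)
      assume Gq: "mpoly_eval q G \<noteq> 0"
      \<comment> \<open>Outside \<open>X\<close> the restricted point has the same default value as
        \<open>q\<close>, so the line through both remains in the affine space.\<close>
      define p' where "p' = restrict p X"
      have "mpoly_eval p' F = mpoly_eval p F"
        unfolding mpoly_eval_def p'_def
        by (intro sum.cong refl arg_cong2[where f = times] prod.cong arg_cong2[where f = power])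
          (use X in auto)
      then have "mpoly_eval p' F \<noteq> 0" using p by simp
      with Gq obtain t where t: "mpoly_eval (\<lambda>x. p' x + t * (q x - p' x)) F \<noteq> 0"
        "mpoly_eval (\<lambda>x. p' x + t * (q x - p' x)) G \<noteq> 0"
        using common_nonzero_on_line[OF inf, of p' F q G] unfolding mpoly_eval_eq_peval by blast
      have "(\<lambda>x. p' x + t * (q x - p' x)) \<in> affine_points X"
        using q by (auto simp: affine_points_def p'_def PiE_iff extensional_def)
      then show False using t Z G P(2) by blast
    qed
    then show "Z = affine_points X" unfolding P(2) by blast
  qed auto
qed

theorem theorem3p6:
  fixes I :: "('n::finite, 'k::field) mpoly set"
    and f :: "nat \<Rightarrow> ('n, 'k) mpoly"
    and m :: nat
    and n :: "'n \<Rightarrow> nat"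
    and \<alpha> :: "('n, 'k) mpoly set"
  assumes "infinite (UNIV :: 'k set)"
    and "monomial_ideal I"
    and "primary_to (ideal_gen (range Var)) I"
    and "inj_on f {..<m}"
    and "minimal_monomial_generators (f ` {..<m}) I"
    and "\<And>i. n i = (LEAST e. Var i ^ e \<in> I)"
    and "\<alpha> = range (\<lambda>i. Var i ^ (CARD('n) * n i))"
  shows "\<exists>U :: ('n \<times> nat \<Rightarrow> 'k) set.
    zariski_open (UNIV \<times> {..<m}) U \<and> zariski_dense (UNIV \<times> {..<m}) U \<and>
    (\<forall>c\<in>U. \<forall>J K.
      J = ideal_gen (range (\<lambda>i. \<Sum>j<m. Const (c (i, j)) * f j)) \<longrightarrow>
      K = ideal_gen (J \<union> \<alpha>) \<longrightarrow>
      ideal_core I = largest_monomial_subideal K \<and>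
      largest_monomial_subideal K =
        ideal_colon (ideal_gen \<alpha>)
          (smallest_monomial_superideal (ideal_colon (ideal_gen \<alpha>) K)))"
proof -
  note inf = assms(1)
  have "\<exists>e. f j = mon e" if "j < m" for j
    using assms(5) that unfolding minimal_monomial_generators_def by blast
  then obtain \<phi> where \<phi>: "\<And>j. j < m \<Longrightarrow> f j = mon (\<phi> j)" by metis
  define F where "F = \<phi> ` {..<m}"
  have fF: "f ` {..<m} = mon ` F" using \<phi> by (auto simp: F_def image_image)
  have I: "I = mideal (pexp F 1)"
    using assms(5) unfolding minimal_monomial_generators_def fF ideal_gen_mon_pexp by blast
  have idI: "is_ideal I" unfolding I by (rule is_ideal_pexp)
  have rad: "ideal_radical I = ideal_gen (range Var)" and "I \<noteq> UNIV"
    using assms(3) by (auto simp: primary_to_def primary_ideal_def)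
  have n_in: "Var i ^ n i \<in> I" for i
  proof -
    have "Var i \<in> ideal_radical I" unfolding rad by (rule ring_module.span_base) simp
    then have "\<exists>e. Var i ^ e \<in> I" by (simp add: ideal_radical_def)
    then show ?thesis unfolding assms(6) by (rule LeastI_ex)
  qed
  have n1: "1 \<le> n i" for i
  proof (rule ccontr)
    assume "\<not> 1 \<le> n i"
    then have "n i = 0" by simp
    then have "1 \<in> I" using n_in[of i] by simp
    then have "x \<in> I" for x using ring_module.subspace_scale[OF idI, of 1 x] by simp
    with \<open>I \<noteq> UNIV\<close> show False by blast
  qed
  have pow: "single i (n i) \<in> pexp F 1" for i
    using n_in[of i] unfolding I Var_power mon_in_mideal .
  define d where "d = CARD('n)"
  define b where "b i = d * n i" for i
  have b1: "1 \<le> b i" for i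
    using n1[of i] by (simp add: b_def d_def Suc_le_eq)
  have \<alpha>: "\<alpha> = range (\<lambda>i. Var i ^ b i)" unfolding assms(7) b_def d_def ..
  have \<alpha>B: "ideal_gen \<alpha> = mideal (big b)" unfolding \<alpha> by (rule ideal_gen_powers)
  define X :: "('n \<times> nat) set" where "X = UNIV \<times> {..<m}"
  \<comment> \<open>Points of affine space are \<open>undefined\<close> outside \<open>X\<close>;
    there they are given the value 0, in accordance with \<open>restr X\<close>.\<close>
  define ext :: "('n \<times> nat \<Rightarrow> 'k) \<Rightarrow> 'n \<times> nat \<Rightarrow> 'k"
    where "ext c = (\<lambda>x. if x \<in> X then c x else 0)" for c
  define gen where "gen lam = lincomb \<phi> m (lam :: 'n \<times> nat \<Rightarrow> ('n, 'k) mpoly)" for lam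
  define sp where "sp a c = useval (\<lambda>x. Const (ext c x)) a" for a and c
  define Kc where "Kc c = ideal_gen (range (gen (\<lambda>x. Const (ext c x))) \<union> \<alpha>)" for c
  have lookup_sp: "lookup (sp a c P) e = peval (\<lambda>c. c) c (restr X (ucoeff a (lookup P e)))" for a c P e
    unfolding sp_def lookup_useval_const peval_restr ext_def ..
  have K_id: "is_ideal (Kc c)" for c by (simp add: Kc_def)
  have BK: "mideal (big b) \<subseteq> Kc c" for c
    unfolding Kc_def \<alpha>B[symmetric] by (rule ring_module.span_mono) blast
  have large_K: "mon e \<in> Kc c" if "(\<Sum>i\<in>UNIV. b i) \<le> mdeg e" for c e
    using large_degree_in_big[OF that] BK mon_in_mideal by blast
  have in_K: "(mon e :: ('n, 'k) mpoly) \<in> Kc c"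
    if ch: "chart \<phi> m n r s M" and s: "lookup (sp a c s) 0 \<noteq> 0"
      and e: "sp a c (dt M) * mon e \<in> mideal (big (\<lambda>l. n l * Suc r))" for r s M a c e
  proof -
    have "sp a c s * mon e \<in> ideal_gen (range (gen (\<lambda>x. Const (ext c x))))"
      unfolding sp_def gen_def by (rule chart_colon[OF ch n1 s[unfolded sp_def] e[unfolded sp_def]])
    also have "\<dots> \<subseteq> Kc c" unfolding Kc_def by (rule ring_module.span_mono) blast
    finally show ?thesis using unit_cancel[OF K_id large_K s] by blast
  qed
  have K_colon: "sp a c (dt M) * y \<in> mideal (big (\<lambda>l. n l * Suc r))"
    if ch: "chart \<phi> m n r s M" and s: "lookup (sp a c s) 0 \<noteq> 0" and y: "y \<in> Kc c" for r s M a c y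
    unfolding sp_def
    by (rule chart_in_colon[OF ch n1 pow[unfolded F_def] s[unfolded sp_def]])
      (use y in \<open>simp add: Kc_def gen_def \<alpha> b_def d_def\<close>)

  \<comment> \<open>A chart that is valid at some scalar point\<close>
  obtain r1 s1 a1 M1 c1 where ch1: "chart \<phi> m n r1 s1 M1" and D1: "lookup (sp a1 c1 s1) 0 \<noteq> 0"
  proof -
    define V where "V = {p. \<exists>c. p = (\<Sum>j<m. Const (c j) * mon (\<phi> j) :: ('n, 'k) mpoly)}"
    have "V \<subseteq> mideal (pexp F 1)"
      unfolding V_def by (auto simp: F_def intro!: mideal_sum mideal_Const_mult in_pexp_1)
    moreover have "p - q \<in> V" if "p \<in> V" "q \<in> V" for p q
    proof -
      obtain c c' where "p = (\<Sum>j<m. Const (c j) * mon (\<phi> j))" "q = (\<Sum>j<m. Const (c' j) * mon (\<phi> j))"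
        using \<open>p \<in> V\<close> \<open>q \<in> V\<close> by (auto simp: V_def)
      then have "p - q = (\<Sum>j<m. Const (c j - c' j) * mon (\<phi> j))"
        by (simp add: rhom.diff[OF rhom_Const] left_diff_distrib sum_subtractf)
      then show ?thesis unfolding V_def by (intro CollectI exI[of _ "\<lambda>j. c j - c' j"])
    qed
    moreover have "Const x * p \<in> V" if "p \<in> V" for x p
    proof -
      obtain c where "p = (\<Sum>j<m. Const (c j) * mon (\<phi> j))" using \<open>p \<in> V\<close> by (auto simp: V_def)
      then have "Const x * p = (\<Sum>j<m. Const (x * c j) * mon (\<phi> j))"
        by (simp add: rhom.mult[OF rhom_Const] sum_distrib_left mult.assoc)
      then show ?thesis unfolding V_def by (intro CollectI exI[of _ "\<lambda>j. x * c j"])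
    qed
    moreover have "finite (mon ` F :: ('n, 'k) mpoly set)" by (simp add: F_def)
    moreover have "(mon ` F :: ('n, 'k) mpoly set) \<subseteq> V"
    proof
      fix p :: "('n, 'k) mpoly" assume "p \<in> mon ` F"
      then obtain l where l: "l < m" "p = mon (\<phi> l)" by (auto simp: F_def)
      have "(\<Sum>j<m. Const (if j = l then 1 else 0) * mon (\<phi> j)) = (\<Sum>j<m. if j = l then mon (\<phi> j) else (0 :: ('n, 'k) mpoly))"
        by (rule sum.cong) auto
      also have "\<dots> = p" using l by simp
      finally show "p \<in> V" unfolding V_def by (intro CollectI exI[of _ "\<lambda>j. if j = l then 1 else 0"]) simp
    qed
    moreover have "red F (mon ` F :: ('n, 'k) mpoly set) 0"
      unfolding red_def
    proof (rule mideal_subset_ideal[OF is_ideal_redset])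
      fix c assume "c \<in> pexp F (Suc 0)"
      then obtain u v where "c = u + v" "u \<in> F" by (auto simp: pexp.simps)
      then show "(mon c :: ('n, 'k) mpoly) \<in> redset F (mon ` F) 0"
        using redset_gen[of "mon u" "mon ` F" "mon v" F 0] by (simp add: mon_add)
    qed
    moreover have "(mon ` F :: ('n, 'k) mpoly set) \<noteq> {}"
      using pow by (auto simp: pexp.simps)
    ultimately obtain g :: "'n \<Rightarrow> ('n, 'k) mpoly" and r where g: "range g \<subseteq> V" "red F (range g) r"
      using ex_small_reduction[OF inf pow, of V "mon ` F" 0] by blast
    have "\<forall>i. \<exists>c. g i = (\<Sum>j<m. Const (c j) * mon (\<phi> j))" using g(1) unfolding V_def by blast
    from choice[OF this] obtain c where c: "\<forall>i. g i = (\<Sum>j<m. Const (c i j) * mon (\<phi> j))" ..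
    define c1 where "c1 = (\<lambda>(i, j). c i j)"
    have "lincomb \<phi> m (\<lambda>x. Const (ext c1 x)) i = g i" for i
      using c by (auto simp: lincomb_def ext_def X_def c1_def intro!: sum.cong)
    then have "red (\<phi> ` {..<m}) (range (lincomb \<phi> m (\<lambda>x. Const (ext c1 x)))) r"
      using g(2) by (simp add: F_def)
    from ex_full_chart[where n = n, OF pow[unfolded F_def] this] that show thesis
      unfolding sp_def by blast
  qed

  \<comment> \<open>From the colon condition at scalar points to membership in every
    reduction\<close>
  define good where "good e \<longleftrightarrow> (\<forall>c. lookup (sp a1 c s1) 0 \<noteq> 0 \<longrightarrow>
    sp a1 c (dt M1) * mon e \<in> mideal (big (\<lambda>l. n l * Suc r1)))" for e
  have good_core: "mon e \<in> ideal_core I" if e: "good e" for e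
    unfolding ideal_core_def
  proof
    fix J assume "J \<in> {J. reduction_of J I}"
    then have J: "reduction_of J (mideal (pexp F 1))" by (simp add: I)
    then obtain r0 where J': "is_ideal J" "J \<subseteq> mideal (pexp F 1)"
      "mideal (pexp F (Suc r0)) \<subseteq> ideal_mult J (mideal (pexp F r0))"
      unfolding reduction_of_mideal_iff by blast
    have "ideal_mult J (mideal (pexp F r0)) \<subseteq> J"
      unfolding ideal_mult_def
    proof (rule ring_module.span_minimal[OF _ J'(1)], clarify)
      fix a b assume "a \<in> J"
      then show "a * b \<in> J"
        using ring_module.subspace_scale[OF J'(1), of a b] by (simp only: mult.commute)
    qed
    then have large: "mideal (pexp F (Suc r0)) \<subseteq> J" using J'(3) by blast
    have "mon (single i (Suc r0 * n i)) \<in> J" for i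
      using large pexp_single[OF pow] mon_in_mideal by blast
    from large_degree_in_ideal[OF J'(1) this]
    obtain B where B: "\<And>a. B \<le> mdeg a \<Longrightarrow> mon a \<in> J" by blast
    obtain G r' where G: "finite G" "G \<subseteq> J" "G \<noteq> {}" "red F G r'"
      using reduction_red[OF pow J] by blast
    obtain g :: "'n \<Rightarrow> ('n, 'k) mpoly" and r where g: "range g \<subseteq> J" "red F (range g) r"
      using ex_small_reduction[OF inf pow J'(2) _ _ G(1,2,4,3)]
        ring_module.subspace_diff[OF J'(1)] ring_module.subspace_scale[OF J'(1)] by blast
    \<comment> \<open>The coefficients are polynomials here: J is an arbitrary reduction, and its
      elements need not be scalar combinations.\<close>
    have "\<forall>i. \<exists>q. g i = (\<Sum>j<m. q j * mon (\<phi> j))"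
    proof
      fix i
      have "g i \<in> ideal_gen ((\<lambda>j. mon (\<phi> j)) ` {..<m})"
        using g(1) J'(2) unfolding ideal_gen_mon_pexp[symmetric] F_def image_image by blast
      then show "\<exists>q. g i = (\<Sum>j<m. q j * mon (\<phi> j))" by (simp only: ideal_gen_image_iff[OF finite_lessThan])
    qed
    from choice[OF this] obtain q where q: "\<forall>i. g i = (\<Sum>j<m. q i j * mon (\<phi> j))" ..
    define \<mu> where "\<mu> = (\<lambda>x. if x \<in> X then q (fst x) (snd x) else 0)"
    have \<mu>: "lincomb \<phi> m \<mu> = g"
      using q by (auto simp: lincomb_def \<mu>_def X_def fun_eq_iff intro!: sum.cong)
    have "red (\<phi> ` {..<m}) (range (lincomb \<phi> m \<mu>)) r" using g(2) by (simp add: \<mu> F_def)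
    from ex_full_chart[where n = n, OF pow[unfolded F_def] this]
    obtain s2 a2 M2 where D2: "lookup (useval \<mu> a2 s2) 0 \<noteq> 0" and ch2: "chart \<phi> m n r s2 M2" by blast
    let ?D1 = "restr X (ucoeff a1 (lookup s1 0))" and ?D2 = "restr X (ucoeff a2 (lookup s2 0))"
    have D1': "\<exists>c. peval (\<lambda>c. c) c ?D1 \<noteq> 0" using D1 unfolding lookup_sp by blast
    have D2': "\<exists>c. peval (\<lambda>c. c) c ?D2 \<noteq> 0"
    proof -
      have "(\<lambda>x. if x \<in> X then lookup (\<mu> x) 0 else 0) = (\<lambda>x. lookup (\<mu> x) 0)"
        by (auto simp: \<mu>_def)
      then have "peval (\<lambda>c. c) (\<lambda>x. lookup (\<mu> x) 0) ?D2 \<noteq> 0"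
        using D2 by (simp only: peval_restr lookup_0_useval not_False_eq_True)
      then show ?thesis by (intro exI[of _ "\<lambda>x. lookup (\<mu> x) 0"])
    qed
    have "useval \<mu> a2 (dt M2 * mon e) \<in> mideal (big (\<lambda>l. n l * Suc r))"
    proof (rule useval_in_mideal[OF up_closed_big])
      fix e' assume e': "e' \<notin> big (\<lambda>l. n l * Suc r)"
      let ?q = "restr X (ucoeff a2 (lookup (dt M2 * mon e) e'))"
      \<comment> \<open>Otherwise some scalar point c makes both charts valid and \<open>?q\<close>
        nonzero. There the first chart puts \<open>mon e\<close> into \<open>Kc c\<close>, and the
        second one then forces the coefficient at e' to vanish. Once \<open>?q\<close> is the zero
        polynomial, it vanishes at the polynomial value \<mu> as well.\<close>
      have "?q = 0"
      proof (rule ccontr)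
        assume "?q \<noteq> 0"
        then have "\<exists>c. peval (\<lambda>c. c) c ?q \<noteq> 0" using poly_fun_zero[OF inf] by blast
        with D1' D2' obtain c where c: "\<forall>F\<in>{?D1, ?D2, ?q}. peval (\<lambda>c. c) c F \<noteq> 0"
          using ex_common_nonzero[OF inf, of "{?D1, ?D2, ?q}"] by auto
        then have s: "lookup (sp a1 c s1) 0 \<noteq> 0" "lookup (sp a2 c s2) 0 \<noteq> 0"
          "lookup (sp a2 c (dt M2 * mon e)) e' \<noteq> 0" unfolding lookup_sp by auto
        have "sp a1 c (dt M1) * mon e \<in> mideal (big (\<lambda>l. n l * Suc r1))"
          using e s(1) unfolding good_def by blast
        then have "mon e \<in> Kc c" by (rule in_K[OF ch1 s(1)])
        then have "sp a2 c (dt M2) * mon e \<in> mideal (big (\<lambda>l. n l * Suc r))"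
          by (rule K_colon[OF ch2 s(2)])
        then have "sp a2 c (dt M2 * mon e) \<in> mideal (big (\<lambda>l. n l * Suc r))"
          by (simp only: sp_def rhom.mult[OF rhom_useval] useval_mon)
        then have "e' \<notin> keys (sp a2 c (dt M2 * mon e))" using e' unfolding mideal_def by blast
        with s(3) show False by (simp only: in_keys_iff not_not)
      qed
      moreover have "\<mu> x = 0" if "x \<notin> X" for x using that by (simp add: \<mu>_def)
      ultimately show "peval Const \<mu> (ucoeff a2 (lookup (dt M2 * mon e) e')) = 0"
        using peval_Const_restr[of X \<mu> "ucoeff a2 (lookup (dt M2 * mon e) e')"]
        by (simp add: rhom.zero[OF rhom.rhom_peval[OF rhom_Const]])
    qed
    then have "useval \<mu> a2 (dt M2) * mon e \<in> mideal (big (\<lambda>l. n l * Suc r))"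
      by (simp only: rhom.mult[OF rhom_useval] useval_mon)
    from chart_colon[OF ch2 n1 D2 this]
    have "useval \<mu> a2 s2 * mon e \<in> ideal_gen (range g)" unfolding \<mu> .
    also have "\<dots> \<subseteq> J" using g(1) J'(1) by (rule ring_module.span_minimal)
    finally show "mon e \<in> J" using unit_cancel[OF J'(1) B D2] by blast
  qed

  \<comment> \<open>The open set of general coefficients\<close>
  define bad where "bad = {e. e \<notin> big b \<and> \<not> good e}"
  \<comment> \<open>Exponents in \<open>big b\<close> can be left out because their monomials lie in
    every \<open>Kc c\<close>; finitely many open conditions remain.\<close>
  have "finite bad" using finite_box[of b] by (rule rev_finite_subset) (auto simp: bad_def)
  have "\<exists>e'. e' \<notin> big (\<lambda>l. n l * Suc r1) \<and>
      (\<exists>c. peval (\<lambda>c. c) c (restr X (ucoeff a1 (lookup (dt M1 * mon e) e'))) \<noteq> 0)" if e: "e \<in> bad" for e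
  proof -
    obtain c where c: "lookup (sp a1 c s1) 0 \<noteq> 0"
      "sp a1 c (dt M1) * mon e \<notin> mideal (big (\<lambda>l. n l * Suc r1))"
      using e unfolding bad_def good_def by blast
    then have "sp a1 c (dt M1 * mon e) \<notin> mideal (big (\<lambda>l. n l * Suc r1))"
      by (simp only: sp_def rhom.mult[OF rhom_useval] useval_mon not_False_eq_True)
    then obtain e' where "e' \<in> keys (sp a1 c (dt M1 * mon e))" "e' \<notin> big (\<lambda>l. n l * Suc r1)"
      unfolding mideal_def by blast
    then show ?thesis unfolding in_keys_iff lookup_sp by blast
  qed
  then obtain w where w: "\<And>e. e \<in> bad \<Longrightarrow> w e \<notin> big (\<lambda>l. n l * Suc r1)"
    "\<And>e. e \<in> bad \<Longrightarrow> \<exists>c. peval (\<lambda>c. c) c (restr X (ucoeff a1 (lookup (dt M1 * mon e) (w e)))) \<noteq> 0"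
    by metis
  define Q where "Q = insert (ucoeff a1 (lookup s1 0)) ((\<lambda>e. ucoeff a1 (lookup (dt M1 * mon e) (w e))) ` bad)"
  \<comment> \<open>Nonvanishing of \<Phi> says that the chart is valid and that each bad monomial e
    violates the colon condition at this very point, through its coefficient at
    \<open>w e\<close>.\<close>
  define \<Phi> where "\<Phi> = restr X (\<Prod>F\<in>Q. F)"
  have finQ: "finite Q" using \<open>finite bad\<close> by (simp add: Q_def)
  have \<Phi>: "mpoly_eval c \<Phi> \<noteq> 0 \<longleftrightarrow> (\<forall>F\<in>Q. peval (\<lambda>c. c) c (restr X F) \<noteq> 0)" for c
    unfolding mpoly_eval_eq_peval \<Phi>_def peval_restr
    using finQ by (simp add: rhom.prod[OF rhom.rhom_peval[OF rhom_id]])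
  have "\<exists>c. \<forall>F\<in>restr X ` Q. peval (\<lambda>c. c) c F \<noteq> 0"
  proof (rule ex_common_nonzero[OF inf])
    fix G assume "G \<in> restr X ` Q"
    then show "\<exists>c. peval (\<lambda>c. c) c G \<noteq> 0"
      using w(2) D1 unfolding Q_def lookup_sp by blast
  qed (use finQ in simp)
  then obtain p where p: "mpoly_eval p \<Phi> \<noteq> 0" unfolding \<Phi> by blast
  define U where "U = {c \<in> affine_points X. mpoly_eval c \<Phi> \<noteq> 0}"
  have "keys \<Phi> \<subseteq> {a. keys a \<subseteq> X}" unfolding \<Phi>_def by (rule keys_restr)
  note zar = zariski_principal_open[OF inf this p, folded U_def]

  \<comment> \<open>Core and largest monomial subideal at a general point\<close>
  have main: "ideal_core I = largest_monomial_subideal (Kc c)" if c: "c \<in> U" for c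
  proof -
    have D1c: "lookup (sp a1 c s1) 0 \<noteq> 0"
      using c unfolding U_def \<Phi> Q_def lookup_sp by blast
    have mon_core: "mon e \<in> ideal_core I" if e: "mon e \<in> Kc c" for e
    proof (rule good_core, cases "e \<in> big b")
      case True
      then have "mon e \<in> Kc c'" for c' using BK mon_in_mideal by blast
      then show "good e" unfolding good_def using K_colon[OF ch1] by blast
    next
      case False
      show "good e"
      proof (rule ccontr)
        assume "\<not> good e"
        then have bad: "e \<in> bad" using False by (simp add: bad_def)
        then have "lookup (sp a1 c (dt M1 * mon e)) (w e) \<noteq> 0"
          using c unfolding U_def \<Phi> Q_def lookup_sp by blast
        moreover have "sp a1 c (dt M1 * mon e) \<in> mideal (big (\<lambda>l. n l * Suc r1))"
          using K_colon[OF ch1 D1c e] by (simp only: sp_def rhom.mult[OF rhom_useval] useval_mon)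
        then have "w e \<notin> keys (sp a1 c (dt M1 * mon e))" using w(1)[OF bad] unfolding mideal_def by blast
        ultimately show False by (simp only: in_keys_iff not_not)
      qed
    qed
    \<comment> \<open>The chart gives s1 * I^(r1+1) inside K I^r1. The powers in \<alpha> put all
      monomials of large degree into that product, so s1 can be cancelled and the equation holds
      globally, not just at the origin.\<close>
    have "reduction_of (Kc c) (mideal (pexp F 1))"
      unfolding reduction_of_mideal_iff
    proof (intro conjI exI[of _ r1])
      show "Kc c \<subseteq> mideal (pexp F 1)"
        unfolding Kc_def
      proof (intro ring_module.span_minimal is_ideal_pexp Un_least image_subsetI)
        show "gen (\<lambda>x. Const (ext c x)) i \<in> mideal (pexp F 1)" for i
          unfolding gen_def lincomb_def by (auto simp: F_def intro!: mideal_sum mideal_Const_mult in_pexp_1)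
        show "\<alpha> \<subseteq> mideal (pexp F 1)"
        proof -
          have "single i (b i) \<in> pexp F 1" for i
          proof -
            have "1 \<le> d" by (simp add: d_def Suc_le_eq)
            then show ?thesis using pexp_single[OF pow, of i d] pexp_antimono[of 1 d F] unfolding b_def by blast
          qed
          then show ?thesis by (auto simp: \<alpha> Var_power)
        qed
      qed
      let ?L = "ideal_mult (Kc c) (mideal (pexp F r1))"
      let ?h = "peval of_int (case_sum (ext c) a1) :: ('n uvar, int) mpoly \<Rightarrow> 'k"
      have h: "rhom ?h" by (rule rhom.rhom_peval[OF rhom_of_int])
      have sp: "sp a1 c = cmap ?h" by (simp add: sp_def useval_const fun_eq_iff)
      have "mon (single i (b i + r1 * n i)) \<in> ?L" for i
      proof -
        have "(mon (single i (b i)) :: ('n, 'k) mpoly) \<in> Kc c"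
          by (rule subsetD[OF BK]) (auto simp: big_def intro!: exI[of _ i])
        moreover have "(mon (single i (r1 * n i)) :: ('n, 'k) mpoly) \<in> mideal (pexp F r1)"
          using pexp_single[OF pow] by simp
        ultimately show ?thesis unfolding single_add mon_add by (rule ideal_mult_mem)
      qed
      from large_degree_in_ideal[OF is_ideal_mult this]
      obtain B where B: "\<And>a. B \<le> mdeg a \<Longrightarrow> mon a \<in> ?L" by blast
      have sub: "ideal_gen (sp a1 c ` {ugen \<phi> m i * p | i p. p \<in> mideal (pexp F r1)}) \<subseteq> ?L"
      proof (rule ring_module.span_minimal[OF _ is_ideal_mult], clarify)
        fix i and p :: "'n upoly" assume "p \<in> mideal (pexp F r1)"
        then have "sp a1 c p \<in> mideal (pexp F r1)"
          using keys_cmap[of ?h p] rhom.zero[OF h] by (auto simp: sp mideal_def)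
        moreover have "sp a1 c (ugen \<phi> m i) \<in> Kc c"
          unfolding sp_def useval_ugen Kc_def gen_def by (rule ring_module.span_base) blast
        ultimately show "sp a1 c (ugen \<phi> m i * p) \<in> ?L"
          unfolding sp_def rhom.mult[OF rhom_useval] by (intro ideal_mult_mem)
      qed
      show "mideal (pexp F (Suc r1)) \<subseteq> ?L"
      proof (rule mideal_subset_ideal[OF is_ideal_mult])
        fix e assume "e \<in> pexp F (Suc r1)"
        then have "s1 * mon e \<in> red_ideal F (ugen \<phi> m) r1" using ch1 by (simp add: chart_def F_def)
        then have "sp a1 c (s1 * mon e) \<in> ?L"
          using rhom.ideal_gen_image[OF rhom_cmap[OF h]] sub unfolding red_ideal_def sp by blast
        then have "sp a1 c s1 * mon e \<in> ?L"
          by (simp only: sp_def rhom.mult[OF rhom_useval] useval_mon)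
        then show "mon e \<in> ?L" using unit_cancel[OF is_ideal_mult B D1c] by blast
      qed
    qed (rule K_id)
    then have core_K: "ideal_core I \<subseteq> Kc c" unfolding ideal_core_def I by blast
    show ?thesis
      unfolding largest_monomial_subideal_eq[OF K_id]
    proof (rule antisym)
      show "ideal_core I \<subseteq> ideal_gen (Kc c \<inter> range mon)"
      proof
        fix p assume p: "p \<in> ideal_core I"
        have "mon u \<in> Kc c \<inter> range mon" if "u \<in> keys p" for u
          using core_monomial[OF inf p[unfolded I] that] core_K unfolding I by blast
        then have "mideal (keys p) \<subseteq> ideal_gen (Kc c \<inter> range mon)"
          by (intro mideal_subset_ideal ring_module.subspace_span) (auto intro: ring_module.span_base)
        then show "p \<in> ideal_gen (Kc c \<inter> range mon)" by (auto simp: mideal_def)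
      qed
      show "ideal_gen (Kc c \<inter> range mon) \<subseteq> ideal_core I"
        by (rule ring_module.span_minimal[OF _ is_ideal_core]) (use mon_core in auto)
    qed
  qed
  have K_eq: "ideal_gen (ideal_gen (range (\<lambda>i. \<Sum>j<m. Const (c (i, j)) * f j)) \<union> \<alpha>) = Kc c" for c
  proof -
    have g: "gen (\<lambda>x. Const (ext c x)) = (\<lambda>i. \<Sum>j<m. Const (c (i, j)) * f j)"
      by (auto simp: gen_def lincomb_def ext_def X_def \<phi> fun_eq_iff intro!: sum.cong)
    show ?thesis unfolding Kc_def g
      by (intro antisym ring_module.span_minimal ring_module.subspace_span Un_least ring_module.span_mono)
        (auto intro: ring_module.span_base)
  qed
  show ?thesis
  proof (intro exI[of _ U] conjI ballI allI impI)
    show "zariski_open (UNIV \<times> {..<m}) U" "zariski_dense (UNIV \<times> {..<m}) U"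
      using zar unfolding X_def by auto
    fix c J K assume c: "c \<in> U" and J: "J = ideal_gen (range (\<lambda>i. \<Sum>j<m. Const (c (i, j)) * f j))"
      and K: "K = ideal_gen (J \<union> \<alpha>)"
    have K': "K = Kc c" unfolding K J by (rule K_eq)
    show "ideal_core I = largest_monomial_subideal K" unfolding K' by (rule main[OF c])
    show "largest_monomial_subideal K = ideal_colon (ideal_gen \<alpha>)
        (smallest_monomial_superideal (ideal_colon (ideal_gen \<alpha>) K))"
      unfolding K' \<alpha>B by (rule monomial_colon_formula[OF K_id b1 BK])
  qed
qed

end
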